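(* Let $M$ be a complex manifold and let $\widehat{\mathbb N}=\mathbb N\cup\{\infty\}$, $M'=\widehat{\mathbb N}\times M$. For every $n\in\widehat{\mathbb N}$ let $\mathscr F_n=\{f_{n,\lambda}:\lambda\in M\}\subset \mathrm{Hol}^*_b(\mathbb C)$ be a family of entire functions depending holomorphically on $\lambda\in M$; write $f_\lambda:=f_{\infty,\lambda}$. Assume that for every $n\in\widehat{\mathbb N}$ the singular values of all maps in $\mathscr F_n$ are holomorphically parametrized by $M$, and that the map $F:M'\to\mathrm{Hol}^*_b(\mathbb C)$, $(n,\lambda)\mapsto f_{n,\lambda}$, is continuous with respect to the metrics $\chi_{M'}$ and $\chi_{\mathrm{dyn}}$. Let $\widetilde H\subset M$ be a kernel of a sequence $(H_n)$ where each $H_n$ is a connected component of $\mathcal H(\mathscr F_n)$. Then exactly one of the following statements holds: (i) $f_\lambda\in\mathscr F_\infty$ is not nonescaping-hyperbolic for any $\lambda\in\widetilde H$; (ii) there is a connected component $H_\infty$ of $\mathcal H(\mathscr F_\infty)$ such that $\widetilde H=H_\infty$.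
   Context: $\mathrm{Hol}^*(\mathbb C)$ is the set of entire functions that are neither constant nor linear (i.e. polynomials of degree $\ge 2$ and transcendental entire functions). The set $S(f)$ of singular values of $f$ is the smallest closed set in $\mathbb C$ such that $f:\mathbb C\setminus f^{-1}(S(f))\to\mathbb C\setminus S(f)$ is a covering map (equivalently, the closure of the set of critical values and finite asymptotic values). $\mathrm{Hol}^*_b(\mathbb C)=\{f\in\mathrm{Hol}^*(\mathbb C): S(f)\text{ bounded}\}$. The postsingular set is $P(f)=\overline{\bigcup_{n\ge0}f^n(S(f))}$ (closure in $\mathbb C$). The Fatou set $\mathcal F(f)\subset\mathbb C$ is the set of points having a neighbourhood on which the iterates $(f^n)$ form a normal family in the sense of Montel. $f\in\mathrm{Hol}^*(\mathbb C)$ is nonescaping-hyperbolic if $P(f)$ is a bounded subset of $\mathcal F(f)$. Metric: $\chi_{\mathrm{dyn}}(f,g)=\chi_{\mathrm{luc}}(f,g)+d_H(S(f),S(g))$ on $\mathrm{Hol}^*(\mathbb C)$, where $\chi_{\mathrm{luc}}$ is a metric on the space of entire functions inducing the topology of locally uniform convergence, and $d_H(A,B)=\inf\{\varepsilon>0: A\subset U_\varepsilon(B),\ B\subset U_\varepsilon(A)\}$ is the Hausdorff distance with respect to the spherical metric, $U_\varepsilon$ denoting $\varepsilon$-neighbourhoods. On $\widehat{\mathbb N}$ put $\chi_{\widehat{\mathbb N}}(m,n)=2^{-\min(m,n)-1}$ for $m\ne n$ and $0$ otherwise. $M$ carries a metric $\chi_M$ (inducing its topology), and $\chi_{M'}((m,\lambda),(n,\nu))=\chi_{\widehat{\mathbb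 N}}(m,n)+\chi_M(\lambda,\nu)$. The singular values of the maps in $\mathscr F_n$ are holomorphically parametrized by $M$ if for every $\lambda_0\in M$ and every $s\in S(f_{n,\lambda_0})$ there is a holomorphic map $w_n:M\to\mathbb C$ with $w_n(\lambda_0)=s$ and $w_n(\lambda)\in S(f_{n,\lambda})$ for all $\lambda\in M$. $\mathcal H(\mathscr F_n)=\{\lambda\in M: f_{n,\lambda}\text{ is nonescaping-hyperbolic}\}$. Kernel: let $O_n\subset M$ be open connected sets (defined for all sufficiently large $n\in\mathbb N$) containing a common point $o\in M$. The kernel of $(O_n)$ with respect to the marked point $o$ is the largest open connected set $O\ni o$ such that each compact $K\subset O$ is contained in all but finitely many $O_n$ (it exists iff some neighbourhood of $o$ lies in all but finitely many $O_n$). A kernel of $(O_n)$ is a kernel with respect to some marked point. *)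

theory Defs
  imports "HOL-Complex_Analysis.Complex_Analysis" "HOL-Library.Extended_Nat"
begin

section \<open>Complex manifolds\<close>

text \<open>The set \<open>S\<close> is meant to be relatively open in a coordinate subspace of the complex
  space; for open \<open>S\<close> this is complex differentiability in several variables.\<close>

definition holomorphic_sv :: "(complex ^ 'n \<Rightarrow> complex) \<Rightarrow> (complex ^ 'n) set \<Rightarrow> bool" where
  "holomorphic_sv h S \<longleftrightarrow>
     (\<forall>p\<in>S. \<exists>L. Vector_Spaces.linear (*s) (*) L \<and> (h has_derivative L) (at p within S))"

definition coord_subspace :: "'n set \<Rightarrow> (complex ^ 'n) set" where
  "coord_subspace I = {v. \<forall>i. i \<notin> I \<longrightarrow> v $ i = 0}"

text \<open>The manifold is the whole type \<open>'m\<close>, whose distance plays the role of \<open>\<chi>\<^sub>M\<close>. A chart is a pair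
  of a domain and a coordinate map. The complex dimension is the cardinality of the index set
  \<open>I\<close>; taking coordinate subspaces as model spaces makes dimension zero available, which
  finite index types alone would exclude. The manifold need not be connected.\<close>

definition complex_atlas :: "('m::metric_space set \<times> ('m \<Rightarrow> complex ^ 'n)) set \<Rightarrow> bool" where
  "complex_atlas \<A> \<longleftrightarrow>
     (\<exists>I. \<forall>(U, \<phi>)\<in>\<A>. open U \<and> openin (top_of_set (coord_subspace I)) (\<phi> ` U) \<and>
            homeomorphism U (\<phi> ` U) \<phi> (inv_into U \<phi>)) \<and>
     (\<Union>(U, \<phi>)\<in>\<A>. U) = UNIV \<and>
     (\<forall>(U, \<phi>)\<in>\<A>. \<forall>(V, \<psi>)\<in>\<A>. \<forall>i.
        holomorphic_sv (\<lambda>v. \<psi> (inv_into U \<phi> v) $ i) (\<phi> ` (U \<inter> V)))"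

definition holomorphic_mfd ::
    "('m::metric_space set \<times> ('m \<Rightarrow> complex ^ 'n)) set \<Rightarrow> ('m \<Rightarrow> complex) \<Rightarrow> bool" where
  "holomorphic_mfd \<A> g \<longleftrightarrow> (\<forall>(U, \<phi>)\<in>\<A>. holomorphic_sv (\<lambda>v. g (inv_into U \<phi> v)) (\<phi> ` U))"


section \<open>Entire functions and nonescaping-hyperbolicity\<close>

definition entire :: "(complex \<Rightarrow> complex) set" where
  "entire = {f. f holomorphic_on UNIV}"

definition Hol_star :: "(complex \<Rightarrow> complex) set" where
  "Hol_star = {f \<in> entire. \<not> (\<exists>a b. \<forall>z. f z = a * z + b)}"

text \<open>For nonconstant entire \<open>f\<close> the least such set exists: it is the complement of the set of
  points that have an evenly covered open neighbourhood. The requirement in \<open>covering_space\<close> that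
  \<open>f\<close> be onto is harmless, since the range of \<open>f\<close> is dense.\<close>

definition sing_vals :: "(complex \<Rightarrow> complex) \<Rightarrow> complex set" where
  "sing_vals f = (LEAST S. closed S \<and> covering_space (UNIV - f -` S) f (UNIV - S))"

definition Hol_star_b :: "(complex \<Rightarrow> complex) set" where
  "Hol_star_b = {f \<in> Hol_star. bounded (sing_vals f)}"

definition postsing :: "(complex \<Rightarrow> complex) \<Rightarrow> complex set" where
  "postsing f = closure (\<Union>n. (f ^^ n) ` sing_vals f)"

text \<open>The limit function may be the constant \<open>\<infinity>\<close>; the second disjunct is locally uniform
  convergence to it.\<close>

definition normal_family :: "complex set \<Rightarrow> (complex \<Rightarrow> complex) set \<Rightarrow> bool" where
  "normal_family U \<F> \<longleftrightarrow>
     (\<forall>\<sigma>. range \<sigma> \<subseteq> \<F> \<longrightarrow>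
        (\<exists>r :: nat \<Rightarrow> nat. strict_mono r \<and>
          ((\<exists>g. g holomorphic_on U \<and>
                (\<forall>K. compact K \<and> K \<subseteq> U \<longrightarrow> uniform_limit K (\<sigma> \<circ> r) g sequentially)) \<or>
           (\<forall>K B. compact K \<and> K \<subseteq> U \<longrightarrow>
                (\<forall>\<^sub>F n in sequentially. \<forall>z\<in>K. B < norm (\<sigma> (r n) z))))))"

definition Fatou :: "(complex \<Rightarrow> complex) \<Rightarrow> complex set" where
  "Fatou f = {z. \<exists>U. open U \<and> z \<in> U \<and> normal_family U (range (\<lambda>n. f ^^ n))}"

definition nonescaping_hyperbolic :: "(complex \<Rightarrow> complex) \<Rightarrow> bool" where
  "nonescaping_hyperbolic f \<longleftrightarrow>
     f \<in> Hol_star \<and> bounded (postsing f) \<and> postsing f \<subseteq> Fatou f"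


section \<open>Metrics\<close>

definition luc_metric :: "((complex \<Rightarrow> complex) \<Rightarrow> (complex \<Rightarrow> complex) \<Rightarrow> real) \<Rightarrow> bool" where
  "luc_metric d \<longleftrightarrow> Metric_space entire d \<and>
     (\<forall>\<U>. openin (Metric_space.mtopology entire d) \<U> \<longleftrightarrow>
        \<U> \<subseteq> entire \<and>
        (\<forall>f\<in>\<U>. \<exists>K \<epsilon>. compact K \<and> \<epsilon> > 0 \<and>
           {g \<in> entire. \<forall>z\<in>K. dist (f z) (g z) < \<epsilon>} \<subseteq> \<U>))"

text \<open>Geodesic distance on the sphere for the metric \<open>2 |dz| / (1 + |z|\<^sup>2)\<close>; the argument of the
  arc sine is half the chordal distance.\<close>

definition sph_dist :: "complex \<Rightarrow> complex \<Rightarrow> real" where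
  "sph_dist z w = 2 * arcsin (norm (z - w) / (sqrt (1 + norm z ^ 2) * sqrt (1 + norm w ^ 2)))"

definition sph_nbhd :: "real \<Rightarrow> complex set \<Rightarrow> complex set" where
  "sph_nbhd \<epsilon> A = {z. \<exists>a\<in>A. sph_dist z a < \<epsilon>}"

definition Hausdorff_dist :: "complex set \<Rightarrow> complex set \<Rightarrow> real" where
  "Hausdorff_dist A B = Inf {\<epsilon>. \<epsilon> > 0 \<and> A \<subseteq> sph_nbhd \<epsilon> B \<and> B \<subseteq> sph_nbhd \<epsilon> A}"

definition chi_dyn :: "((complex \<Rightarrow> complex) \<Rightarrow> (complex \<Rightarrow> complex) \<Rightarrow> real) \<Rightarrow>
    (complex \<Rightarrow> complex) \<Rightarrow> (complex \<Rightarrow> complex) \<Rightarrow> real" where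
  "chi_dyn d f g = d f g + Hausdorff_dist (sing_vals f) (sing_vals g)"

definition chi_enat :: "enat \<Rightarrow> enat \<Rightarrow> real" where
  "chi_enat m n = (if m = n then 0 else (1 / 2) ^ (the_enat (min m n) + 1))"

definition chi_prod :: "enat \<times> 'm::metric_space \<Rightarrow> enat \<times> 'm \<Rightarrow> real" where
  "chi_prod p q = chi_enat (fst p) (fst q) + dist (snd p) (snd q)"

definition continuous_wrt ::
    "('a \<Rightarrow> 'a \<Rightarrow> real) \<Rightarrow> ('b \<Rightarrow> 'b \<Rightarrow> real) \<Rightarrow> ('a \<Rightarrow> 'b) \<Rightarrow> bool" where
  "continuous_wrt d d' F \<longleftrightarrow>
     (\<forall>x. \<forall>\<epsilon>>0. \<exists>\<delta>>0. \<forall>y. d x y < \<delta> \<longrightarrow> d' (F x) (F y) < \<epsilon>)"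


section \<open>Families, hyperbolic loci and kernels\<close>

definition sing_vals_parametrized :: "('m::metric_space set \<times> ('m \<Rightarrow> complex ^ 'n)) set \<Rightarrow>
    ('m \<Rightarrow> complex \<Rightarrow> complex) \<Rightarrow> bool" where
  "sing_vals_parametrized \<A> f \<longleftrightarrow>
     (\<forall>l0. \<forall>s \<in> sing_vals (f l0).
        \<exists>w. holomorphic_mfd \<A> w \<and> w l0 = s \<and> (\<forall>l. w l \<in> sing_vals (f l)))"

definition hyp_locus :: "('m \<Rightarrow> complex \<Rightarrow> complex) \<Rightarrow> 'm set" where
  "hyp_locus f = {l. nonescaping_hyperbolic (f l)}"

definition kernel_candidate ::
    "(nat \<Rightarrow> 'm::topological_space set) \<Rightarrow> 'm \<Rightarrow> 'm set \<Rightarrow> bool" where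
  "kernel_candidate W p V \<longleftrightarrow> open V \<and> connected V \<and> p \<in> V \<and>
     (\<forall>K. compact K \<and> K \<subseteq> V \<longrightarrow> (\<forall>\<^sub>F n in sequentially. K \<subseteq> W n))"

definition is_kernel :: "(nat \<Rightarrow> 'm::topological_space set) \<Rightarrow> 'm set \<Rightarrow> bool" where
  "is_kernel W V \<longleftrightarrow>
     (\<exists>p. kernel_candidate W p V \<and> (\<forall>V'. kernel_candidate W p V' \<longrightarrow> V' \<subseteq> V))"

end

theory Submission
  imports Defs
begin

text \<open>
  Call a singular value \<open>s\<close> of \<open>f\<close> attracted if \<open>f\<^sup>p\<^sup>m(s)\<close> converges to an attracting fixed point of
  some \<open>f\<^sup>p\<close>. A map with bounded singular set is nonescaping-hyperbolic if and only if all its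
  singular values are attracted; this condition is stable under perturbation in the sense of the
  metric \<open>\<chi>\<^sub>d\<^sub>y\<^sub>n\<close>, so a hyperbolic component of the limit family that meets the kernel is contained in it.

  For the converse it suffices to consider a complex disc \<open>D\<close> in the kernel, so that \<open>f\<^sub>n\<^sub>,\<^sub>t\<close> is hyperbolic
  for all \<open>t \<in> D\<close> and all large finite \<open>n\<close>, and a parameter in \<open>D\<close> where the limit map is hyperbolic.
  Let \<open>w\<^sub>k(t)\<close> be the orbit of a moving singular value of \<open>f\<^sub>n\<^sub>,\<^sub>t\<close>. The set of periods of the cycle that
  attracts it does not depend on \<open>t\<close>. If \<open>w\<^sub>k\<close> meets both \<open>w\<^sub>i\<close> and \<open>w\<^sub>j\<close> for \<open>i < j < k\<close>, then \<open>k - i\<close> and \<open>k - j\<close>,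
  hence \<open>j - i\<close>, are such periods, and \<open>w\<^sub>i = w\<^sub>j\<close> at the first meeting point. Therefore \<open>w\<^sub>k\<close> omits two of
  \<open>w\<^sub>0\<close>, \<open>w\<^sub>1\<close>, \<open>w\<^sub>2\<close> wherever these are distinct, and Montel's theorem bounds the orbits uniformly in \<open>n\<close> and \<open>k\<close>.
  By Vitali's theorem the singular orbits of the limit maps
  converge to moving cycles on all of \<open>D\<close>. Such a cycle cannot become repelling unless the orbit lands
  on it identically; and since every attracting, not superattracting, cycle attracts an infinite
  singular orbit, it stays attracting in that case as well.
\<close>

section \<open>Normal families\<close>

text \<open>Hyperbolicity of the approximating maps gives no bound uniform in the index: as
  \<open>n\<close> grows, their attracting cycles might run off to infinity or have unbounded
  periods. The uniformity has to come from Montel's theorem, but there are no fixed values that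
  moving singular orbits avoid. The beginning of the orbit itself has to supply moving values, and
  arithmetic of periods decides which of them are avoided. Three points are taken because one of
  them may be hit. Coincidences among them occur on a countable set of parameters, whose removal
  does not disconnect the disc, or else identically; in the latter case the orbit is eventually
  periodic throughout and carries no information on the multiplier of its cycle, so that a second
  singular value is called for. Attraction is used in place of the Fatou set because it can be
  perturbed and continued one singular value at a time. Several arguments on a single map end in the
  same contradiction: an injective entire function is affine.\<close>

lemma injective_entire_imp_linear:
  assumes hol: "f holomorphic_on UNIV" and inj: "inj f"
  shows "\<exists>a b. \<forall>z. f z = a * z + b"
proof -
  define h where "h = (\<lambda>z. if z = 0 then deriv f 0 else (f z - f 0) / (z - 0))"
  have holh: "h holomorphic_on UNIV"
    unfolding h_def by (rule pole_lemma_open[OF hol open_UNIV])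
  have d0: "deriv f 0 \<noteq> 0"
    using holomorphic_injective_imp_regular[OF hol open_UNIV inj] by simp
  have h0: "h z \<noteq> 0" for z
    using d0 inj by (auto simp: h_def inj_eq)
  have "open (f ` ball 0 1)"
    using open_mapping_thm3[of f "ball 0 1"] holomorphic_on_subset[OF hol] inj
    by (auto intro: inj_on_subset)
  then obtain \<delta> where \<delta>: "\<delta> > 0" "ball (f 0) \<delta> \<subseteq> f ` ball 0 1"
    unfolding open_contains_ball by (metis centre_in_ball image_eqI zero_less_one)
  \<comment> \<open>Points outside the unit disc avoid the \<open>\<delta>\<close>-disc around
    \<open>f 0\<close>, which is already covered from inside. Hence \<open>1 / h\<close> grows at
    most linearly, is affine by Liouville, and, having no zero, constant.\<close>
  have far: "norm (f z - f 0) \<ge> \<delta>" if "1 \<le> norm z" for z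
  proof (rule ccontr)
    assume "\<not> ?thesis"
    then have "f z \<in> f ` ball 0 1" using \<delta>(2) by (auto simp: dist_norm norm_minus_commute)
    then show False using inj that by (auto simp: inj_eq)
  qed
  have holq: "(\<lambda>z. 1 / h z) holomorphic_on UNIV"
    using holh h0 by (auto intro!: holomorphic_intros)
  have bq: "norm (1 / h z) \<le> (1 / \<delta>) * norm z ^ 1" if "1 \<le> norm z" for z
  proof -
    have "norm (1 / h z) = norm z / norm (f z - f 0)"
      using that by (auto simp: h_def norm_divide)
    also have "\<dots> \<le> norm z / \<delta>"
      using far[OF that] \<delta>(1) by (intro divide_left_mono) (auto intro!: mult_pos_pos)
    finally show ?thesis by simp
  qed
  define c0 c1 where "c0 = 1 / h 0" and "c1 = deriv (\<lambda>z. 1 / h z) 0"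
  have q: "1 / h z = c0 + c1 * z" for z
    using Liouville_polynomial[OF holq bq, of 1 z] by (simp add: c0_def c1_def)
  have "c1 = 0"
  proof (rule ccontr)
    assume "c1 \<noteq> 0"
    then have "c0 + c1 * (- c0 / c1) = 0" by simp
    then have "1 / h (- c0 / c1) = 0" using q by metis
    then show False using h0 by simp
  qed
  then have "h z = h 0" for z using q[of z] h0[of z] h0[of 0] by (simp add: c0_def)
  then have hz: "h z = deriv f 0" for z by (metis h_def)
  have "f z = deriv f 0 * z + f 0" for z
  proof (cases "z = 0")
    case False
    then have "(f z - f 0) / z = deriv f 0" using hz[of z] by (simp add: h_def)
    then show ?thesis using False by (simp add: field_simps)
  qed simp
  then show ?thesis by blast
qed

text \<open>Schottky's theorem on the closed unit disc is rescaled to the radius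
  \<open>3 * R / 4\<close>, which stays inside the open ball and sends the disc of radius
  \<open>R / 2\<close> to radius \<open>2 / 3\<close>. The constant is
  \<open>26 = 2 + 12 * (2/3) / (1 - 2/3)\<close>.\<close>

lemma schottky_ball:
  assumes hol: "h holomorphic_on ball c R" and R: "R > 0"
    and omit: "\<And>z. z \<in> ball c R \<Longrightarrow> h z \<noteq> 0 \<and> h z \<noteq> 1"
    and hc: "norm (h c) \<le> C" and z: "norm (z - c) \<le> R / 2"
  shows "norm (h z) \<le> exp (pi * exp (pi * (26 + 2 * C)))"
proof -
  define k where "k = (\<lambda>u. h (c + of_real (3 * R / 4) * u))"
  have sub: "c + of_real (3 * R / 4) * u \<in> ball c R" if "u \<in> cball 0 1" for u
  proof -
    have "norm (of_real (3 * R / 4) * u) = 3 * R / 4 * norm u"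
      using R by (simp add: norm_mult)
    also have "\<dots> \<le> 3 * R / 4 * 1" using R that by (intro mult_left_mono) auto
    finally show ?thesis using R by (simp add: dist_norm)
  qed
  have holk: "k holomorphic_on cball 0 1"
    unfolding k_def using sub
    by (intro holomorphic_on_compose_gen[OF _ hol, unfolded o_def]) (auto intro!: holomorphic_intros)
  define u where "u = (z - c) / of_real (3 * R / 4)"
  have "complex_of_real (3 * R / 4) \<noteq> 0" using R by simp
  then have zu: "z = c + of_real (3 * R / 4) * u"
    unfolding u_def by (simp only: times_divide_eq_right nonzero_mult_div_cancel_left) simp
  have nu: "norm u \<le> 2 / 3"
    using z R unfolding u_def norm_divide norm_of_real by (simp add: field_simps)
  have "norm (k u) \<le> exp (pi * exp (pi * (2 + 2 * C + 12 * (2/3) / (1 - 2/3))))"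
    by (rule Schottky[OF holk]) (use hc nu omit sub in \<open>auto simp: k_def\<close>)
  then show ?thesis using zu by (simp add: k_def)
qed

text \<open>Schottky's bound depends only on the value at the centre, so boundedness of the family
  at one point spreads over a disc, then along the connected set, and finally over compact
  sets.\<close>

lemma normal_omit_0_1:
  assumes S: "open S" "connected S" "w \<in> S"
    and hol: "\<And>h. h \<in> Y \<Longrightarrow> h holomorphic_on S"
    and omit: "\<And>h z. h \<in> Y \<Longrightarrow> z \<in> S \<Longrightarrow> h z \<noteq> 0 \<and> h z \<noteq> 1"
    and bw: "\<And>h. h \<in> Y \<Longrightarrow> norm (h w) \<le> C"
    and K: "compact K" "K \<subseteq> S"
  shows "\<exists>B. \<forall>h\<in>Y. \<forall>z\<in>K. norm (h z) \<le> B"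
proof -
  have loc: "\<exists>B. \<forall>h\<in>Y. \<forall>y. norm (y - x) \<le> R / 2 \<longrightarrow> norm (h y) \<le> B"
    if "ball x R \<subseteq> S" "R > 0" "\<exists>B. \<forall>h\<in>Y. norm (h x) \<le> B" for x R
  proof -
    from that obtain B where "\<forall>h\<in>Y. norm (h x) \<le> B" by blast
    then show ?thesis
      using schottky_ball[of _ x R B] that hol omit by (meson holomorphic_on_subset subsetD)
  qed
  have pt: "\<exists>B. \<forall>h\<in>Y. norm (h b) \<le> B" if "b \<in> S" for b
  proof (rule connected_induction_simple[where P = "\<lambda>x. \<exists>B. \<forall>h\<in>Y. norm (h x) \<le> B", OF S(2) S(3) that])
    show "\<exists>B. \<forall>h\<in>Y. norm (h w) \<le> B" using bw by blast
    fix a assume "a \<in> S"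
    then obtain r where r: "r > 0" "ball a r \<subseteq> S" using S(1) open_contains_ball by metis
    show "\<exists>T. openin (top_of_set S) T \<and> a \<in> T \<and> (\<forall>x\<in>T. \<forall>y\<in>T.
        (\<exists>B. \<forall>h\<in>Y. norm (h x) \<le> B) \<longrightarrow> (\<exists>B. \<forall>h\<in>Y. norm (h y) \<le> B))"
    proof (rule exI[of _ "ball a (r/4)"], intro conjI ballI impI)
      show "openin (top_of_set S) (ball a (r/4))"
        by (rule open_subset) (use r subset_ball[of "r/4" r a] in auto)
      show "a \<in> ball a (r/4)" using r by simp
      fix x y assume xy: "x \<in> ball a (r/4)" "y \<in> ball a (r/4)" and b: "\<exists>B. \<forall>h\<in>Y. norm (h x) \<le> B"
      have "ball x (r/2) \<subseteq> S"
      proof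
        fix u assume "u \<in> ball x (r/2)"
        then have "dist a u < r" using xy r(1) dist_triangle[of a u x] by (simp add: dist_commute)
        then show "u \<in> S" using r(2) by auto
      qed
      moreover have "ball x (3*r/4) \<subseteq> S"
      proof
        fix u assume "u \<in> ball x (3*r/4)"
        then have "dist a u < r" using xy r(1) dist_triangle[of a u x] by (simp add: dist_commute)
        then show "u \<in> S" using r(2) by auto
      qed
      moreover have "norm (y - x) < r / 2"
        using xy dist_triangle[of x y a] by (simp add: dist_commute dist_norm norm_minus_commute)
      ultimately show "\<exists>B. \<forall>h\<in>Y. norm (h y) \<le> B"
      proof -
        \<comment> \<open>The local bound reaches only half the radius of a disc, which is not
          enough to get from \<open>x\<close> to \<open>y\<close>; the midpoint splits the move into
          two of length at most \<open>r / 4\<close>.\<close>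
        define m where "m = (x + y) / 2"
        have m: "norm (m - x) \<le> (r/2) / 2" "norm (y - m) \<le> (r/2) / 2"
        proof -
          have "m - x = (y - x) / 2" "y - m = (y - x) / 2" by (auto simp: m_def field_simps)
          then have "norm (m - x) = norm (y - x) / 2" "norm (y - m) = norm (y - x) / 2"
            by (metis norm_divide norm_numeral)+
          then show "norm (m - x) \<le> (r/2) / 2" "norm (y - m) \<le> (r/2) / 2"
            using \<open>norm (y - x) < r / 2\<close> by linarith+
        qed
        obtain B where "\<forall>h\<in>Y. \<forall>y. norm (y - x) \<le> (r/2) / 2 \<longrightarrow> norm (h y) \<le> B"
          using loc[of x "r/2"] \<open>ball x (r/2) \<subseteq> S\<close> b r by auto
        then have bm: "\<exists>B. \<forall>h\<in>Y. norm (h m) \<le> B" using m by blast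
        have "ball m (r/2) \<subseteq> S"
        proof
          fix u assume "u \<in> ball m (r/2)"
          moreover have "dist x m \<le> r/4" using m by (simp add: dist_norm norm_minus_commute)
          ultimately have "dist x u < 3*r/4" using dist_triangle[of x u m] by simp
          then show "u \<in> S" using \<open>ball x (3*r/4) \<subseteq> S\<close> by auto
        qed
        from loc[OF this _ bm] m r show ?thesis by (metis half_gt_zero)
      qed
    qed
  qed
  have "\<exists>U B. open U \<and> x \<in> U \<and> (\<forall>h\<in>Y. \<forall>z\<in>U. norm (h z) \<le> B)" if "x \<in> K" for x
  proof -
    have "x \<in> S" using K that by blast
    then obtain r where r: "r > 0" "ball x r \<subseteq> S" using S(1) open_contains_ball by metis
    obtain B where "\<forall>h\<in>Y. \<forall>y. norm (y - x) \<le> r / 2 \<longrightarrow> norm (h y) \<le> B"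
      using loc[OF r(2,1) pt[OF \<open>x \<in> S\<close>]] by blast
    then show ?thesis using r
      by (intro exI[of _ "ball x (r/2)"] exI[of _ B])
        (auto simp: dist_norm norm_minus_commute)
  qed
  then obtain U B where UB: "\<And>x. x \<in> K \<Longrightarrow> open (U x) \<and> x \<in> U x \<and> (\<forall>h\<in>Y. \<forall>z\<in>U x. norm (h z) \<le> B x)"
    by metis
  obtain T where T: "T \<subseteq> K" "finite T" "K \<subseteq> (\<Union>x\<in>T. U x)"
    using compactE_image[OF K(1), of K U] UB by blast
  show ?thesis
  proof (intro exI ballI)
    fix h z assume "h \<in> Y" "z \<in> K"
    then obtain x where "x \<in> T" "z \<in> U x" using T by blast
    then have "norm (h z) \<le> B x" using UB T \<open>h \<in> Y\<close> by blast
    also have "\<dots> \<le> Max (B ` T)" using T \<open>x \<in> T\<close> by auto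
    finally show "norm (h z) \<le> Max (B ` T)" .
  qed
qed

text \<open>The affine change \<open>q\<close> turns the moving omitted values into 0 and 1. The
  lower bound for their distance acts at \<open>w\<close>, where \<open>q\<close> must be bounded;
  going back from \<open>q\<close> to \<open>h\<close> multiplies by \<open>b - a\<close>, for which
  upper bounds suffice.\<close>

lemma normal_omit_two:
  fixes h a b :: "'i \<Rightarrow> complex \<Rightarrow> complex"
  assumes S: "open S" "connected S" "w \<in> S" and K: "compact K" "K \<subseteq> S"
    and hol: "\<And>i. i \<in> I \<Longrightarrow> h i holomorphic_on S" "\<And>i. i \<in> I \<Longrightarrow> a i holomorphic_on S"
             "\<And>i. i \<in> I \<Longrightarrow> b i holomorphic_on S"
    and omit: "\<And>i z. i \<in> I \<Longrightarrow> z \<in> S \<Longrightarrow> a i z \<noteq> b i z \<and> h i z \<noteq> a i z \<and> h i z \<noteq> b i z"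
    and bw: "\<And>i. i \<in> I \<Longrightarrow> norm (h i w) \<le> M" 
    and ab: "\<And>i z. i \<in> I \<Longrightarrow> z \<in> S \<Longrightarrow> norm (a i z) \<le> M \<and> norm (b i z) \<le> M"
    and sep: "e > 0" "\<And>i. i \<in> I \<Longrightarrow> e \<le> norm (b i w - a i w)"
  shows "\<exists>B. \<forall>i\<in>I. \<forall>z\<in>K. norm (h i z) \<le> B"
proof -
  define q where "q i z = (h i z - a i z) / (b i z - a i z)" for i z
  have "\<exists>B. \<forall>k\<in>q ` I. \<forall>z\<in>K. norm (k z) \<le> B"
  proof (rule normal_omit_0_1[OF S _ _ _ K])
    fix k assume "k \<in> q ` I"
    then obtain i where i: "i \<in> I" "k = q i" by blast
    show "k holomorphic_on S"
      unfolding i(2) q_def using hol omit i by (fastforce intro!: holomorphic_intros)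
    have M0: "M \<ge> 0" using norm_ge_zero order_trans bw[OF i(1)] by blast
    have "norm (h i w - a i w) \<le> 2 * M"
      using norm_triangle_ineq4[of "h i w" "a i w"] bw[OF i(1)] ab[OF i(1) S(3)] by linarith
    then have "norm (k w) \<le> (2 * M) / e"
      unfolding i(2) q_def norm_divide using sep(1) sep(2)[OF i(1)] M0 by (intro frac_le) auto
    then show "norm (k w) \<le> (2 * M) / e" .
    fix z assume "z \<in> S"
    have o: "b i z \<noteq> a i z" "h i z \<noteq> a i z" "h i z \<noteq> b i z"
      using omit[OF i(1) \<open>z \<in> S\<close>] by (blast dest: not_sym)+
    show "k z \<noteq> 0 \<and> k z \<noteq> 1" unfolding i(2) q_def using o by simp
  qed
  then obtain B where B: "\<And>i z. i \<in> I \<Longrightarrow> z \<in> K \<Longrightarrow> norm (q i z) \<le> B" by blast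
  have "norm (h i z) \<le> \<bar>B\<bar> * (2 * M) + M" if "i \<in> I" "z \<in> K" for i z
  proof -
    have z: "z \<in> S" using that K by blast
    have "b i z \<noteq> a i z" using omit[OF that(1) z] by (blast dest: not_sym)
    then have "h i z = q i z * (b i z - a i z) + a i z" by (simp add: q_def)
    then have "norm (h i z) \<le> norm (q i z) * norm (b i z - a i z) + norm (a i z)"
      by (metis norm_mult norm_triangle_ineq)
    also have "\<dots> \<le> \<bar>B\<bar> * (2 * M) + M"
    proof (intro add_mono mult_mono)
      show "norm (b i z - a i z) \<le> 2 * M" 
        using norm_triangle_ineq4[of "b i z" "a i z"] ab[OF that(1) z] by linarith
    qed (use B[OF that] ab[OF that(1) z] in auto)
    finally show ?thesis .
  qed
  then show ?thesis by blast
qed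

text \<open>By Montel every subsequence has a convergent subsequence, and every limit agrees with
  \<open>g\<close> on the open set \<open>V\<close>, hence with every other limit on all of
  \<open>S\<close>.\<close>

lemma vitali_convergence:
  fixes \<phi> :: "nat \<Rightarrow> complex \<Rightarrow> complex"
  assumes S: "open S" "connected S" and hol: "\<And>n. \<phi> n holomorphic_on S"
    and bd: "\<And>K. compact K \<Longrightarrow> K \<subseteq> S \<Longrightarrow> \<exists>B. \<forall>n. \<forall>z\<in>K. norm (\<phi> n z) \<le> B"
    and V: "open V" "V \<noteq> {}" "V \<subseteq> S" and lim: "\<And>z. z \<in> V \<Longrightarrow> (\<lambda>n. \<phi> n z) \<longlonglongrightarrow> g z"
  obtains A where "A holomorphic_on S" 
    "\<And>K. compact K \<Longrightarrow> K \<subseteq> S \<Longrightarrow> uniform_limit K \<phi> A sequentially"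
    "\<And>z. z \<in> S \<Longrightarrow> (\<lambda>n. \<phi> n z) \<longlonglongrightarrow> A z"
    "\<And>z. z \<in> V \<Longrightarrow> A z = g z"
proof -
  have ex: "\<exists>A r. A holomorphic_on S \<and> strict_mono (r::nat\<Rightarrow>nat) \<and>
      (\<forall>K. compact K \<and> K \<subseteq> S \<longrightarrow> uniform_limit K (\<lambda>n. \<phi> (s (r n))) A sequentially) \<and> (\<forall>z\<in>V. A z = g z)"
    if s: "strict_mono s" for s :: "nat \<Rightarrow> nat"
  proof -
    obtain A r where Ar: "A holomorphic_on S" "strict_mono (r::nat\<Rightarrow>nat)"
      "\<And>x. x \<in> S \<Longrightarrow> (\<lambda>n. \<phi> (s (r n)) x) \<longlonglongrightarrow> A x"
      "\<And>K. \<lbrakk>compact K; K \<subseteq> S\<rbrakk> \<Longrightarrow> uniform_limit K ((\<lambda>n. \<phi> (s n)) \<circ> r) A sequentially"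
    proof (rule Montel[OF S(1), of "range \<phi>" "\<lambda>n. \<phi> (s n)"])
      fix K assume "compact K" "K \<subseteq> S"
      then obtain B where "\<forall>n. \<forall>z\<in>K. norm (\<phi> n z) \<le> B" using bd by blast
      then show "\<exists>B. \<forall>h\<in>range \<phi>. \<forall>z\<in>K. norm (h z) \<le> B" by blast
    qed (use hol in auto)
    have "A z = g z" if "z \<in> V" for z
    proof (rule LIMSEQ_unique)
      show "(\<lambda>n. \<phi> (s (r n)) z) \<longlonglongrightarrow> A z" using Ar(3) that V by blast
      show "(\<lambda>n. \<phi> (s (r n)) z) \<longlonglongrightarrow> g z"
        using LIMSEQ_subseq_LIMSEQ[OF lim[OF that] strict_mono_o[OF s Ar(2)]] by (simp add: o_def)
    qed
    then show ?thesis using Ar(1,2,4) unfolding o_def by blast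
  qed
  obtain A r where A: "A holomorphic_on S" "strict_mono (r::nat\<Rightarrow>nat)" "\<forall>z\<in>V. A z = g z"
    using ex[of id] strict_mono_id by auto
  have uni: "uniform_limit K \<phi> A sequentially" if K: "compact K" "K \<subseteq> S" for K
  proof (rule ccontr)
    assume "\<not> ?thesis"
    then obtain e where e: "e > 0" "\<not> (\<forall>\<^sub>F n in sequentially. \<forall>x\<in>K. dist (\<phi> n x) (A x) < e)"
      unfolding uniform_limit_iff by blast
    then obtain s :: "nat \<Rightarrow> nat" where s: "strict_mono s" "\<And>n. \<not> (\<forall>x\<in>K. dist (\<phi> (s n) x) (A x) < e)"
      using not_eventually_sequentiallyD[OF e(2)] by blast
    obtain A' r' where A': "A' holomorphic_on S" "strict_mono (r'::nat\<Rightarrow>nat)" "\<forall>z\<in>V. A' z = g z"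
      "uniform_limit K (\<lambda>n. \<phi> (s (r' n))) A' sequentially"
      using ex[OF s(1)] K by blast
    have "A' z = A z" if "z \<in> S" for z
      by (rule analytic_continuation_open[OF V(1) S(1) V(2) S(2) V(3) A'(1) A(1) _ that])
        (use A A' in auto)
    then have "\<forall>\<^sub>F n in sequentially. \<forall>x\<in>K. dist (\<phi> (s (r' n)) x) (A x) < e"
      using A'(4) e(1) K unfolding uniform_limit_iff by (smt (verit) eventually_mono subsetD)
    then show False using s(2) by (auto simp: eventually_sequentially)
  qed
  show ?thesis
  proof (rule that[OF A(1) uni])
    fix z assume "z \<in> S"
    then show "(\<lambda>n. \<phi> n z) \<longlonglongrightarrow> A z"
      using tendsto_uniform_limitI[OF uni[of "{z}"]] by auto
  qed (use A in auto)
qed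

lemma norm_deriv_le_Cauchy:
  assumes "f holomorphic_on S" "open S" "cball z r \<subseteq> S" "0 < r" "\<And>x. x \<in> cball z r \<Longrightarrow> norm (f x) \<le> B"
  shows "norm (deriv f z) \<le> B / r"
proof -
  have "ball z r \<subseteq> S" using assms(3) by auto
  then have "f holomorphic_on ball z r" "continuous_on (cball z r) f"
    using assms(1,3) holomorphic_on_imp_continuous_on holomorphic_on_subset by blast+
  then show ?thesis
    using Cauchy_inequality[of f z r B 1] assms(4,5) by (simp add: dist_norm)
qed

section \<open>Locally uniform convergence and attracting cycles\<close>

text \<open>A general filter lets the same facts serve sequences of maps, a family at a parameter
  (\<open>nhds t\<close>), and both at once
  (\<open>sequentially \<times>\<^sub>F nhds t\<close>).\<close>

definition luc_tendsto :: "('i \<Rightarrow> complex \<Rightarrow> complex) \<Rightarrow> (complex \<Rightarrow> complex) \<Rightarrow> 'i filter \<Rightarrow> bool" where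
  "luc_tendsto G f F \<longleftrightarrow> (\<forall>R. uniform_limit (cball 0 R) G f F)"

lemma luc_tendsto_compact:
  assumes "luc_tendsto G f F" "compact K"
  shows "uniform_limit K G f F"
proof -
  obtain R where "K \<subseteq> ball 0 R"
    using compact_imp_bounded[OF assms(2)] bounded_subset_ballD[of K 0] by blast
  then have "K \<subseteq> cball 0 R" using ball_subset_cball by blast
  then show ?thesis using assms(1) uniform_limit_on_subset unfolding luc_tendsto_def by blast
qed

lemma luc_tendsto_const: "luc_tendsto (\<lambda>_. f) f F"
  by (simp add: luc_tendsto_def uniform_limit_const)

lemma luc_tendsto_filterlim:
  assumes "luc_tendsto G f F" "filterlim h F F'"
  shows "luc_tendsto (\<lambda>i. G (h i)) f F'"
  using assms filterlim_compose unfolding luc_tendsto_def by blast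

lemma luc_tendsto_eval:
  assumes G: "luc_tendsto G f F" and f: "continuous_on UNIV f" and x: "(x \<longlongrightarrow> x0) F"
  shows "((\<lambda>i. G i (x i)) \<longlongrightarrow> f x0) F"
proof -
  have "isCont f x0" using f by (simp add: continuous_on_eq_continuous_at)
  then have fx: "((\<lambda>i. f (x i)) \<longlongrightarrow> f x0) F" using x by (rule isCont_tendsto_compose)
  have "((\<lambda>i. dist (G i (x i)) (f (x i))) \<longlongrightarrow> 0) F"
  proof (rule tendstoI)
    fix e :: real assume "e > 0"
    have 1: "\<forall>\<^sub>F i in F. dist (x i) x0 < 1" using x by (rule tendstoD) simp
    have 2: "\<forall>\<^sub>F i in F. \<forall>z\<in>cball x0 1. dist (G i z) (f z) < e"
      using luc_tendsto_compact[OF G compact_cball] \<open>e > 0\<close> unfolding uniform_limit_iff by blast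
    show "\<forall>\<^sub>F i in F. dist (dist (G i (x i)) (f (x i))) 0 < e"
      using 1 2 by eventually_elim (auto simp: dist_commute)
  qed
  from tendsto_add[OF this tendsto_dist_iff[THEN iffD1, OF fx]]
  have "((\<lambda>i. dist (G i (x i)) (f (x i)) + dist (f (x i)) (f x0)) \<longlongrightarrow> 0) F" by simp
  then have "((\<lambda>i. dist (G i (x i)) (f x0)) \<longlongrightarrow> 0) F"
    by (rule tendsto_sandwich[OF _ _ tendsto_const, rotated 2]) (auto intro!: always_eventually dist_triangle)
  then show ?thesis by (rule tendsto_dist_iff[THEN iffD2])
qed

lemma luc_tendsto_compose:
  assumes G: "luc_tendsto G f F" "continuous_on UNIV f" and H: "luc_tendsto H h F" "continuous_on UNIV h"
  shows "luc_tendsto (\<lambda>i z. G i (H i z)) (\<lambda>z. f (h z)) F"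
  unfolding luc_tendsto_def uniform_limit_iff
proof (intro allI impI)
  fix R e :: real assume e: "e > 0"
  have "compact (h ` cball 0 R)" using H(2) by (intro compact_continuous_image) (auto intro: continuous_on_subset)
  then obtain M where "h ` cball 0 R \<subseteq> ball 0 M"
    using compact_imp_bounded bounded_subset_ballD[of "h ` cball 0 R" 0] by blast
  then have M: "h ` cball 0 R \<subseteq> cball 0 M" using ball_subset_cball by blast
  have "uniformly_continuous_on (cball 0 (M+1)) f"
    by (rule compact_uniformly_continuous) (auto intro: continuous_on_subset[OF G(2)])
  then obtain d where d: "d > 0" "\<And>x y. x \<in> cball 0 (M+1) \<Longrightarrow> y \<in> cball 0 (M+1) \<Longrightarrow> dist x y < d \<Longrightarrow> dist (f x) (f y) < e/2"
    unfolding uniformly_continuous_on_def using half_gt_zero[OF e] by blast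
  have 1: "\<forall>\<^sub>F i in F. \<forall>z\<in>cball 0 R. dist (H i z) (h z) < min d 1"
    using H(1)[unfolded luc_tendsto_def uniform_limit_iff, rule_format, of "min d 1" R] d(1) by simp
  have 2: "\<forall>\<^sub>F i in F. \<forall>z\<in>cball 0 (M+1). dist (G i z) (f z) < e/2"
    using G(1) half_gt_zero[OF e] unfolding luc_tendsto_def uniform_limit_iff by blast
  show "\<forall>\<^sub>F i in F. \<forall>z\<in>cball 0 R. dist (G i (H i z)) (f (h z)) < e"
    using 1 2
  proof eventually_elim
    case (elim i)
    show ?case
    proof
      fix z :: complex assume z: "z \<in> cball 0 R"
      have "h z \<in> cball 0 M" using M z by blast
      then have hz: "norm (h z) \<le> M" by simp
      have Hz: "dist (H i z) (h z) < d" "dist (H i z) (h z) < 1" using elim(1) z by auto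
      have "norm (H i z) \<le> M + 1"
        using Hz(2) hz norm_triangle_sub[of "H i z" "h z"] by (simp add: dist_norm)
      then have "dist (f (H i z)) (f (h z)) < e/2" "dist (G i (H i z)) (f (H i z)) < e/2"
        using d(2)[of "H i z" "h z"] Hz hz elim(2) by auto
      then show "dist (G i (H i z)) (f (h z)) < e"
        using dist_triangle[of "G i (H i z)" "f (h z)" "f (H i z)"] by linarith
    qed
  qed
qed

section \<open>Iterates and their dependence on the map\<close>

lemma continuous_on_funpow:
  fixes f :: "'a::topological_space \<Rightarrow> 'a"
  assumes "continuous_on UNIV f" shows "continuous_on UNIV (f ^^ n)"
proof (induction n)
  case (Suc n)
  then have "continuous_on UNIV (f \<circ> (f ^^ n))"
    by (intro continuous_on_compose) (auto intro: continuous_on_subset[OF assms])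
  then show ?case by simp
qed (simp add: id_def)

lemma tendsto_funpow:
  fixes f :: "'a::t2_space \<Rightarrow> 'a"
  assumes "continuous_on UNIV f" "(x \<longlongrightarrow> l) F" shows "((\<lambda>i. (f ^^ n) (x i)) \<longlongrightarrow> (f ^^ n) l) F"
proof -
  have "isCont (f ^^ n) l" using continuous_on_funpow[OF assms(1)] by (simp add: continuous_on_eq_continuous_at)
  then show ?thesis using assms(2) by (rule isCont_tendsto_compose)
qed

lemma holomorphic_on_funpow:
  assumes "f holomorphic_on UNIV" shows "(f ^^ n) holomorphic_on UNIV"
proof (induction n)
  case (Suc n)
  then have "(f \<circ> (f ^^ n)) holomorphic_on UNIV"
    by (intro holomorphic_on_compose) (auto intro: holomorphic_on_subset[OF assms])
  then show ?case by (simp add: o_def)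
qed (simp add: id_def)

lemma funpow_differentiable:
  assumes "f holomorphic_on UNIV" shows "(f ^^ n) field_differentiable at x"
  using holomorphic_on_funpow[OF assms] holomorphic_on_imp_differentiable_at by blast

lemma luc_tendsto_funpow:
  assumes "luc_tendsto G f F" "continuous_on UNIV f"
  shows "luc_tendsto (\<lambda>i. G i ^^ n) (f ^^ n) F"
proof (induction n)
  case 0 then show ?case using luc_tendsto_const[of id] by (simp add: id_def)
next
  case (Suc n)
  from luc_tendsto_compose[OF assms Suc continuous_on_funpow[OF assms(2)]] 
  show ?case by (simp add: o_def)
qed

lemma luc_tendsto_deriv:
  assumes G: "luc_tendsto G f F" and hol: "\<forall>\<^sub>F i in F. G i holomorphic_on UNIV" "f holomorphic_on UNIV"
  shows "luc_tendsto (\<lambda>i. deriv (G i)) (deriv f) F"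
  unfolding luc_tendsto_def uniform_limit_iff
proof (intro allI impI)
  fix R e :: real assume e: "e > 0"
  have "\<forall>\<^sub>F i in F. \<forall>z\<in>cball 0 (R+1). dist (G i z) (f z) < e/2"
    using G half_gt_zero[OF e] unfolding luc_tendsto_def uniform_limit_iff by blast
  with hol(1) show "\<forall>\<^sub>F i in F. \<forall>z\<in>cball 0 R. dist (deriv (G i) z) (deriv f z) < e"
  proof eventually_elim
    case (elim i)
    show ?case
    proof
      fix z :: complex assume z: "z \<in> cball 0 R"
      have "norm (deriv (\<lambda>z. G i z - f z) z) \<le> (e/2) / 1"
      proof (rule norm_deriv_le_Cauchy)
        show "(\<lambda>z. G i z - f z) holomorphic_on UNIV" using elim(1) hol(2) by (intro holomorphic_intros)
        fix x assume "x \<in> cball z 1"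
        then have "x \<in> cball 0 (R+1)" using z norm_triangle_sub[of x z] by (simp add: dist_norm norm_minus_commute)
        then show "norm (G i x - f x) \<le> e/2" using elim(2) by (force simp: dist_norm)
      qed auto
      moreover have "deriv (\<lambda>z. G i z - f z) z = deriv (G i) z - deriv f z"
        using elim(1) hol(2) by (intro deriv_diff) (auto simp: holomorphic_on_imp_differentiable_at)
      ultimately show "dist (deriv (G i) z) (deriv f z) < e" using e by (simp add: dist_norm)
    qed
  qed
qed

section \<open>Orbits attracted by a periodic point\<close>

lemma tendsto_residues:
  fixes X :: "nat \<Rightarrow> 'a::metric_space"
  assumes k: "k > 0" and "\<And>r. r < k \<Longrightarrow> (\<lambda>q. X (k * q + r)) \<longlonglongrightarrow> a"
  shows "X \<longlonglongrightarrow> a"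
proof (rule tendstoI)
  fix e :: real assume "e > 0"
  have "\<forall>\<^sub>F q in sequentially. \<forall>r\<in>{..<k}. dist (X (k * q + r)) a < e"
    using assms(2) \<open>e > 0\<close> by (intro eventually_ball_finite) (auto dest: tendstoD)
  then obtain Q where Q: "\<And>q r. q \<ge> Q \<Longrightarrow> r < k \<Longrightarrow> dist (X (k * q + r)) a < e"
    unfolding eventually_sequentially by blast
  have "dist (X m) a < e" if "m \<ge> k * Q" for m
  proof -
    have "m div k \<ge> Q" using that k by (metis div_le_mono nonzero_mult_div_cancel_left not_gr0)
    then have "dist (X (k * (m div k) + m mod k)) a < e" by (rule Q) (use k in simp)
    then show ?thesis by simp
  qed
  then show "\<forall>\<^sub>F m in sequentially. dist (X m) a < e" unfolding eventually_sequentially by blast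
qed

text \<open>\<open>p\<close> is some period of \<open>a\<close>, not necessarily the least;
  superattracting points and orbits landing on \<open>a\<close> are included. Taking times
  \<open>p * m\<close> fixes which point of the cycle is the limit. The derivative condition rules
  out \<open>p = 0\<close>, since the identity has derivative 1.\<close>

definition attr_to :: "(complex \<Rightarrow> complex) \<Rightarrow> nat \<Rightarrow> complex \<Rightarrow> complex \<Rightarrow> bool" where
  "attr_to f p s a \<longleftrightarrow> (f ^^ p) a = a \<and> norm (deriv (f ^^ p) a) < 1 \<and> (\<lambda>m. (f ^^ (p * m)) s) \<longlonglongrightarrow> a"

lemma attr_to_pos: "attr_to f p s a \<Longrightarrow> p > 0"
  by (rule ccontr) (auto simp: attr_to_def id_def)

lemma funpow_fixed: "(f ^^ p) a = a \<Longrightarrow> (f ^^ (p * m)) a = a"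
  by (induction m) (auto simp: funpow_add)

lemma funpow_commute_apply: "(f ^^ m) ((f ^^ n) x) = (f ^^ n) ((f ^^ m) x)"
  by (metis add.commute comp_apply funpow_add)

lemma deriv_funpow_fixed:
  assumes hol: "f holomorphic_on UNIV" and a: "(f ^^ p) a = a"
  shows "deriv (f ^^ (p * m)) a = deriv (f ^^ p) a ^ m"
proof (induction m)
  case (Suc m)
  have "deriv (f ^^ (p * Suc m)) a = deriv ((f ^^ p) \<circ> (f ^^ (p * m))) a" by (simp add: funpow_add)
  also have "\<dots> = deriv (f ^^ p) ((f ^^ (p * m)) a) * deriv (f ^^ (p * m)) a"
    using funpow_differentiable[OF hol] by (intro deriv_chain)
  finally show ?case using Suc funpow_fixed[OF a] by simp
qed (simp add: id_def)

lemma deriv_funpow_cycle: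
  assumes hol: "f holomorphic_on UNIV" and a: "(f ^^ p) a = a"
  shows "deriv (f ^^ p) ((f ^^ l) a) = deriv (f ^^ p) a"
proof (induction l)
  case (Suc l)
  define b where "b = (f ^^ l) a"
  have b: "(f ^^ p) b = b" unfolding b_def by (subst funpow_commute_apply) (simp add: a)
  note ds = funpow_differentiable[OF hol, of 1, simplified] funpow_differentiable[OF hol]
  show ?case
  proof (cases "p = 0")
    case True then show ?thesis by (simp add: id_def)
  next
    case False
    then obtain q where p: "p = Suc q" by (cases p) auto
    have "deriv (f \<circ> (f ^^ p)) b = deriv ((f ^^ p) \<circ> f) b" by (simp add: funpow_swap1 o_def)
    then have 1: "deriv f b * deriv (f ^^ p) b = deriv (f ^^ p) (f b) * deriv f b"
      using deriv_chain[of "f ^^ p" b f] deriv_chain[of f b "f ^^ p"] ds b by simp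
    have "deriv (f ^^ p) (f b) = deriv (f ^^ p) b"
    proof (cases "deriv f b = 0")
      case False then show ?thesis using 1 by simp
    next
      \<comment> \<open>At a critical point the factor \<open>deriv f b\<close> cannot be cancelled.
        Both multipliers then vanish, since each is a product over the same cycle, which contains
        \<open>b\<close>.\<close>
      case True
      have "deriv (f ^^ p) b = deriv ((f ^^ q) \<circ> f) b" by (simp add: p funpow_swap1 o_def)
      also have "\<dots> = 0" using True deriv_chain[of f b "f ^^ q"] ds by simp
      finally have z: "deriv (f ^^ p) b = 0" .
      have "(f ^^ q) (f b) = b" using b by (simp add: p funpow_swap1)
      then have "deriv (f \<circ> (f ^^ q)) (f b) = 0"
        using True deriv_chain[of "f ^^ q" "f b" f] ds by simp
      then show ?thesis using z by (simp add: p)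
    qed
    then show ?thesis using Suc by (simp add: b_def)
  qed
qed simp

text \<open>The multiplier of \<open>f ^^ (p * d)\<close> is a power of the multipliers for
  \<open>p\<close> and for \<open>d\<close>, so one has modulus below 1 exactly if the other has.
  Convergence along multiples of \<open>d\<close> follows by splitting times into residues modulo
  \<open>p\<close>.\<close>

lemma attr_to_period:
  assumes hol: "f holomorphic_on UNIV" and at: "attr_to f p s a" and d: "(f ^^ d) a = a" "d > 0"
  shows "attr_to f d s a"
proof -
  have p: "p > 0" using attr_to_pos[OF at] .
  have pa: "(f ^^ p) a = a" "norm (deriv (f ^^ p) a) < 1" "(\<lambda>m. (f ^^ (p * m)) s) \<longlonglongrightarrow> a"
    using at by (auto simp: attr_to_def)
  have "deriv (f ^^ d) a ^ p = deriv (f ^^ p) a ^ d"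
    using deriv_funpow_fixed[OF hol d(1), of p] deriv_funpow_fixed[OF hol pa(1), of d] by (simp add: mult.commute)
  then have "norm (deriv (f ^^ d) a) ^ p = norm (deriv (f ^^ p) a) ^ d" by (metis norm_power)
  also have "\<dots> < 1" using pa(2) d(2) by (simp add: power_less_one_iff)
  finally have 1: "norm (deriv (f ^^ d) a) < 1" using p by (simp add: power_less_one_iff)
  have "(\<lambda>m. (f ^^ (d * m)) s) \<longlonglongrightarrow> a"
  proof (rule tendsto_residues[OF p])
    fix r
    have "(\<lambda>q. (f ^^ (p * (d * q))) s) \<longlonglongrightarrow> a"
      using LIMSEQ_subseq_LIMSEQ[OF pa(3), of "\<lambda>q. d * q"] d(2) by (simp add: o_def strict_mono_def)
    then have "(\<lambda>q. (f ^^ (d * r)) ((f ^^ (p * (d * q))) s)) \<longlonglongrightarrow> (f ^^ (d * r)) a"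
      by (rule tendsto_funpow[OF holomorphic_on_imp_continuous_on[OF hol]])
    moreover have "(f ^^ (d * (p * q + r))) s = (f ^^ (d * r)) ((f ^^ (p * (d * q))) s)" for q
    proof -
      have "d * (p * q + r) = d * r + p * (d * q)" by (simp add: algebra_simps)
      then show ?thesis by (simp add: funpow_add)
    qed
    ultimately show "(\<lambda>q. (f ^^ (d * (p * q + r))) s) \<longlonglongrightarrow> a"
      using funpow_fixed[OF d(1)] by simp
  qed
  then show ?thesis using 1 d by (simp add: attr_to_def)
qed

lemma attr_to_image:
  assumes hol: "f holomorphic_on UNIV" and at: "attr_to f p s a"
  shows "attr_to f p ((f ^^ l) s) ((f ^^ l) a)"
proof -
  have "(\<lambda>m. (f ^^ l) ((f ^^ (p * m)) s)) \<longlonglongrightarrow> (f ^^ l) a"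
    using at by (intro tendsto_funpow[OF holomorphic_on_imp_continuous_on[OF hol]]) (simp add: attr_to_def)
  then show ?thesis
    using at deriv_funpow_cycle[OF hol, of p a l] funpow_commute_apply[of p f l a]
      funpow_commute_apply[where f = f and n = l and x = s]
    by (simp add: attr_to_def)
qed

text \<open>The \<open>l\<close> steps taken by the orbit are completed to the multiple
  \<open>p * l\<close> of the period, and the limit point moves along its cycle by the remaining
  \<open>p * l - l\<close> steps.\<close>

lemma attr_to_preimage:
  assumes hol: "f holomorphic_on UNIV" and at: "attr_to f p ((f ^^ l) s) a"
  shows "attr_to f p s ((f ^^ (p * l - l)) a)"
proof -
  have p: "p > 0" using attr_to_pos[OF at] .
  have "attr_to f p ((f ^^ (p * l - l)) ((f ^^ l) s)) ((f ^^ (p * l - l)) a)"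
    by (rule attr_to_image[OF hol at])
  moreover have "(f ^^ (p * l - l)) ((f ^^ l) s) = (f ^^ (p * l)) s"
  proof -
    have "p * l - l + l = p * l" using p by simp
    then show ?thesis by (metis comp_apply funpow_add)
  qed
  moreover have "(f ^^ (p * m)) ((f ^^ (p * l)) s) = (f ^^ (p * (m + l))) s" for m
    by (simp add: funpow_add distrib_left)
  ultimately show ?thesis unfolding attr_to_def using LIMSEQ_offset by fastforce
qed

text \<open>The centre need not be fixed by \<open>g\<close>: a single disc with a single
  contraction constant is to serve all maps near a given one. Mapping the closed disc into the open
  one puts the fixed point in the interior, where its derivative can be compared with
  \<open>c\<close>.\<close>

definition trap :: "(complex \<Rightarrow> complex) \<Rightarrow> nat \<Rightarrow> complex \<Rightarrow> real \<Rightarrow> real \<Rightarrow> bool" where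
  "trap g p a r c \<longleftrightarrow> 0 < r \<and> 0 \<le> c \<and> c < 1 \<and> (\<forall>x\<in>cball a r. (g ^^ p) x \<in> ball a r) \<and>
     (\<forall>x\<in>cball a r. \<forall>y\<in>cball a r. dist ((g ^^ p) x) ((g ^^ p) y) \<le> c * dist x y)"

lemma eventually_trap:
  assumes hol: "f holomorphic_on UNIV" and a: "(f ^^ p) a = a" "norm (deriv (f ^^ p) a) < 1"
    and G: "luc_tendsto G f F" "\<forall>\<^sub>F i in F. G i holomorphic_on UNIV" and r0: "r0 > 0"
  obtains r c where "0 < r" "r < r0" "\<forall>\<^sub>F i in F. trap (G i) p a r c"
proof -
  let ?g = "f ^^ p"
  have holg: "?g holomorphic_on UNIV" by (rule holomorphic_on_funpow[OF hol])
  define m where "m = norm (deriv ?g a)"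
  \<comment> \<open>These values divide the interval from \<open>m\<close> to 1 into thirds:
    \<open>c1\<close> bounds the derivative of the limit map on the disc, the step from
    \<open>c1\<close> to \<open>c\<close> absorbs the error in the derivatives, and the step from
    \<open>c\<close> to 1 the error in the values, bounded by \<open>(1 - c) * r\<close>.\<close>
  define c1 c where "c1 = (1 + 2 * m) / 3" and "c = (2 + m) / 3"
  have m: "0 \<le> m" "m < c1" "c1 < c" "c < 1" using a(2) by (auto simp: m_def c1_def c_def)
  have "continuous_on UNIV (deriv ?g)"
    by (intro holomorphic_on_imp_continuous_on holomorphic_deriv holg) simp
  then have "isCont (\<lambda>x. norm (deriv ?g x)) a"
    by (intro continuous_intros) (simp add: continuous_on_eq_continuous_at)
  then have "((\<lambda>x. norm (deriv ?g x)) \<longlongrightarrow> m) (nhds a)"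
    unfolding isCont_def m_def by (rule tendsto_at_iff_tendsto_nhds[of "\<lambda>x. norm (deriv ?g x)" a, THEN iffD1])
  then have "\<forall>\<^sub>F x in nhds a. norm (deriv ?g x) < c1"
    using m(2) by (rule order_tendstoD)
  then obtain r1 where r1: "r1 > 0" "\<And>x. dist x a < r1 \<Longrightarrow> norm (deriv ?g x) < c1"
    unfolding eventually_nhds_metric by blast
  define r where "r = min r1 r0 / 2"
  have r: "0 < r" "r < r0" "r < r1" using r1(1) r0 by (auto simp: r_def)
  have L: "luc_tendsto (\<lambda>i. G i ^^ p) ?g F"
    by (rule luc_tendsto_funpow[OF G(1) holomorphic_on_imp_continuous_on[OF hol]])
  have holG: "\<forall>\<^sub>F i in F. (G i ^^ p) holomorphic_on UNIV"
    using G(2) by eventually_elim (rule holomorphic_on_funpow)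
  have 1: "\<forall>\<^sub>F i in F. \<forall>x\<in>cball a r. dist (deriv (G i ^^ p) x) (deriv ?g x) < c - c1"
    using luc_tendsto_compact[OF luc_tendsto_deriv[OF L holG holg] compact_cball] m unfolding uniform_limit_iff
    by simp
  have "0 < (1 - c) * r" using m r by simp
  then have 2: "\<forall>\<^sub>F i in F. \<forall>x\<in>cball a r. dist ((G i ^^ p) x) (?g x) < (1 - c) * r"
    using luc_tendsto_compact[OF L compact_cball] unfolding uniform_limit_iff by blast
  have "\<forall>\<^sub>F i in F. trap (G i) p a r c"
    using 1 2 holG
  proof eventually_elim
    case (elim i)
    have lip: "dist ((G i ^^ p) x) ((G i ^^ p) y) \<le> c * dist x y" if "x \<in> cball a r" "y \<in> cball a r" for x y
      unfolding dist_norm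
    proof (rule field_differentiable_bound[OF convex_cball _ _ that])
      fix z assume z: "z \<in> cball a r"
      show "((G i ^^ p) has_field_derivative deriv (G i ^^ p) z) (at z within cball a r)"
        using elim(3) by (intro holomorphic_derivI) auto
      have "norm (deriv (G i ^^ p) z) \<le> dist (deriv (G i ^^ p) z) (deriv ?g z) + norm (deriv ?g z)"
        
          using norm_triangle_sub[of "deriv (G i ^^ p) z" "deriv ?g z"] by (simp add: dist_norm)
      also have "\<dots> \<le> c" using bspec[OF elim(1) z] r1(2)[of z] z r by (simp add: dist_commute)
      finally show "norm (deriv (G i ^^ p) z) \<le> c" .
    qed
    have "(G i ^^ p) x \<in> ball a r" if "x \<in> cball a r" for x
    proof -
      have "dist a ((G i ^^ p) x) \<le> dist ((G i ^^ p) a) (?g a) + dist ((G i ^^ p) x) ((G i ^^ p) a)"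
        using dist_triangle[of a "(G i ^^ p) x" "(G i ^^ p) a"] by (simp add: dist_commute a)
      also have "\<dots> < (1 - c) * r + c * r"
      proof (rule add_less_le_mono)
        have "a \<in> cball a r" using r by simp
        then show "dist ((G i ^^ p) a) (?g a) < (1 - c) * r" using elim(2) by blast
        have "dist ((G i ^^ p) x) ((G i ^^ p) a) \<le> c * dist x a"
          using lip[OF that] r by simp
        also have "\<dots> \<le> c * r" using that m by (intro mult_left_mono) (auto simp: dist_commute)
        finally show "dist ((G i ^^ p) x) ((G i ^^ p) a) \<le> c * r" .
      qed
      finally show ?thesis by (simp add: algebra_simps)
    qed
    then show ?case using lip r m unfolding trap_def by auto
  qed
  then show ?thesis using that r by blast
qed

lemma trap_invariant:
  assumes "trap g p a r c" "x \<in> cball a r" shows "(g ^^ (p * m)) x \<in> cball a r"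
proof (induction m)
  case (Suc m)
  have "(g ^^ (p * Suc m)) x = (g ^^ p) ((g ^^ (p * m)) x)" by (simp add: funpow_add)
  then show ?case using assms Suc unfolding trap_def by (metis ball_subset_cball subsetD)
qed (use assms in auto)

text \<open>Banach's fixed point theorem gives \<open>b\<close>; its multiplier is a limit of
  difference quotients, all bounded by \<open>c < 1\<close>.\<close>

lemma trap_attr_to:
  assumes hol: "g holomorphic_on UNIV" and t: "trap g p a r c"
  obtains b where "b \<in> ball a r" "\<And>x. x \<in> cball a r \<Longrightarrow> attr_to g p x b"
proof -
  have T: "0 < r" "0 \<le> c" "c < 1" "\<And>x. x \<in> cball a r \<Longrightarrow> (g ^^ p) x \<in> ball a r"
     "\<And>x y. x \<in> cball a r \<Longrightarrow> y \<in> cball a r \<Longrightarrow> dist ((g ^^ p) x) ((g ^^ p) y) \<le> c * dist x y"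
    using t by (auto simp: trap_def)
  have "\<exists>!x\<in>cball a r. (g ^^ p) x = x"
  proof (rule Banach_fix[OF _ _ T(2,3)])
    show "complete (cball a r)" by (simp add: complete_eq_closed)
    show "cball a r \<noteq> {}" using T(1) by simp
    show "(g ^^ p) ` cball a r \<subseteq> cball a r" using T(4) ball_subset_cball by blast
  qed (use T(5) in auto)
  then obtain b where b: "b \<in> cball a r" "(g ^^ p) b = b" by blast
  then have bb: "b \<in> ball a r" using T(4) by metis
  have conv: "(\<lambda>m. (g ^^ (p * m)) x) \<longlonglongrightarrow> b" if x: "x \<in> cball a r" for x
  proof -
    have bound: "dist ((g ^^ (p * m)) x) b \<le> c ^ m * dist x b" for m
    proof (induction m)
      case (Suc m)
      have "dist ((g ^^ (p * Suc m)) x) b = dist ((g ^^ p) ((g ^^ (p * m)) x)) ((g ^^ p) b)"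
        by (simp add: funpow_add b)
      also have "\<dots> \<le> c * dist ((g ^^ (p * m)) x) b"
        by (rule T(5)[OF trap_invariant[OF t x] b(1)])
      also have "\<dots> \<le> c * (c ^ m * dist x b)" using Suc T(2) by (intro mult_left_mono)
      finally show ?case by (simp add: mult.assoc)
    qed simp
    have "(\<lambda>m. c ^ m * dist x b) \<longlonglongrightarrow> 0 * dist x b"
      using T by (intro tendsto_intros LIMSEQ_realpow_zero)
    moreover have "\<forall>\<^sub>F m in sequentially. norm (dist ((g ^^ (p * m)) x) b) \<le> c ^ m * dist x b"
      by (rule always_eventually) (simp add: bound)
    ultimately have "(\<lambda>m. dist ((g ^^ (p * m)) x) b) \<longlonglongrightarrow> 0"
      by (simp only: mult_zero_left Lim_null_comparison)
    then show ?thesis by (rule tendsto_dist_iff[THEN iffD2])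
  qed
  have "norm (deriv (g ^^ p) b) \<le> c"
  proof (rule tendsto_upperbound)
    have "(g ^^ p) field_differentiable at b" by (rule funpow_differentiable[OF hol])
    then have "((g ^^ p) has_field_derivative deriv (g ^^ p) b) (at b)"
      by (simp add: field_differentiable_derivI)
    then have "((\<lambda>y. ((g ^^ p) y - (g ^^ p) b) / (y - b)) \<longlongrightarrow> deriv (g ^^ p) b) (at b)"
      by (simp only: has_field_derivative_iff)
    then show "((\<lambda>y. norm (((g ^^ p) y - (g ^^ p) b) / (y - b))) \<longlongrightarrow> norm (deriv (g ^^ p) b)) (at b)"
      by (rule tendsto_norm)
    have "\<forall>\<^sub>F y in at b. y \<in> ball a r" by (intro eventually_at_in_open' open_ball bb)
    moreover have "\<forall>\<^sub>F y in at b. y \<noteq> b" by (simp add: eventually_at_filter)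
    ultimately show "\<forall>\<^sub>F y in at b. norm (((g ^^ p) y - (g ^^ p) b) / (y - b)) \<le> c"
    proof eventually_elim
      case (elim y)
      have "norm ((g ^^ p) y - (g ^^ p) b) \<le> c * norm (y - b)"
        using T(5)[of y b] elim bb by (auto simp: dist_norm)
      then show ?case using elim by (simp add: norm_divide divide_le_eq)
    qed
  qed simp
  then have "norm (deriv (g ^^ p) b) < 1" using T by linarith
  then show ?thesis using that bb b conv unfolding attr_to_def by blast
qed

text \<open>After \<open>p * N\<close> steps the orbit of \<open>s\<close> lies in a trap, and so do
  the orbits of nearby points under nearby maps. Besides attraction this yields a bound for the
  whole orbit that is uniform in the perturbation, the input for later normal-family
  arguments.\<close>

lemma attr_to_stable:
  assumes hol: "f holomorphic_on UNIV" and at: "attr_to f p s a"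
    and G: "luc_tendsto G f F" "\<forall>\<^sub>F i in F. G i holomorphic_on UNIV" and x: "(x \<longlongrightarrow> s) F" and r0: "r0 > 0"
  obtains M where "\<forall>\<^sub>F i in F. (\<exists>b\<in>ball a r0. attr_to (G i) p (x i) b) \<and> (\<forall>m. norm ((G i ^^ m) (x i)) \<le> M)"
proof -
  have p: "p > 0" using attr_to_pos[OF at] .
  have a: "(f ^^ p) a = a" "norm (deriv (f ^^ p) a) < 1" "(\<lambda>m. (f ^^ (p * m)) s) \<longlonglongrightarrow> a"
    using at by (auto simp: attr_to_def)
  obtain r c where rc: "0 < r" "r < r0" "\<forall>\<^sub>F i in F. trap (G i) p a r c"
    by (rule eventually_trap[OF hol a(1,2) G r0])
  have cf: "continuous_on UNIV f" by (rule holomorphic_on_imp_continuous_on[OF hol])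
  obtain N where N: "dist ((f ^^ (p * N)) s) a < r"
    using tendstoD[OF a(3) rc(1)] by (auto simp: eventually_sequentially)
  have lim: "((\<lambda>i. (G i ^^ m) (x i)) \<longlongrightarrow> (f ^^ m) s) F" for m
    by (rule luc_tendsto_eval[OF luc_tendsto_funpow[OF G(1) cf] continuous_on_funpow[OF cf] x])
  have 1: "\<forall>\<^sub>F i in F. dist ((G i ^^ (p * N)) (x i)) a < r"
    using tendsto_dist[OF lim tendsto_const] N by (rule order_tendstoD)
  have 2: "\<forall>\<^sub>F i in F. \<forall>m\<in>{..<p*N}. norm ((G i ^^ m) (x i)) < norm ((f ^^ m) s) + 1"
    using lim by (intro eventually_ball_finite) (auto intro!: order_tendstoD(2)[OF tendsto_norm])
  have 3: "\<forall>\<^sub>F i in F. \<forall>j\<in>{..<p}. \<forall>z\<in>cball a r. dist ((G i ^^ j) z) ((f ^^ j) z) < 1"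
    using luc_tendsto_compact[OF luc_tendsto_funpow[OF G(1) cf] compact_cball]
    by (intro eventually_ball_finite) (auto simp: uniform_limit_iff)
  have "\<exists>B. \<forall>z\<in>cball a r. norm ((f ^^ j) z) \<le> B" for j
  proof -
    have "bounded ((f ^^ j) ` cball a r)"
      by (intro compact_imp_bounded compact_continuous_image)
        (auto intro: continuous_on_subset[OF continuous_on_funpow[OF cf]])
    then show ?thesis by (auto simp: bounded_iff)
  qed
  then obtain B where B: "\<And>j z. z \<in> cball a r \<Longrightarrow> norm ((f ^^ j) z) \<le> B j" by metis
  \<comment> \<open>A time \<open>m\<close> is either one of the first \<open>p * N\<close>, or
    \<open>p * N\<close> plus a multiple of \<open>p\<close> plus a remainder \<open>j < p\<close>;
    in the latter case the orbit point is the image under \<open>j\<close> steps of a point in the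
    trap. The summand 1 pays for the perturbation.\<close>
  define M where "M = Max ((\<lambda>m. norm ((f ^^ m) s) + 1) ` {..<p*N} \<union> (\<lambda>j. B j + 1) ` {..<p})"
  have "\<forall>\<^sub>F i in F. (\<exists>b\<in>ball a r0. attr_to (G i) p (x i) b) \<and> (\<forall>m. norm ((G i ^^ m) (x i)) \<le> M)"
    using 1 2 3 rc(3) G(2)
  proof eventually_elim
    case (elim i)
    let ?y = "(G i ^^ (p * N)) (x i)"
    have y: "?y \<in> cball a r" using elim(1) by (simp add: dist_commute)
    obtain b where b: "b \<in> ball a r" "\<And>x. x \<in> cball a r \<Longrightarrow> attr_to (G i) p x b"
      using trap_attr_to[OF elim(5,4)] by blast
    have "attr_to (G i) p (x i) ((G i ^^ (p * (p * N) - p * N)) b)"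
      by (rule attr_to_preimage[OF elim(5) b(2)[OF y]])
    moreover have "(G i ^^ (p * (p * N) - p * N)) b = b"
    proof -
      have "p * (p * N) - p * N = p * (p * N - N)" by (simp add: diff_mult_distrib2)
      moreover have "(G i ^^ p) b = b" using b(2)[OF y] by (simp add: attr_to_def)
      ultimately show ?thesis using funpow_fixed by metis
    qed
    ultimately have A: "attr_to (G i) p (x i) b" by simp
    have "norm ((G i ^^ m) (x i)) \<le> M" for m
    proof (cases "m < p * N")
      case True
      then have "norm ((G i ^^ m) (x i)) \<le> norm ((f ^^ m) s) + 1" using elim(2) by (simp add: less_imp_le)
      also have "\<dots> \<le> M" unfolding M_def using True by (intro Max_ge) auto
      finally show ?thesis .
    next
      case False
      define j q where "j = (m - p * N) mod p" and "q = (m - p * N) div p"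
      have j: "j < p" using p by (simp add: j_def)
      have "m = j + (p * q + p * N)" using False by (simp add: j_def q_def)
      then have "(G i ^^ m) (x i) = (G i ^^ j) ((G i ^^ (p * q)) ?y)" by (simp add: funpow_add)
      moreover have *: "(G i ^^ (p * q)) ?y \<in> cball a r" by (rule trap_invariant[OF elim(4) y])
      ultimately have "norm ((G i ^^ m) (x i)) \<le> norm ((f ^^ j) ((G i ^^ (p * q)) ?y)) + 1"
        using elim(3) j norm_triangle_sub by (smt (verit) dist_norm lessThan_iff)
      also have "\<dots> \<le> B j + 1" using B[OF *] by simp
      also have "\<dots> \<le> M" unfolding M_def using j by (intro Max_ge) auto
      finally show ?thesis .
    qed
    then show ?case using A b(1) rc(2) by auto
  qed
  then show ?thesis by (rule that)
qed

section \<open>Singular values and inverse branches\<close>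

lemma Hol_star_holomorphic: "f \<in> Hol_star \<Longrightarrow> f holomorphic_on UNIV"
  by (simp add: Hol_star_def entire_def)

lemma Hol_star_continuous: "f \<in> Hol_star \<Longrightarrow> continuous_on UNIV f"
  by (simp add: Hol_star_holomorphic holomorphic_on_imp_continuous_on)

lemma Hol_star_not_constant: "f \<in> Hol_star \<Longrightarrow> \<not> f constant_on UNIV"
proof
  assume f: "f \<in> Hol_star" and "f constant_on UNIV"
  then obtain c where "\<forall>z. f z = 0 * z + c" by (auto simp: constant_on_def)
  then show False using f unfolding Hol_star_def by blast
qed

lemma Hol_star_not_inj: "f \<in> Hol_star \<Longrightarrow> \<not> inj f"
  using injective_entire_imp_linear unfolding Hol_star_def entire_def by blast

lemma Hol_star_open_image: "f \<in> Hol_star \<Longrightarrow> open U \<Longrightarrow> open (f ` U)"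
  using open_mapping_thm[OF Hol_star_holomorphic open_UNIV connected_UNIV _ subset_UNIV Hol_star_not_constant] by blast

lemma Hol_star_range_dense:
  assumes f: "f \<in> Hol_star" and T: "open T" "y \<in> T"
  shows "\<exists>x. f x \<in> T"
proof (rule ccontr)
  assume no: "\<not> ?thesis"
  obtain e where e: "e > 0" "ball y e \<subseteq> T" using T open_contains_ball by metis
  have far: "e \<le> norm (f z - y)" for z
  proof (rule ccontr)
    assume "\<not> ?thesis"
    then have "f z \<in> ball y e" by (simp add: dist_norm norm_minus_commute)
    then show False using e no by blast
  qed
  then have ne: "f z - y \<noteq> 0" for z using e(1) by (metis norm_zero not_le)
  let ?g = "\<lambda>z. 1 / (f z - y)"
  have "?g holomorphic_on UNIV"
    using Hol_star_holomorphic[OF f] ne by (intro holomorphic_intros) auto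
  moreover have "bounded (range ?g)"
    unfolding bounded_iff
  proof (intro exI ballI)
    fix x assume "x \<in> range ?g"
    then obtain z where z: "x = 1 / (f z - y)" by blast
    have "norm x = 1 / norm (f z - y)" unfolding z norm_divide by simp
    also have "\<dots> \<le> 1 / e" using far[of z] e(1) ne[of z] by (intro divide_left_mono mult_pos_pos) auto
    finally show "norm x \<le> 1 / e" .
  qed
  ultimately have "?g constant_on UNIV" by (rule Liouville_theorem)
  then obtain c where c: "\<And>z. 1 / (f z - y) = c" by (auto simp: constant_on_def)
  have "1 / c = f z - y" for z unfolding c[of z, symmetric] by simp
  then have "f z = 1 / c + y" for z by (metis diff_add_cancel)
  then have "f constant_on UNIV" by (auto simp: constant_on_def)
  then show False using Hol_star_not_constant[OF f] by blast
qed

text \<open>The least closed set is the complement of the union of all evenly covered open sets.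
  Density of the range enters because an evenly covered set might otherwise have no sheets, whereas
  a covering map has to be onto.\<close>

lemma sing_vals_covering:
  assumes f: "f \<in> Hol_star"
  shows "closed (sing_vals f)" "covering_space (UNIV - f -` sing_vals f) f (UNIV - sing_vals f)"
proof -
  define good where "good T \<longleftrightarrow> open T \<and> (\<exists>v. \<Union>v = f -` T \<and> (\<forall>u\<in>v. open u) \<and> pairwise disjnt v \<and>
      (\<forall>u\<in>v. \<exists>q. homeomorphism u T f q))" for T
  define S0 where "S0 = - \<Union>{T. good T}"
  have cf: "continuous_on UNIV f" by (rule Hol_star_continuous[OF f])
  have cl: "closed S0" unfolding S0_def closed_def by (auto simp: good_def)
  have goodS0: "T \<subseteq> UNIV - S0" if "good T" for T using that by (auto simp: S0_def)
  have cov: "covering_space (UNIV - f -` S0) f (UNIV - S0)"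
    unfolding covering_space_def
  proof (intro conjI ballI)
    show "continuous_on (UNIV - f -` S0) f" using cf continuous_on_subset by blast
    show "f ` (UNIV - f -` S0) = UNIV - S0"
    proof
      show "UNIV - S0 \<subseteq> f ` (UNIV - f -` S0)"
      proof
        fix y assume y: "y \<in> UNIV - S0"
        then obtain T where T: "good T" "y \<in> T" by (auto simp: S0_def)
        then obtain v where v: "\<Union>v = f -` T" "\<forall>u\<in>v. \<exists>q. homeomorphism u T f q" "open T"
          by (auto simp: good_def)
        obtain x where "f x \<in> T" using Hol_star_range_dense[OF f v(3) T(2)] by blast
        then obtain u where "u \<in> v" using v(1) by blast
        then have "f ` u = T" using v(2) homeomorphism_image1 by blast
        then obtain x where "f x = y" using T(2) by blast
        then show "y \<in> f ` (UNIV - f -` S0)" using y by blast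
      qed
    qed auto
    fix y assume "y \<in> UNIV - S0"
    then obtain T where T: "good T" "y \<in> T" by (auto simp: S0_def)
    then obtain v where v: "\<Union>v = f -` T" "\<forall>u\<in>v. open u" "pairwise disjnt v"
        "\<forall>u\<in>v. \<exists>q. homeomorphism u T f q" "open T"
      by (auto simp: good_def)
    have "openin (top_of_set (UNIV - S0)) T" using v(5) goodS0[OF T(1)] by (intro open_subset)
    moreover have "\<Union>v = (UNIV - f -` S0) \<inter> f -` T" using v(1) goodS0[OF T(1)] by auto
    moreover have "\<forall>u\<in>v. openin (top_of_set (UNIV - f -` S0)) u"
      using v(1,2) goodS0[OF T(1)] by (auto intro!: open_subset)
    ultimately show "\<exists>T. y \<in> T \<and> openin (top_of_set (UNIV - S0)) T \<and> (\<exists>v. \<Union>v = (UNIV - f -` S0) \<inter> f -` T \<and>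
        (\<forall>u\<in>v. openin (top_of_set (UNIV - f -` S0)) u) \<and> pairwise disjnt v \<and> (\<forall>u\<in>v. \<exists>q. homeomorphism u T f q))"
      using T(2) v(3,4) by blast
  qed
  have least: "S0 \<subseteq> S" if S: "closed S \<and> covering_space (UNIV - f -` S) f (UNIV - S)" for S
  proof
    fix y assume yS0: "y \<in> S0"
    show "y \<in> S"
    proof (rule ccontr)
      assume "y \<notin> S"
      then obtain T v where T: "y \<in> T" "openin (top_of_set (UNIV - S)) T" "\<Union>v = (UNIV - f -` S) \<inter> f -` T"
         "\<forall>u\<in>v. openin (top_of_set (UNIV - f -` S)) u" "pairwise disjnt v" "\<forall>u\<in>v. \<exists>q. homeomorphism u T f q"
        using S unfolding covering_space_def by (metis DiffI UNIV_I)
      have oS: "open (UNIV - S)" using S by (simp add: open_Diff)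
      have "closed (f -` S)" using S cf by (simp add: continuous_closed_vimage continuous_on_eq_continuous_at)
      then have oc: "open (UNIV - f -` S)" by (simp add: open_Diff)
      have "T \<subseteq> UNIV - S" using T(2) openin_imp_subset by blast
      then have "\<Union>v = f -` T" using T(3) by auto
      moreover have "open T" using openin_open_eq[OF oS] T(2) by blast
      moreover have "\<forall>u\<in>v. open u" using openin_open_eq[OF oc] T(4) by blast
      ultimately have "good T" unfolding good_def using T(5,6) by blast
      then show False using T(1) yS0 by (auto simp: S0_def)
    qed
  qed
  have "sing_vals f = S0"
    unfolding sing_vals_def by (rule Least_equality) (use cl cov least in auto)
  then show "closed (sing_vals f)" "covering_space (UNIV - f -` sing_vals f) f (UNIV - sing_vals f)"
    using cl cov by auto
qed

text \<open>Without singular values \<open>f\<close> would cover the plane by the plane; the lift of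
  the identity then inverts \<open>f\<close>, which is impossible. Nonemptiness keeps the infimum in
  \<open>Hausdorff_dist\<close> from being taken over the empty set.\<close>

lemma sing_vals_nonempty:
  assumes f: "f \<in> Hol_star" shows "sing_vals f \<noteq> {}"
proof
  assume "sing_vals f = {}"
  then have cov: "covering_space UNIV f UNIV" using sing_vals_covering(2)[OF f] by simp
  have cf: "continuous_on UNIV f" by (rule Hol_star_continuous[OF f])
  obtain g where g: "continuous_on UNIV g" "g (f 0) = 0" "\<And>y. f (g y) = y"
    using covering_space_lift_strong[OF cov UNIV_I UNIV_I, of "\<lambda>x. x" "f 0" 0]
    by (auto simp: convex_imp_simply_connected convex_imp_locally_path_connected)
  have "g (f x) = x" for x
    by (rule covering_space_lift_unique[OF cov, of "\<lambda>x. g (f x)" 0 "\<lambda>x. x" UNIV f])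
      (use g cf in \<open>auto intro: continuous_on_compose2\<close>)
  then have "inj f" by (metis injI)
  then show False using Hol_star_not_inj[OF f] by blast
qed

text \<open>Forward invariance of \<open>P\<close> makes lifting repeatable: a point whose image
  lies outside \<open>P\<close> lies outside \<open>P\<close> itself, so each lift again avoids the
  singular values and can be lifted once more.\<close>

lemma lift_through_funpow:
  fixes B :: "complex set"
  assumes f: "f \<in> Hol_star" and P: "sing_vals f \<subseteq> P" "f ` P \<subseteq> P"
    and B: "simply_connected B" "locally path_connected B" "u \<in> B"
  shows "continuous_on B h \<Longrightarrow> h ` B \<inter> P = {} \<Longrightarrow> (f ^^ k) y = h u \<Longrightarrow>
     \<exists>g. continuous_on B g \<and> g u = y \<and> (\<forall>z\<in>B. (f ^^ k) (g z) = h z \<and> g z \<notin> P)"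
proof (induction k arbitrary: h)
  case 0
  then show ?case by (intro exI[of _ h]) auto
next
  case (Suc k)
  let ?S = "sing_vals f"
  have hP: "h z \<notin> P" if "z \<in> B" for z using Suc.prems(2) that by blast
  have eq: "h u = f ((f ^^ k) y)" using Suc.prems(3) by simp
  have mem: "(f ^^ k) y \<in> UNIV - f -` ?S" using hP[OF B(3)] P(1) eq by auto
  have hB: "h \<in> B \<rightarrow> UNIV - ?S" using hP P(1) by auto
  obtain g1 where g1: "continuous_on B g1" "g1 \<in> B \<rightarrow> UNIV - f -` ?S" "g1 u = (f ^^ k) y"
      "\<And>z. z \<in> B \<Longrightarrow> f (g1 z) = h z"
    by (rule covering_space_lift_strong[OF sing_vals_covering(2)[OF f] mem B(3,1,2) Suc.prems(1) hB eq]) (rule that)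
  have "g1 ` B \<inter> P = {}" using g1(4) hP P(2) by fastforce
  then obtain g where "continuous_on B g" "g u = y" "\<forall>z\<in>B. (f ^^ k) (g z) = g1 z \<and> g z \<notin> P"
    using Suc.IH[OF g1(1) _ g1(3)[symmetric]] by blast
  then show ?case using g1(4) by (intro exI[of _ g]) auto
qed

text \<open>A right inverse is injective, so by invariance of domain its image is open; there
  \<open>F\<close> is injective and has a holomorphic inverse, which must be
  \<open>g\<close>.\<close>

lemma right_inverse_holomorphic:
  assumes "open B" and g: "continuous_on B g" and F: "F holomorphic_on UNIV"
    and inv: "\<And>z. z \<in> B \<Longrightarrow> F (g z) = z"
  shows "g holomorphic_on B"
proof -
  have "inj_on g B" by (metis inj_onI inv)
  then have o: "open (g ` B)" using invariance_of_domain[OF g \<open>open B\<close>] by blast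
  have "inj_on F (g ` B)" using inv by (auto simp: inj_on_def)
  then obtain G where G: "G holomorphic_on F ` (g ` B)" "\<And>w. w \<in> g ` B \<Longrightarrow> G (F w) = w"
    using holomorphic_has_inverse[OF holomorphic_on_subset[OF F subset_UNIV] o] by metis
  have "F ` (g ` B) = B" using inv by force
  then show ?thesis using G inv by (metis (no_types, lifting) holomorphic_transform imageI)
qed

lemma inverse_branch:
  assumes f: "f \<in> Hol_star" and P: "sing_vals f \<subseteq> P" "f ` P \<subseteq> P"
    and B: "simply_connected B" "open B" "u \<in> B" "B \<inter> P = {}" and y: "(f ^^ k) y = u"
  obtains g where "g holomorphic_on B" "g u = y" "\<And>z. z \<in> B \<Longrightarrow> (f ^^ k) (g z) = z" "\<And>z. z \<in> B \<Longrightarrow> g z \<notin> P"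
proof -
  have "\<exists>g. continuous_on B g \<and> g u = y \<and> (\<forall>z\<in>B. (f ^^ k) (g z) = z \<and> g z \<notin> P)"
    by (rule lift_through_funpow[OF f P B(1) open_imp_locally_path_connected[OF B(2)] B(3)]) (use B(4) y in auto)
  then obtain g where g: "continuous_on B g" "g u = y" "\<forall>z\<in>B. (f ^^ k) (g z) = z \<and> g z \<notin> P"
    by blast
  then have "g holomorphic_on B"
    using right_inverse_holomorphic[OF B(2) g(1) holomorphic_on_funpow[OF Hol_star_holomorphic[OF f]]] by blast
  then show ?thesis using that g by blast
qed

section \<open>Hyperbolicity as attraction of all singular values\<close>

text \<open>Brouwer's theorem for \<open>z - F z + v\<close>. A displacement of at most
  \<open>R - s\<close> on the disc means that the concentric closed disc of radius \<open>s\<close>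
  is covered; \<open>s = 0\<close> still yields the centre.\<close>

lemma near_identity_onto:
  fixes F :: "complex \<Rightarrow> complex"
  assumes "continuous_on (cball u R) F" "R > 0" "0 \<le> s" "\<And>z. z \<in> cball u R \<Longrightarrow> norm (F z - z) \<le> R - s"
    and v: "norm (v - u) \<le> s"
  obtains y where "y \<in> cball u R" "F y = v"
proof -
  obtain y where "y \<in> cball u R" "y - F y + v = y"
  proof (rule brouwer_ball[OF assms(2), of u "\<lambda>z. z - F z + v"])
    show "continuous_on (cball u R) (\<lambda>z. z - F z + v)" using assms(1) by (intro continuous_intros)
    show "(\<lambda>z. z - F z + v) \<in> cball u R \<rightarrow> cball u R"
    proof
      fix z assume "z \<in> cball u R"
      have "norm (z - F z + v - u) \<le> norm (z - F z) + norm (v - u)"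
        by (metis add_diff_eq norm_triangle_ineq)
      also have "\<dots> \<le> R" using assms(4)[OF \<open>z \<in> cball u R\<close>] v by (simp add: norm_minus_commute)
      finally show "z - F z + v \<in> cball u R" by (simp add: dist_norm norm_minus_commute)
    qed
  qed
  then show ?thesis using that by (metis add_diff_cancel_left' add_diff_eq diff_add_eq eq_iff_diff_eq_0 right_minus_eq)
qed

text \<open>A quantitative substitute for the Fatou set: at points with bounded orbit the two
  notions agree, while Fatou points with unbounded orbit are left out. A uniform bound on a disc
  gives Cauchy estimates for all iterates at once.\<close>

definition bounded_orbit_set :: "(complex \<Rightarrow> complex) \<Rightarrow> complex set" where
  "bounded_orbit_set f = {z. \<exists>r>0. \<exists>M. \<forall>m. \<forall>x\<in>cball z r. norm ((f ^^ m) x) \<le> M}"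

lemma bounded_orbit_setE:
  assumes "z \<in> bounded_orbit_set f"
  obtains r M where "r > 0" "\<And>m x. x \<in> cball z r \<Longrightarrow> norm ((f ^^ m) x) \<le> M"
  using assms unfolding bounded_orbit_set_def by blast

lemma open_bounded_orbit_set: "open (bounded_orbit_set f)"
  unfolding open_contains_ball
proof
  fix z assume "z \<in> bounded_orbit_set f"
  then obtain r M where r: "r > 0" "\<forall>m. \<forall>x\<in>cball z r. norm ((f ^^ m) x) \<le> M" by (auto simp: bounded_orbit_set_def)
  have "y \<in> bounded_orbit_set f" if "y \<in> ball z (r/2)" for y
  proof -
    have "cball y (r/2) \<subseteq> cball z r"
    proof
      fix x assume "x \<in> cball y (r/2)"
      then show "x \<in> cball z r" using that dist_triangle[of z x y] by simp
    qed
    then have "\<forall>m. \<forall>x\<in>cball y (r/2). norm ((f ^^ m) x) \<le> M" using r by blast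
    then show ?thesis using r unfolding bounded_orbit_set_def by (intro CollectI exI[of _ "r/2"]) auto
  qed
  then show "\<exists>e>0. ball z e \<subseteq> bounded_orbit_set f" using r by (intro exI[of _ "r/2"]) auto
qed

text \<open>If no disc worked, some iterates would exceed every \<open>n\<close> at points of a
  fixed disc. A finite limit function bounds a subsequence there; the limit infinity contradicts the
  bounded orbit of \<open>z\<close> itself.\<close>

lemma Fatou_bounded_orbit:
  assumes f: "continuous_on UNIV f" and z: "z \<in> Fatou f" and bd: "\<And>m. norm ((f ^^ m) z) \<le> M0"
  shows "z \<in> bounded_orbit_set f"
proof -
  obtain U where U: "open U" "z \<in> U" "normal_family U (range (\<lambda>n. f ^^ n))" using z by (auto simp: Fatou_def)
  obtain r where r: "r > 0" "cball z r \<subseteq> U" using U open_contains_cball by metis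
  show ?thesis
  proof (rule ccontr)
    assume "\<not> ?thesis"
    then have "\<not> (\<forall>m. \<forall>x\<in>cball z r. norm ((f ^^ m) x) \<le> M)" for M using r(1) by (auto simp: bounded_orbit_set_def)
    then have "\<exists>m x. x \<in> cball z r \<and> real n < norm ((f ^^ m) x)" for n :: nat by (meson not_le)
    then obtain m x where mx: "\<And>n. x n \<in> cball z r" "\<And>n. real n < norm ((f ^^ (m n)) (x n))" by metis
    obtain s where s: "strict_mono (s :: nat \<Rightarrow> nat)"
      and alt: "(\<exists>g. g holomorphic_on U \<and> (\<forall>K. compact K \<and> K \<subseteq> U \<longrightarrow> 
            uniform_limit K ((\<lambda>n. f ^^ (m n)) \<circ> s) g sequentially)) \<or>
         (\<forall>K B. compact K \<and> K \<subseteq> U \<longrightarrow> (\<forall>\<^sub>F n in sequentially. \<forall>z\<in>K. B < norm ((f ^^ (m (s n))) z)))"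
      using U(3)[unfolded normal_family_def, rule_format, of "\<lambda>n. f ^^ (m n)"] by blast
    from alt show False
    proof
      assume "\<exists>g. g holomorphic_on U \<and> (\<forall>K. compact K \<and> K \<subseteq> U \<longrightarrow> uniform_limit K ((\<lambda>n. f ^^ (m n)) \<circ> s) g sequentially)"
      then obtain g where g: "g holomorphic_on U" "uniform_limit (cball z r) ((\<lambda>n. f ^^ (m n)) \<circ> s) g sequentially"
        using r compact_cball by blast
      have "compact (g ` cball z r)"
        using r g(1) by (intro compact_continuous_image) (auto intro: holomorphic_on_imp_continuous_on holomorphic_on_subset)
      then obtain B where B: "\<And>x. x \<in> cball z r \<Longrightarrow> norm (g x) \<le> B"
        using compact_imp_bounded by (force simp: bounded_iff)
      have "\<forall>\<^sub>F n in sequentially. \<forall>x\<in>cball z r. dist ((f ^^ (m (s n))) x) (g x) < 1"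
        using g(2) by (auto simp: uniform_limit_iff)
      moreover have "\<forall>\<^sub>F n in sequentially. real n \<ge> B + 1" by real_asymp
      ultimately obtain n where n: "\<forall>x\<in>cball z r. dist ((f ^^ (m (s n))) x) (g x) < 1" "real n \<ge> B + 1"
        using eventually_happens'[OF sequentially_bot eventually_conj] by blast
      have "norm ((f ^^ (m (s n))) (x (s n))) < B + 1"
        using n(1) mx(1)[of "s n"] B[OF mx(1)[of "s n"]] norm_triangle_sub[of "(f ^^ (m (s n))) (x (s n))" "g (x (s n))"]
        by (auto simp: dist_norm dest!: bspec[of _ _ "x (s n)"])
      moreover have "real n \<le> real (s n)" using seq_suble[OF s] by simp
      ultimately show False using mx(2)[of "s n"] n(2) by linarith
    next
      assume H: "\<forall>K B. compact K \<and> K \<subseteq> U \<longrightarrow> (\<forall>\<^sub>F n in sequentially. \<forall>z\<in>K. B < norm ((f ^^ (m (s n))) z))"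
      have "\<forall>\<^sub>F n in sequentially. \<forall>z\<in>{z}. M0 < norm ((f ^^ (m (s n))) z)"
        by (rule H[rule_format]) (use U(2) in auto)
      then obtain n where "M0 < norm ((f ^^ (m (s n))) z)" by (auto simp: eventually_sequentially)
      then show False using bd[of "m (s n)"] by simp
    qed
  qed
qed

lemma bounded_orbit_set_equicont:
  assumes f: "f holomorphic_on UNIV" and a: "a \<in> bounded_orbit_set f"
  obtains r L where "r > 0" "L > 0" "\<And>m x. x \<in> cball a r \<Longrightarrow> norm ((f ^^ m) x - (f ^^ m) a) \<le> L * norm (x - a)"
proof -
  obtain R M where R: "R > 0" "\<And>m x. x \<in> cball a R \<Longrightarrow> norm ((f ^^ m) x) \<le> M"
    using bounded_orbit_setE[OF a] by blast
  have "norm ((f ^^ 0) a) \<le> M" by (rule R(2)) (use R(1) in simp)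
  then have M: "M \<ge> 0" using norm_ge_zero[of "(f ^^ 0) a"] by linarith
  have "norm ((f ^^ m) x - (f ^^ m) a) \<le> (M / (R/2)) * norm (x - a)" if "x \<in> cball a (R/2)" for m x
  proof (rule field_differentiable_bound[OF convex_cball[of a "R/2"]])
    fix z assume z: "z \<in> cball a (R/2)"
    show "((f ^^ m) has_field_derivative deriv (f ^^ m) z) (at z within cball a (R/2))"
      using funpow_differentiable[OF f] by (simp add: field_differentiable_derivI has_field_derivative_at_within)
    show "norm (deriv (f ^^ m) z) \<le> M / (R/2)"
    proof (rule norm_deriv_le_Cauchy[OF holomorphic_on_funpow[OF f]])
      fix x assume "x \<in> cball z (R/2)"
      then have "x \<in> cball a R" using z dist_triangle[of a x z] by simp
      then show "norm ((f ^^ m) x) \<le> M" by (rule R(2))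
    qed (use R in auto)
  qed (use that R in auto)
  then have "norm ((f ^^ m) x - (f ^^ m) a) \<le> (M / (R/2) + 1) * norm (x - a)" if "x \<in> cball a (R/2)" for m x
    using that by (smt (verit) mult_right_mono norm_ge_zero)
  then show ?thesis using that[of "R/2" "M / (R/2) + 1"] R(1) M by (smt (verit) divide_nonneg_pos half_gt_zero)
qed

text \<open>Iterates tending to the identity near a point of \<open>P\<close> would do so beyond the bounded Fatou
  components: inverse branches near a boundary point \<open>b\<close> exist because \<open>b\<close> is far from \<open>P\<close>, and
  they form a normal family since they omit \<open>P\<close> and the orbit of a point close to \<open>a\<close>.\<close>

lemma no_recurrence:
  assumes f: "f \<in> Hol_star" and P: "compact P" "sing_vals f \<subseteq> P" "f ` P \<subseteq> P" "P \<subseteq> bounded_orbit_set f"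
    and a: "a \<in> P" and k: "\<And>j. k j \<ge> (1::nat)" and r: "r > 0"
    and lim: "uniform_limit (ball a r) (\<lambda>j. f ^^ (k j)) (\<lambda>x. x) sequentially"
  shows False
proof -
  let ?F = "\<lambda>j. f ^^ (k j)"
  have hol: "f holomorphic_on UNIV" and cf: "continuous_on UNIV f"
    using f Hol_star_holomorphic Hol_star_continuous by auto
  have cfp: "continuous_on X (f ^^ m)" for X m
    using continuous_on_funpow[OF cf] continuous_on_subset by blast
  \<comment> \<open>\<open>U\<close> is the open set near whose points the chosen iterates tend to
    the identity. A boundary point \<open>b\<close> of it will lead to the contradiction.\<close>
  define U where "U = {z. \<exists>r>0. uniform_limit (ball z r) ?F (\<lambda>x. x) sequentially}"
  have "open U"
    unfolding open_contains_ball
  proof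
    fix z assume "z \<in> U"
    then obtain r where r: "r > 0" "uniform_limit (ball z r) ?F (\<lambda>x. x) sequentially" by (auto simp: U_def)
    have "y \<in> U" if "y \<in> ball z (r/2)" for y
    proof -
      have "ball y (r/2) \<subseteq> ball z r"
      proof
        fix x assume "x \<in> ball y (r/2)"
        then show "x \<in> ball z r" using that dist_triangle[of z x y] by simp
      qed
      then show ?thesis using r uniform_limit_on_subset unfolding U_def by (intro CollectI exI[of _ "r/2"]) auto
    qed
    then show "\<exists>e>0. ball z e \<subseteq> U" using r by (intro exI[of _ "r/2"]) auto
  qed
  have limU: "(\<lambda>j. ?F j z) \<longlonglongrightarrow> z" if zU: "z \<in> U" for z
  proof -
    obtain r where r: "r > 0" "uniform_limit (ball z r) ?F (\<lambda>x. x) sequentially" using zU by (auto simp: U_def)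
    from tendsto_uniform_limitI[OF r(2), of z] r(1) show ?thesis by simp
  qed
  have "a \<in> U" using r lim by (auto simp: U_def)
  \<comment> \<open>Convergence to the identity on the whole plane would make \<open>f\<close>
    injective: \<open>f x = f y\<close> gives equal values under every iterate of order
    \<open>k j \<ge> 1\<close>.\<close>
  have "U \<noteq> UNIV"
  proof
    assume U: "U = UNIV"
    have "inj f"
    proof
      fix x y assume xy: "f x = f y"
      have "?F j x = ?F j y" for j
      proof -
        obtain i where "k j = Suc i" using k[of j] by (cases "k j") auto
        then show ?thesis using xy by (simp add: funpow_swap1)
      qed
      then show "x = y" using limU[of x] limU[of y] U LIMSEQ_unique by auto
    qed
    then show False using Hol_star_not_inj[OF f] by blast
  qed
  then have "frontier U \<noteq> {}" using \<open>a \<in> U\<close> by (intro frontier_not_empty) auto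
  then obtain b where b: "b \<in> closure U" "b \<notin> U" using \<open>open U\<close> by (auto simp: frontier_def interior_open)
  \<comment> \<open>Bounded orbits around \<open>b\<close> would let Vitali's theorem carry the
    convergence from \<open>U\<close> across \<open>b\<close>.\<close>
  have bnot: "b \<notin> bounded_orbit_set f"
  proof
    assume "b \<in> bounded_orbit_set f"
    then obtain R M where R: "R > 0" "\<And>m x. x \<in> cball b R \<Longrightarrow> norm ((f ^^ m) x) \<le> M"
      using bounded_orbit_setE by blast
    have V: "open (ball b R \<inter> U)" "ball b R \<inter> U \<noteq> {}" "ball b R \<inter> U \<subseteq> ball b R"
    proof -
      obtain u where "u \<in> U" "dist u b < R" using b(1) R(1) by (auto simp: closure_approachable)
      then show "ball b R \<inter> U \<noteq> {}" by (auto simp: dist_commute)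
    qed (use \<open>open U\<close> in auto)
    obtain A where A: "A holomorphic_on ball b R" "uniform_limit (cball b (R/2)) ?F A sequentially"
        "\<And>z. z \<in> ball b R \<inter> U \<Longrightarrow> A z = z"
    proof (rule vitali_convergence[OF open_ball convex_connected[OF convex_ball] _ _ V, of ?F "\<lambda>z. z"])
      show "?F n holomorphic_on ball b R" for n
        using holomorphic_on_funpow[OF hol] holomorphic_on_subset by blast
      show "\<exists>B. \<forall>n. \<forall>z\<in>K. norm (?F n z) \<le> B" if "compact K" "K \<subseteq> ball b R" for K
        using R(2) that ball_subset_cball by blast
      show "(\<lambda>n. ?F n z) \<longlonglongrightarrow> z" if "z \<in> ball b R \<inter> U" for z using limU that by blast
    qed (use R(1) in \<open>auto simp: cball_subset_ball_iff\<close>)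
    have "A z = z" if "z \<in> ball b R" for z
      by (rule analytic_continuation_open[OF V(1) open_ball V(2) convex_connected[OF convex_ball] V(3) A(1) _ _ that])
        (use A(3) in \<open>auto intro: holomorphic_intros\<close>)
    then have "uniform_limit (cball b (R/2)) ?F (\<lambda>x. x) sequentially"
      using A(2) R(1) by (intro uniform_limit_cong'[THEN iffD1, OF _ _ A(2)]) auto
    then have "uniform_limit (ball b (R/2)) ?F (\<lambda>x. x) sequentially"
      using uniform_limit_on_subset ball_subset_cball by blast
    then show False using b(2) R(1) unfolding U_def by (metis (no_types, lifting) half_gt_zero mem_Collect_eq)
  qed
  obtain \<rho> where \<rho>: "\<rho> > 0" "(\<Union>x\<in>P. ball x \<rho>) \<subseteq> bounded_orbit_set f"
    using compact_subset_open_imp_ball_epsilon_subset[OF P(1) open_bounded_orbit_set P(4)] by blast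
  have farP: "\<rho> \<le> dist b y" if "y \<in> P" for y
  proof (rule ccontr)
    assume "\<not> \<rho> \<le> dist b y"
    then have "b \<in> ball y \<rho>" by (simp add: dist_commute)
    then show False using that \<rho>(2) bnot by blast
  qed
  obtain r2 L where L: "r2 > 0" "L > 0" "\<And>m x. x \<in> cball a r2 \<Longrightarrow> norm ((f ^^ m) x - (f ^^ m) a) \<le> L * norm (x - a)"
    using bounded_orbit_set_equicont[OF hol] a P(4) by blast
  \<comment> \<open>\<open>\<delta>\<close> is small enough that the orbit of
    \<open>x = a + \<delta>\<close> stays within \<open>\<rho> / 2\<close> of the orbit of
    \<open>a\<close>. Since \<open>b\<close> has distance at least \<open>\<rho>\<close> from
    \<open>P\<close>, the ball \<open>B\<close> of radius \<open>\<rho> / 2\<close> avoids this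
    orbit too, and inverse branches on \<open>B\<close> omit the two values \<open>a\<close> and
    \<open>x\<close>.\<close>
  define \<delta> where "\<delta> = min r2 (\<rho> / (2 * L))"
  have \<delta>: "\<delta> > 0" "\<delta> \<le> r2" "L * \<delta> \<le> \<rho> / 2"
    using L \<rho>(1) by (auto simp: \<delta>_def min_def field_simps)
  define x where "x = a + of_real \<delta>"
  have xa: "norm (x - a) = \<delta>" "x \<noteq> a" using \<delta> by (auto simp: x_def)
  have Pm: "(f ^^ m) y \<in> P" if "y \<in> P" for m y using that P(3) by (induction m) auto
  have orbx: "norm ((f ^^ m) x - (f ^^ m) a) \<le> \<rho> / 2" for m
    using L(3)[of x m] xa \<delta> by (simp add: dist_norm norm_minus_commute) 
  define Q where "Q = P \<union> range (\<lambda>m. (f ^^ m) x)"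
  have fQ: "f ` Q \<subseteq> Q"
  proof -
    have "f ((f ^^ m) x) \<in> range (\<lambda>m. (f ^^ m) x)" for m by (rule range_eqI[of _ _ "Suc m"]) simp
    then show ?thesis using P(3) by (auto simp: Q_def)
  qed
  define B where "B = ball b (\<rho> / 2)"
  have BQ: "B \<inter> Q = {}"
  proof -
    have "\<rho> / 2 \<le> dist b ((f ^^ m) x)" for m
      using farP[OF Pm[OF a], of m] orbx[of m] dist_triangle[of b "(f ^^ m) a" "(f ^^ m) x"]
      by (simp add: dist_norm)
    moreover have "\<rho> / 2 \<le> dist b y" if "y \<in> P" for y using farP[OF that] \<rho>(1) by simp
    ultimately have "\<rho> / 2 \<le> dist b y" if "y \<in> Q" for y using that unfolding Q_def by blast
    then show ?thesis unfolding B_def by (meson disjoint_iff mem_ball not_le)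
  qed
  have B: "simply_connected B" "open B" "connected B"
    by (auto simp: B_def convex_imp_simply_connected convex_connected)
  obtain u where u: "u \<in> U" "u \<in> B" using b(1) \<rho>(1) unfolding B_def closure_approachable
    by (metis dist_commute half_gt_zero mem_ball)
  obtain r1 where r1: "r1 > 0" "uniform_limit (ball u r1) ?F (\<lambda>x. x) sequentially" using u(1) by (auto simp: U_def)
  obtain r3 where r3: "r3 > 0" "cball u r3 \<subseteq> B" using u(2) B(2) open_contains_cball by metis
  define r0 where "r0 = min (r1/2) r3"
  have r0: "r0 > 0" "cball u r0 \<subseteq> B" "cball u r0 \<subseteq> ball u r1"
    using r1 r3 by (auto simp: r0_def)
  have ul: "uniform_limit (cball u r0) ?F (\<lambda>x. x) sequentially" using uniform_limit_on_subset[OF r1(2) r0(3)] .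
  then have "\<forall>\<^sub>F j in sequentially. \<forall>z\<in>cball u r0. dist (?F j z) z < r0" using r0 by (simp add: uniform_limit_iff)
  then obtain J where "\<forall>j\<ge>J. \<forall>z\<in>cball u r0. dist (?F j z) z < r0"
    unfolding eventually_sequentially by blast
  then have J: "dist (?F (j + J) z) z < r0" if "z \<in> cball u r0" for j z using that by simp
  define F where "F j = ?F (j + J)" for j
  have ulF: "uniform_limit (cball u r0) F (\<lambda>x. x) sequentially"
    using ul unfolding F_def uniform_limit_iff eventually_sequentially by (metis trans_le_add1)
  have "\<exists>g. g holomorphic_on B \<and> g u \<in> cball u r0 \<and> (\<forall>z\<in>B. F j (g z) = z \<and> g z \<notin> Q)" for j
  proof -
    \<comment> \<open>A preimage of \<open>u\<close> close to \<open>u\<close> selects the branch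
      that is near the identity; it also bounds \<open>g j u\<close>, as the normality criterion
      requires.\<close>
    obtain y where y: "y \<in> cball u r0" "F j y = u"
    proof (rule near_identity_onto[of u r0 "F j" 0 u])
      show "continuous_on (cball u r0) (F j)" unfolding F_def by (rule cfp)
      show "norm (F j z - z) \<le> r0 - 0" if "z \<in> cball u r0" for z
        using J[OF that, of j] by (simp add: F_def dist_norm)
    qed (use r0 in auto)
    obtain g where "g holomorphic_on B" "g u = y" "\<And>z. z \<in> B \<Longrightarrow> F j (g z) = z" "\<And>z. z \<in> B \<Longrightarrow> g z \<notin> Q"
      using inverse_branch[OF f _ fQ B(1,2) u(2) BQ, of "k (j + J)" y] y(2) P(2) unfolding F_def by (auto simp: Q_def)
    then show ?thesis using y by blast
  qed
  then obtain g where g: "\<And>j. g j holomorphic_on B" "\<And>j. g j u \<in> cball u r0"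
      "\<And>j z. z \<in> B \<Longrightarrow> F j (g j z) = z" "\<And>j z. z \<in> B \<Longrightarrow> g j z \<notin> Q"
    by metis
  have bd: "\<exists>C. \<forall>j. \<forall>z\<in>K. norm (g j z) \<le> C" if K: "compact K" "K \<subseteq> B" for K
  proof -
    have "\<exists>C. \<forall>j\<in>UNIV. \<forall>z\<in>K. norm (g j z) \<le> C"
    proof (rule normal_omit_two[OF B(2,3) u(2) K, of UNIV g "\<lambda>_ _. a" "\<lambda>_ _. x" "Max {norm u + r0, norm a, norm x}" "norm (x - a)"])
      fix j z assume "z \<in> B"
      have "a \<in> Q" "x \<in> Q" using a by (auto simp: Q_def intro: range_eqI[of _ _ 0])
      then show "a \<noteq> x \<and> g j z \<noteq> a \<and> g j z \<noteq> x" using g(4)[OF \<open>z \<in> B\<close>] xa(2) by metis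
    next
      fix j
      have "norm (g j u) \<le> norm u + r0" using g(2)[of j] norm_triangle_sub[of "g j u" u] by (simp add: dist_norm norm_minus_commute)
      then show "norm (g j u) \<le> Max {norm u + r0, norm a, norm x}" by simp
    qed (use g(1) xa in auto)
    then show ?thesis by blast
  qed
  obtain C0 where C0: "\<And>j z. z \<in> cball u r0 \<Longrightarrow> norm (g j z) \<le> C0" using bd[OF compact_cball r0(2)] by blast
  define C where "C = \<bar>C0\<bar> + 1"
  have C: "C > 0" "norm (g j z) \<le> C" if "z \<in> cball u r0" for j z
    using C0[OF that, of j] by (auto simp: C_def)
  have C1: "C > 0" by (simp add: C_def)
  \<comment> \<open>The Cauchy estimate bounds the derivatives of all branches by
    \<open>2 * C / r0\<close> near \<open>u\<close>. On the disc of radius \<open>d\<close> each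
    branch thus varies by at most \<open>r0 / 2\<close>, and eventually takes values where
    \<open>F j\<close> is close to the identity.\<close>
  define d where "d = min (r0 / 2) (r0 * r0 / (4 * C))"
  have d: "d > 0" "d \<le> r0 / 2" "(2 * C / r0) * d \<le> r0 / 2"
    using r0(1) C1 by (auto simp: d_def min_def field_simps)
  have close: "norm (g j z - g j u) \<le> r0 / 2" if z: "z \<in> ball u d" for j z
  proof -
    have "norm (g j z - g j u) \<le> (C / (r0/2)) * norm (z - u)"
    proof (rule field_differentiable_bound[OF convex_cball[of u "r0/2"]])
      fix w assume w: "w \<in> cball u (r0/2)"
      have wB: "cball w (r0/2) \<subseteq> cball u r0"
      proof
        fix v assume "v \<in> cball w (r0/2)"
        then show "v \<in> cball u r0" using w dist_triangle[of u v w] by simp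
      qed
      moreover have "w \<in> cball w (r0/2)" using r0 by simp
      ultimately have "w \<in> B" using r0 by blast
      then show "(g j has_field_derivative deriv (g j) w) (at w within cball u (r0/2))"
        using holomorphic_derivI[OF g(1) B(2)] by blast
      show "norm (deriv (g j) w) \<le> C / (r0/2)"
        by (rule norm_deriv_le_Cauchy[OF g(1) B(2)]) (use wB r0 C1 C(2) in auto)
    qed (use z d r0 in auto)
    also have "\<dots> \<le> (C / (r0/2)) * d" using z C1 r0 by (intro mult_left_mono) (auto simp: dist_norm norm_minus_commute)
    also have "\<dots> = (2 * C / r0) * d" by simp
    finally show ?thesis using d(3) by linarith
  qed
  have conv: "(\<lambda>j. g j z) \<longlonglongrightarrow> z" if z: "z \<in> ball u d" for z
  proof (rule tendstoI)
    fix e :: real assume e: "e > 0"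
    have "\<forall>\<^sub>F j in sequentially. \<forall>w\<in>cball u r0. dist (F j w) w < min e (r0/2)"
      by (rule ulF[unfolded uniform_limit_iff, rule_format]) (use e r0(1) in simp)
    then show "\<forall>\<^sub>F j in sequentially. dist (g j z) z < e"
    proof eventually_elim
      case (elim j)
      have "dist (F j (g j u)) (g j u) < r0/2" using elim g(2)[of j] by auto
      then have "dist u (g j u) < r0/2" using g(3)[OF u(2)] by simp
      moreover have "dist (g j u) (g j z) \<le> r0/2" using close[OF z, of j] by (simp add: dist_norm norm_minus_commute)
      ultimately have "g j z \<in> cball u r0" using dist_triangle[of u "g j z" "g j u"] by simp
      then have "dist (F j (g j z)) (g j z) < e" using elim by auto
      moreover have "z \<in> B" using z d r0 by auto
      ultimately show ?case using g(3) by (simp add: dist_commute)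
    qed
  qed
  have dB: "ball u d \<subseteq> B" using d r0 by auto
  obtain A where A: "A holomorphic_on B" "\<And>K. compact K \<Longrightarrow> K \<subseteq> B \<Longrightarrow> uniform_limit K g A sequentially"
      "\<And>z. z \<in> ball u d \<Longrightarrow> A z = z"
    using vitali_convergence[OF B(2,3) g(1) bd open_ball _ dB conv] d(1) by (metis ball_eq_empty not_le)
  have Aid: "A z = z" if "z \<in> B" for z
    by (rule analytic_continuation_open[OF open_ball[of u d] B(2) _ B(3) dB A(1) _ _ that])
      (use A(3) d in \<open>auto intro: holomorphic_intros\<close>)
  have K: "cball b (\<rho>/4) \<subseteq> B" using \<rho>(1) by (auto simp: B_def)
  have ulg: "\<forall>\<^sub>F j in sequentially. \<forall>z\<in>cball b (\<rho>/4). dist (g j z) z < e" if "e > 0" for e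
  proof -
    have "\<forall>\<^sub>F j in sequentially. \<forall>z\<in>cball b (\<rho>/4). dist (g j z) (A z) < e"
      using A(2)[OF compact_cball K] that unfolding uniform_limit_iff by blast
    then show ?thesis
    proof eventually_elim
      case (elim j)
      show ?case
      proof
        fix z assume z: "z \<in> cball b (\<rho>/4)"
        then have "A z = z" using Aid K by blast
        then show "dist (g j z) z < e" using elim z by metis
      qed
    qed
  qed
  \<comment> \<open>Around \<open>b\<close> the branches tend to the identity; being nearly the
    identity they cover a smaller ball, on which \<open>F j\<close> is therefore their inverse and
    tends to the identity as well. This puts \<open>b\<close> into \<open>U\<close>.\<close>
  have "uniform_limit (ball b (\<rho>/8)) F (\<lambda>x. x) sequentially"
    unfolding uniform_limit_iff
  proof (intro allI impI)
    fix e :: real assume e: "e > 0"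
    have "\<forall>\<^sub>F j in sequentially. \<forall>z\<in>cball b (\<rho>/4). dist (g j z) z < min e (\<rho>/8)"
      using e \<rho>(1) by (intro ulg) simp
    then show "\<forall>\<^sub>F j in sequentially. \<forall>x\<in>ball b (\<rho>/8). dist (F j x) x < e"
    proof eventually_elim
      case (elim j)
      show ?case
      proof
        fix z assume z: "z \<in> ball b (\<rho>/8)"
        have cg: "continuous_on (cball b (\<rho>/4)) (g j)"
          using holomorphic_on_imp_continuous_on[OF g(1)] K continuous_on_subset by blast
        have bound: "norm (g j w - w) \<le> \<rho>/4 - \<rho>/8" if "w \<in> cball b (\<rho>/4)" for w
          using elim that by (force simp: dist_norm)
        obtain y where y: "y \<in> cball b (\<rho>/4)" "g j y = z"
          by (rule near_identity_onto[OF cg _ _ bound, of z]) (use \<rho>(1) z in \<open>auto simp: dist_norm norm_minus_commute less_imp_le\<close>)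
        have "F j z = y" using g(3)[of y j] y K by auto
        then show "dist (F j z) z < e" using elim y by (force simp: dist_commute)
      qed
    qed
  qed
  then have ul8: "\<forall>\<^sub>F j in sequentially. \<forall>x\<in>ball b (\<rho>/8). dist (?F (j + J) x) x < e" if "e > 0" for e
    using that unfolding uniform_limit_iff F_def by blast
  have "uniform_limit (ball b (\<rho>/8)) ?F (\<lambda>x. x) sequentially"
    unfolding uniform_limit_iff
  proof (intro allI impI)
    fix e :: real assume "e > 0"
    from ul8[OF this] show "\<forall>\<^sub>F j in sequentially. \<forall>x\<in>ball b (\<rho>/8). dist (?F j x) x < e"
      by (rule eventually_sequentially_seg[of "\<lambda>j. \<forall>x\<in>ball b (\<rho>/8). dist (?F j x) x < e" J, THEN iffD1])
  qed
  then show False using b(2) \<rho>(1) unfolding U_def by (metis (no_types, lifting) divide_pos_pos mem_Collect_eq zero_less_numeral)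
qed

section \<open>Contraction near the postsingular set\<close>

lemma postsing_facts:
  assumes f: "f \<in> Hol_star"
  shows "closed (postsing f)" "sing_vals f \<subseteq> postsing f" "f ` postsing f \<subseteq> postsing f"
proof -
  let ?X = "\<Union>n. (f ^^ n) ` sing_vals f"
  show "closed (postsing f)" by (simp add: postsing_def)
  have "(f ^^ 0) ` sing_vals f \<subseteq> ?X" by blast
  then show "sing_vals f \<subseteq> postsing f" unfolding postsing_def using closure_subset by force
  have "f ` ?X \<subseteq> ?X"
  proof
    fix y assume "y \<in> f ` ?X"
    then obtain n s where "s \<in> sing_vals f" "y = f ((f ^^ n) s)" by blast
    then have "y = (f ^^ Suc n) s" by simp
    then show "y \<in> ?X" using \<open>s \<in> sing_vals f\<close> by blast
  qed
  then have fX: "f ` ?X \<subseteq> closure ?X" using closure_subset by (rule order_trans)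
  have "f ` closure ?X \<subseteq> closure ?X"
    by (rule image_closure_subset[OF continuous_on_subset[OF Hol_star_continuous[OF f] subset_UNIV] closed_closure fX])
  then show "f ` postsing f \<subseteq> postsing f" by (simp add: postsing_def)
qed

text \<open>Otherwise some limit of iterates near a postsingular point is nonconstant. Comparing
  consecutive members of the convergent subsequence produces iterates that tend to the identity near
  a postsingular point, which \<open>no_recurrence\<close> excludes. This takes the place of the
  classification of Fatou components.\<close>

lemma hyperbolic_contracting:
  assumes hyp: "nonescaping_hyperbolic f"
  obtains N where "N \<ge> 1" "\<And>z. z \<in> postsing f \<Longrightarrow> norm (deriv (f ^^ N) z) < 1/2"
proof (rule ccontr)
  assume neg: "\<not> thesis"
  have f: "f \<in> Hol_star" and bP: "bounded (postsing f)" and PF: "postsing f \<subseteq> Fatou f"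
    using hyp by (auto simp: nonescaping_hyperbolic_def)
  let ?P = "postsing f"
  note P = postsing_facts[OF f]
  have hol: "f holomorphic_on UNIV" and cf: "continuous_on UNIV f"
    using f Hol_star_holomorphic Hol_star_continuous by auto
  have holm: "(f ^^ m) holomorphic_on X" for m X using holomorphic_on_funpow[OF hol] holomorphic_on_subset by blast
  have cP: "compact ?P" using P(1) bP by (simp add: compact_eq_bounded_closed)
  have Pm: "(f ^^ m) y \<in> ?P" if "y \<in> ?P" for m y using that P(3) by (induction m) auto
  obtain M0 where M0: "\<And>y. y \<in> ?P \<Longrightarrow> norm y \<le> M0" using bP by (auto simp: bounded_iff)
  have POm: "?P \<subseteq> bounded_orbit_set f"
  proof
    fix z assume z: "z \<in> ?P"
    show "z \<in> bounded_orbit_set f"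
      by (rule Fatou_bounded_orbit[OF cf, of _ M0]) (use z PF M0 Pm in auto)
  qed
  have "\<exists>z\<in>?P. 1/2 \<le> norm (deriv (f ^^ Suc n) z)" for n
    using neg that[of "Suc n"] by (metis not_le le_add1 plus_1_eq_Suc)
  then obtain \<zeta> where \<zeta>: "\<And>n. \<zeta> n \<in> ?P" "\<And>n. 1/2 \<le> norm (deriv (f ^^ Suc n) (\<zeta> n))" by metis
  obtain z0 s where s: "z0 \<in> ?P" "strict_mono (s :: nat \<Rightarrow> nat)" "(\<zeta> \<circ> s) \<longlonglongrightarrow> z0"
    using cP \<zeta>(1) unfolding compact_def by metis
  obtain r M where r: "r > 0" "\<And>m x. x \<in> cball z0 r \<Longrightarrow> norm ((f ^^ m) x) \<le> M"
    using bounded_orbit_setE s(1) POm by blast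
  obtain g t where g: "g holomorphic_on ball z0 r" "strict_mono (t :: nat \<Rightarrow> nat)"
      "\<And>x. x \<in> ball z0 r \<Longrightarrow> (\<lambda>n. (f ^^ Suc (s (t n))) x) \<longlonglongrightarrow> g x"
      "\<And>K. compact K \<Longrightarrow> K \<subseteq> ball z0 r \<Longrightarrow> uniform_limit K ((\<lambda>n. f ^^ Suc (s n)) \<circ> t) g sequentially"
  proof (rule Montel[OF open_ball, of "range (\<lambda>n. f ^^ Suc (s n))" z0 r "\<lambda>n. f ^^ Suc (s n)"])
    show "\<exists>B. \<forall>h\<in>range (\<lambda>n. f ^^ Suc (s n)). \<forall>z\<in>K. norm (h z) \<le> B" if "compact K" "K \<subseteq> ball z0 r" for K
      using that r(2) ball_subset_cball by blast
  qed (use holm in blast)+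
  define N where "N j = Suc (s (t j))" for j
  have N: "N j < N (Suc j)" for j
    using g(2) s(2) by (simp add: N_def strict_mono_Suc_iff strict_mono_less)
  have ulg: "uniform_limit (cball z0 (r/2)) (\<lambda>j. f ^^ N j) g sequentially"
    using g(4)[OF compact_cball, of z0 "r/2"] r(1) by (simp add: o_def N_def cball_subset_ball_iff)
  \<comment> \<open>With a constant limit the iterates would differ from the constant by less than
    \<open>r / 16\<close> on discs of radius \<open>r / 4\<close>; Cauchy then bounds their
    derivatives by 1/4, against the lower bound 1/2 at the points \<open>\<zeta> n\<close>.\<close>
  have nc: "\<not> g constant_on ball z0 r"
  proof
    assume "g constant_on ball z0 r"
    then obtain c where c: "\<And>x. x \<in> ball z0 r \<Longrightarrow> g x = c" by (auto simp: constant_on_def)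
    have "\<forall>\<^sub>F j in sequentially. \<forall>x\<in>cball z0 (r/2). dist ((f ^^ N j) x) (g x) < r/16"
      by (rule ulg[unfolded uniform_limit_iff, rule_format]) (use r(1) in simp)
    moreover have "\<forall>\<^sub>F j in sequentially. dist ((\<zeta> \<circ> s \<circ> t) j) z0 < r/4"
      using LIMSEQ_subseq_LIMSEQ[OF s(3) g(2)] r(1) by (auto dest!: tendstoD[where e = "r/4"])
    ultimately obtain j where j: "\<forall>x\<in>cball z0 (r/2). dist ((f ^^ N j) x) (g x) < r/16"
        "dist ((\<zeta> \<circ> s \<circ> t) j) z0 < r/4"
      using eventually_happens'[OF sequentially_bot eventually_conj] by blast
    define w where "w = \<zeta> (s (t j))"
    have w: "dist w z0 < r/4" using j(2) by (simp add: w_def)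
    have "norm (deriv (\<lambda>x. (f ^^ N j) x - c) w) \<le> (r/16) / (r/4)"
    proof (rule norm_deriv_le_Cauchy[OF _ open_UNIV])
      show "(\<lambda>x. (f ^^ N j) x - c) holomorphic_on UNIV" by (intro holomorphic_intros holm)
      fix x assume "x \<in> cball w (r/4)"
      then have x: "x \<in> cball z0 (r/2)" using w dist_triangle[of z0 x w] by (simp add: dist_commute)
      then have "x \<in> ball z0 r" using r(1) by simp
      then show "norm ((f ^^ N j) x - c) \<le> r/16" using j(1) x c by (force simp: dist_norm)
    qed (use r in auto)
    moreover have "deriv (\<lambda>x. (f ^^ N j) x - c) w = deriv (f ^^ N j) w"
      using funpow_differentiable[OF hol] by (subst deriv_diff) auto
    ultimately have "norm (deriv (f ^^ N j) w) \<le> 1/4" using r(1) by simp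
    then show False using \<zeta>(2)[of "s (t j)"] by (simp add: N_def w_def)
  qed
  have z0b: "z0 \<in> ball z0 r" using r by simp
  define a where "a = g z0"
  have "(\<lambda>j. (f ^^ N j) z0) \<longlonglongrightarrow> a" using g(3)[OF z0b] by (simp add: a_def N_def)
  then have aP: "a \<in> ?P" using closed_sequentially[OF P(1), of "\<lambda>j. (f ^^ N j) z0" a] Pm[OF s(1)] by blast
  obtain R M1 where R: "R > 0" "\<And>m x. x \<in> cball a R \<Longrightarrow> norm ((f ^^ m) x) \<le> M1"
    using bounded_orbit_setE aP POm by blast
  \<comment> \<open>\<open>f ^^ N (Suc j)\<close> is \<open>f ^^ k j\<close> after
    \<open>f ^^ N j\<close>, and both long iterates tend to \<open>g\<close>; a limit
    \<open>h\<close> of the \<open>f ^^ k j\<close> therefore fixes values of \<open>g\<close>, and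
    these fill an open set because \<open>g\<close> is not constant.\<close>
  define k where "k j = N (Suc j) - N j" for j
  obtain h q where h: "h holomorphic_on ball a R" "strict_mono (q :: nat \<Rightarrow> nat)"
      "\<And>K. compact K \<Longrightarrow> K \<subseteq> ball a R \<Longrightarrow> uniform_limit K ((\<lambda>j. f ^^ (k j)) \<circ> q) h sequentially"
  proof (rule Montel[OF open_ball, of "range (\<lambda>j. f ^^ (k j))" a R "\<lambda>j. f ^^ (k j)"])
    show "\<exists>B. \<forall>h\<in>range (\<lambda>j. f ^^ (k j)). \<forall>z\<in>K. norm (h z) \<le> B" if "compact K" "K \<subseteq> ball a R" for K
      using that R(2) ball_subset_cball by blast
  qed (use holm in blast)+
  have ulh: "uniform_limit (cball a (R/2)) (\<lambda>j. f ^^ k (q j)) h sequentially"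
    using h(3)[OF compact_cball, of a "R/2"] R(1) by (simp add: o_def cball_subset_ball_iff)
  define W where "W = ball z0 r \<inter> g -` ball a (R/2)"
  have W: "open W" "z0 \<in> W" "W \<subseteq> ball z0 r"
    using continuous_open_preimage[OF holomorphic_on_imp_continuous_on[OF g(1)] open_ball open_ball] R(1) r(1)
    by (auto simp: W_def a_def)
  have hid: "h (g x) = g x" if x: "x \<in> W" for x
  proof (rule LIMSEQ_unique)
    have xb: "x \<in> ball z0 r" "g x \<in> ball a (R/2)" using x by (auto simp: W_def)
    have lim: "(\<lambda>j. (f ^^ N j) x) \<longlonglongrightarrow> g x" using g(3)[OF xb(1)] by (simp add: N_def)
    have lq: "(\<lambda>j. (f ^^ N (q j)) x) \<longlonglongrightarrow> g x"
      using LIMSEQ_subseq_LIMSEQ[OF lim h(2)] by (simp add: o_def)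
    have "(\<lambda>j. (f ^^ N (Suc (q j))) x) \<longlonglongrightarrow> g x"
      using LIMSEQ_subseq_LIMSEQ[OF LIMSEQ_Suc[OF lim] h(2)] by (simp add: o_def)
    moreover have "(f ^^ N (Suc (q j))) x = (f ^^ k (q j)) ((f ^^ N (q j)) x)" for j
    proof -
      have "N (Suc (q j)) = k (q j) + N (q j)" using N[of "q j"] by (simp add: k_def)
      then show ?thesis by (simp add: funpow_add)
    qed
    ultimately show "(\<lambda>j. (f ^^ k (q j)) ((f ^^ N (q j)) x)) \<longlonglongrightarrow> g x" by simp
    show "(\<lambda>j. (f ^^ k (q j)) ((f ^^ N (q j)) x)) \<longlonglongrightarrow> h (g x)"
    proof (rule tendstoI)
      fix e :: real assume e: "e > 0"
      have "isCont h (g x)"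
        using h(1) xb(2) R(1) by (intro continuous_on_interior[OF holomorphic_on_imp_continuous_on[OF h(1)]]) auto
      then have "(\<lambda>j. h ((f ^^ N (q j)) x)) \<longlonglongrightarrow> h (g x)" using lq by (rule isCont_tendsto_compose)
      then have "\<forall>\<^sub>F j in sequentially. dist (h ((f ^^ N (q j)) x)) (h (g x)) < e/2" using e by (intro tendstoD) auto
      moreover have "\<forall>\<^sub>F j in sequentially. (f ^^ N (q j)) x \<in> ball a (R/2)"
        using lq xb(2) by (rule topological_tendstoD[OF _ open_ball])
      moreover have "\<forall>\<^sub>F j in sequentially. \<forall>y\<in>cball a (R/2). dist ((f ^^ k (q j)) y) (h y) < e/2"
        using ulh e unfolding uniform_limit_iff by (meson half_gt_zero)
      ultimately show "\<forall>\<^sub>F j in sequentially. dist ((f ^^ k (q j)) ((f ^^ N (q j)) x)) (h (g x)) < e"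
      proof eventually_elim
        case (elim j)
        have "(f ^^ N (q j)) x \<in> cball a (R/2)" using elim(2) by simp
        then have "dist ((f ^^ k (q j)) ((f ^^ N (q j)) x)) (h ((f ^^ N (q j)) x)) < e/2" using elim(3) by blast
        then show ?case using elim(1) dist_triangle[of "(f ^^ k (q j)) ((f ^^ N (q j)) x)" "h (g x)" "h ((f ^^ N (q j)) x)"]
          by linarith
      qed
    qed
  qed
  have og: "open (g ` W)"
    by (rule open_mapping_thm[OF g(1) open_ball convex_connected[OF convex_ball] W(1,3) nc])
  have gW: "g ` W \<subseteq> ball a R" using R(1) by (auto simp: W_def)
  have hz: "h z = z" if "z \<in> ball a R" for z
    by (rule analytic_continuation_open[OF og open_ball _ convex_connected[OF convex_ball] gW h(1) _ _ that])
      (use W(2) hid in \<open>auto intro: holomorphic_intros\<close>)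
  have ul2: "uniform_limit (ball a (R/2)) (\<lambda>j. f ^^ k (q j)) h sequentially"
    using uniform_limit_on_subset[OF ulh ball_subset_cball] .
  have "uniform_limit (ball a (R/2)) (\<lambda>j. f ^^ k (q j)) (\<lambda>x. x) sequentially"
    by (rule uniform_limit_cong'[THEN iffD1, OF _ _ ul2]) (use hz R(1) in auto)
  moreover have "k j \<ge> 1" for j using N[of j] by (simp add: k_def)
  ultimately show False
    using no_recurrence[OF f cP P(2,3) POm aP, of "\<lambda>j. k (q j)" "R/2"] R(1) by auto
qed

definition all_attracted :: "(complex \<Rightarrow> complex) \<Rightarrow> bool" where
  "all_attracted f \<longleftrightarrow> (\<forall>s\<in>sing_vals f. \<exists>p a. attr_to f p s a)"

text \<open>Some iterate contracts uniformly near the postsingular set. By compactness the orbit of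
  \<open>s\<close> returns close to itself, and the contracting return map of a small disc has an
  attracting fixed point.\<close>

lemma hyperbolic_imp_all_attracted:
  assumes hyp: "nonescaping_hyperbolic f" shows "all_attracted f"
  unfolding all_attracted_def
proof
  fix s assume s: "s \<in> sing_vals f"
  have f: "f \<in> Hol_star" and bP: "bounded (postsing f)" using hyp by (auto simp: nonescaping_hyperbolic_def)
  let ?P = "postsing f"
  note P = postsing_facts[OF f]
  have hol: "f holomorphic_on UNIV" using f Hol_star_holomorphic by auto
  have cP: "compact ?P" using P(1) bP by (simp add: compact_eq_bounded_closed)
  have Pm: "(f ^^ m) y \<in> ?P" if "y \<in> ?P" for m y using that P(3) by (induction m) auto
  obtain N where N: "N \<ge> 1" "\<And>z. z \<in> ?P \<Longrightarrow> norm (deriv (f ^^ N) z) < 1/2" using hyperbolic_contracting[OF hyp] by blast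
  let ?V = "{z. norm (deriv (f ^^ N) z) < 1/2}"
  have "continuous_on UNIV (deriv (f ^^ N))"
    by (intro holomorphic_on_imp_continuous_on holomorphic_deriv holomorphic_on_funpow hol) simp
  then have "open ?V" by (intro open_Collect_less continuous_intros)
  then obtain \<delta> where \<delta>: "\<delta> > 0" "(\<Union>y\<in>?P. ball y \<delta>) \<subseteq> ?V"
    using compact_subset_open_imp_ball_epsilon_subset[OF cP, of ?V] N(2) by blast
  have contr: "dist ((f ^^ N) x) ((f ^^ N) x') \<le> 1/2 * dist x x'" if "y \<in> ?P" "x \<in> ball y \<delta>" "x' \<in> ball y \<delta>" for y x x'
    unfolding dist_norm
  proof (rule field_differentiable_bound[OF convex_ball[of y \<delta>] _ _ that(2,3)])
    fix z assume z: "z \<in> ball y \<delta>"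
    show "((f ^^ N) has_field_derivative deriv (f ^^ N) z) (at z within ball y \<delta>)"
      using funpow_differentiable[OF hol] by (simp add: field_differentiable_derivI has_field_derivative_at_within)
    show "norm (deriv (f ^^ N) z) \<le> 1/2" using z \<delta>(2) that(1) by (force simp: less_imp_le)
  qed
  have sP: "s \<in> ?P" using s P(2) by blast
  let ?x = "\<lambda>m. (f ^^ (N * m)) s"
  obtain l t where t: "strict_mono (t :: nat \<Rightarrow> nat)" "(?x \<circ> t) \<longlonglongrightarrow> l"
    using cP Pm[OF sP] unfolding compact_def by metis
  have "Cauchy (?x \<circ> t)" using t(2) by (rule LIMSEQ_imp_Cauchy)
  \<comment> \<open>The tolerance \<open>\<delta> / 4\<close> is made for the trap below: the centre
    moves by less than \<open>\<delta> / 4\<close>, and contraction by 1/2 turns the radius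
    \<open>\<delta> / 2\<close> into \<open>\<delta> / 4\<close>.\<close>
  then obtain K where K: "\<And>m n. m \<ge> K \<Longrightarrow> n \<ge> K \<Longrightarrow> dist ((?x \<circ> t) m) ((?x \<circ> t) n) < \<delta>/4"
    using \<delta>(1) unfolding Cauchy_def by (metis divide_pos_pos zero_less_numeral)
  define i j where "i = t K" and "j = t (Suc K)"
  have ij: "i < j" using t(1) by (simp add: i_def j_def strict_mono_def)
  have dij: "dist (?x j) (?x i) < \<delta>/4" using K[of "Suc K" K] by (simp add: i_def j_def)
  define y q where "y = ?x i" and "q = N * (j - i)"
  have yP: "y \<in> ?P" using Pm[OF sP] by (simp add: y_def)
  have qy: "(f ^^ q) y = ?x j"
  proof -
    have "q + N * i = N * j" using ij by (simp add: q_def diff_mult_distrib2)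
    then show ?thesis unfolding y_def by (metis comp_apply funpow_add)
  qed
  \<comment> \<open>The contraction can be iterated since the images of the disc stay in
    \<open>\<delta>\<close>-balls around the orbit of \<open>y\<close>, whose points all belong to
    the postsingular set.\<close>
  have lip: "dist ((f ^^ (N * m)) x) ((f ^^ (N * m)) x') \<le> (1/2) ^ m * dist x x'"
    if "x \<in> cball y (\<delta>/2)" "x' \<in> cball y (\<delta>/2)" for x x' m
    using that
  proof (induction m arbitrary: x x')
    case (Suc m)
    let ?g = "f ^^ (N * m)"
    have near: "?g w \<in> ball (?g y) \<delta>" if "w \<in> cball y (\<delta>/2)" for w
    proof -
      have "dist (?g w) (?g y) \<le> (1/2) ^ m * dist w y" using Suc.IH[OF that, of y] \<delta>(1) by simp
      also have "\<dots> \<le> 1 * dist w y" by (intro mult_right_mono) (auto simp: power_le_one)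
      also have "\<dots> < \<delta>" using that \<delta>(1) by (simp add: dist_commute)
      finally show ?thesis by (simp add: dist_commute)
    qed
    have "dist ((f ^^ (N * Suc m)) x) ((f ^^ (N * Suc m)) x') = dist ((f ^^ N) (?g x)) ((f ^^ N) (?g x'))"
      by (simp add: funpow_add)
    also have "\<dots> \<le> 1/2 * dist (?g x) (?g x')"
      by (rule contr[OF Pm[OF yP]]) (use near Suc.prems in auto)
    also have "\<dots> \<le> 1/2 * ((1/2) ^ m * dist x x')" using Suc.IH[OF Suc.prems] by simp
    finally show ?case by simp
  qed simp
  have lipq: "dist ((f ^^ q) x) ((f ^^ q) x') \<le> 1/2 * dist x x'" if "x \<in> cball y (\<delta>/2)" "x' \<in> cball y (\<delta>/2)" for x x'
  proof -
    have "(1/2::real) ^ (j - i) \<le> (1/2) ^ 1" using ij by (intro power_decreasing) auto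
    then have "(1/2) ^ (j - i) * dist x x' \<le> 1/2 * dist x x'" by (intro mult_right_mono) auto
    then show ?thesis using lip[OF that, of "j - i"] by (simp add: q_def)
  qed
  have "trap f q y (\<delta>/2) (1/2)"
    unfolding trap_def
  proof (intro conjI ballI)
    fix x assume x: "x \<in> cball y (\<delta>/2)"
    have "dist y ((f ^^ q) x) \<le> dist y ((f ^^ q) y) + dist ((f ^^ q) y) ((f ^^ q) x)" by (rule dist_triangle)
    also have "\<dots> < \<delta>/4 + \<delta>/4"
      using dij lipq[of y x] x \<delta>(1) unfolding qy by (intro add_less_le_mono) (auto simp: y_def dist_commute)
    finally show "(f ^^ q) x \<in> ball y (\<delta>/2)" by simp
  qed (use \<delta>(1) lipq in auto)
  then obtain b where "\<And>x. x \<in> cball y (\<delta>/2) \<Longrightarrow> attr_to f q x b" using trap_attr_to[OF hol] by metis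
  then have "attr_to f q ((f ^^ (N * i)) s) b" using \<delta>(1) by (simp add: y_def)
  then show "\<exists>p a. attr_to f p s a" using attr_to_preimage[OF hol] by blast
qed

section \<open>From attraction back to hyperbolicity\<close>

lemma attr_to_bounded_orbit:
  assumes hol: "f holomorphic_on UNIV" and at: "attr_to f p s a"
  shows "s \<in> bounded_orbit_set f"
proof -
  obtain M where "\<forall>\<^sub>F x in nhds s. (\<exists>b\<in>ball a 1. attr_to f p x b) \<and> (\<forall>m. norm ((f ^^ m) x) \<le> M)"
    using attr_to_stable[OF hol at luc_tendsto_const[of f "nhds s"] _ filterlim_ident[of "nhds s"], of 1] hol by auto
  then obtain d where "d > 0" "\<And>x. dist x s < d \<Longrightarrow> \<forall>m. norm ((f ^^ m) x) \<le> M"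
    unfolding eventually_nhds_metric by blast
  then show ?thesis unfolding bounded_orbit_set_def
    by (intro CollectI exI[of _ "d/2"] conjI exI[of _ M]) (auto simp: dist_commute)
qed

lemma bounded_orbit_set_image:
  assumes f: "f \<in> Hol_star" and z: "z \<in> bounded_orbit_set f" shows "(f ^^ i) z \<in> bounded_orbit_set f"
proof (induction i)
  case (Suc i)
  let ?w = "(f ^^ i) z"
  obtain r M where r: "r > 0" "\<And>m x. x \<in> cball ?w r \<Longrightarrow> norm ((f ^^ m) x) \<le> M" using bounded_orbit_setE[OF Suc] by blast
  have "open (f ` ball ?w r)" using Hol_star_open_image[OF f] by blast
  moreover have "f ?w \<in> f ` ball ?w r" using r by auto
  ultimately obtain e where e: "e > 0" "cball (f ?w) e \<subseteq> f ` ball ?w r" by (metis open_contains_cball)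
  have "norm ((f ^^ m) x) \<le> M" if xe: "x \<in> cball (f ?w) e" for m x
  proof -
    obtain v where v: "v \<in> ball ?w r" "x = f v" using e(2) xe by blast
    then have "(f ^^ m) x = (f ^^ Suc m) v" by (simp add: funpow_swap1)
    then show ?thesis using r(2)[of v "Suc m"] v by simp
  qed
  then have "(f ^^ Suc i) z \<in> {z. \<exists>r>0. \<exists>M. \<forall>m. \<forall>x\<in>cball z r. norm ((f ^^ m) x) \<le> M}"
    using e(1) by (intro CollectI exI[of _ e] conjI exI[of _ M]) auto
  then show ?case by (simp only: bounded_orbit_set_def)
qed (use z in simp)

lemma bounded_orbit_set_subset_Fatou:
  assumes hol: "f holomorphic_on UNIV" shows "bounded_orbit_set f \<subseteq> Fatou f"
proof
  fix z assume "z \<in> bounded_orbit_set f"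
  then obtain r M where r: "r > 0" "\<And>m x. x \<in> cball z r \<Longrightarrow> norm ((f ^^ m) x) \<le> M" using bounded_orbit_setE by blast
  have "normal_family (ball z r) (range (\<lambda>n. f ^^ n))"
    unfolding normal_family_def
  proof (intro allI impI)
    fix \<sigma> :: "nat \<Rightarrow> complex \<Rightarrow> complex" assume rng: "range \<sigma> \<subseteq> range (\<lambda>n. f ^^ n)"
    obtain g t where "g holomorphic_on ball z r" "strict_mono (t :: nat \<Rightarrow> nat)"
      "\<And>K. compact K \<Longrightarrow> K \<subseteq> ball z r \<Longrightarrow> uniform_limit K (\<sigma> \<circ> t) g sequentially"
    proof (rule Montel[OF open_ball _ _ rng])
      show "\<exists>B. \<forall>h\<in>range (\<lambda>n. f ^^ n). \<forall>z\<in>K. norm (h z) \<le> B" if "compact K" "K \<subseteq> ball z r" for K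
        using that r(2) ball_subset_cball by blast
      show "h holomorphic_on ball z r" if "h \<in> range (\<lambda>n. f ^^ n)" for h
        using that holomorphic_on_funpow[OF hol] holomorphic_on_subset by blast
    qed blast
    then show "\<exists>r'. strict_mono r' \<and> ((\<exists>g. g holomorphic_on ball z r \<and>
        (\<forall>K. compact K \<and> K \<subseteq> ball z r \<longrightarrow> uniform_limit K (\<sigma> \<circ> r') g sequentially)) \<or>
        (\<forall>K B. compact K \<and> K \<subseteq> ball z r \<longrightarrow> (\<forall>\<^sub>F n in sequentially. \<forall>z\<in>K. B < norm (\<sigma> (r' n) z))))"
      by blast
  qed
  then show "z \<in> Fatou f" using r(1) unfolding Fatou_def by (intro CollectI exI[of _ "ball z r"]) auto
qed

text \<open>By compactness finitely many traps receive all singular values in bounded time. The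
  postsingular set then lies in a compact set of points with locally bounded orbits, made of
  finitely many images of the singular set and of the traps.\<close>

lemma all_attracted_imp_hyperbolic:
  assumes f: "f \<in> Hol_star_b" and att: "all_attracted f" shows "nonescaping_hyperbolic f"
proof -
  have fs: "f \<in> Hol_star" and bS: "bounded (sing_vals f)" using f by (auto simp: Hol_star_b_def)
  let ?S = "sing_vals f"
  have hol: "f holomorphic_on UNIV" using fs Hol_star_holomorphic by auto
  have cfp: "continuous_on X (f ^^ m)" for X m
    using continuous_on_funpow[OF Hol_star_continuous[OF fs]] continuous_on_subset by blast
  have cS: "compact ?S" using sing_vals_covering(1)[OF fs] bS by (simp add: compact_eq_bounded_closed)
  have "\<exists>U p a r c N. open U \<and> s \<in> U \<and> p > 0 \<and> trap f p a r c \<and> (\<forall>x\<in>U. (f ^^ (p * N)) x \<in> cball a r)" if "s \<in> ?S" for s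
  proof -
    obtain p a where at: "attr_to f p s a" using att \<open>s \<in> ?S\<close> by (auto simp: all_attracted_def)
    then have at': "(f ^^ p) a = a" "norm (deriv (f ^^ p) a) < 1" "(\<lambda>m. (f ^^ (p * m)) s) \<longlonglongrightarrow> a" "p > 0"
      using attr_to_pos by (auto simp: attr_to_def)
    obtain r c where rc: "0 < r" "\<forall>\<^sub>F i in (sequentially :: nat filter). trap f p a r c"
      using eventually_trap[OF hol at'(1,2) luc_tendsto_const[of f sequentially] always_eventually[OF allI[OF hol]] zero_less_one]
      by blast
    have t: "trap f p a r c" using rc(2) by simp
    obtain N where N: "(f ^^ (p * N)) s \<in> ball a r"
      using topological_tendstoD[OF at'(3) open_ball, of a r] rc(1) by (auto simp: eventually_sequentially)
    have "open ((f ^^ (p * N)) -` ball a r)" using cfp[of UNIV] by (simp add: open_vimage)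
    then show ?thesis using N t at'(4) 
      by (intro exI[of _ "(f ^^ (p * N)) -` ball a r"] exI[of _ p] exI[of _ a] exI[of _ r] exI[of _ c] exI[of _ N] conjI)
        (auto simp: less_imp_le)
  qed
  then obtain U p a r c N where U: "\<And>s. s \<in> ?S \<Longrightarrow> open (U s) \<and> s \<in> U s \<and> p s > 0 \<and> trap f (p s) (a s) (r s) (c s) \<and>
      (\<forall>x\<in>U s. (f ^^ (p s * N s)) x \<in> cball (a s) (r s))" by metis
  obtain T where T: "T \<subseteq> ?S" "finite T" "?S \<subseteq> (\<Union>s\<in>T. U s)"
    using compactE_image[OF cS, of ?S U] U by blast
  \<comment> \<open>\<open>M\<close> is at least \<open>p s * N s + p s\<close> for each
    \<open>s\<close> in the finite set, so from time \<open>M\<close> on every singular orbit has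
    entered a trap and run through one more period.\<close>
  define M where "M = (\<Sum>s\<in>T. p s * N s + p s)"
  define X where "X = (\<Union>m<M. (f ^^ m) ` ?S) \<union> (\<Union>s\<in>T. \<Union>i<p s. (f ^^ i) ` ((f ^^ p s) ` cball (a s) (r s)))"
  have cX: "compact X"
    unfolding X_def using T(2) cS cfp
    by (intro compact_Un compact_UN finite_lessThan compact_continuous_image compact_cball) auto
  have inX: "(f ^^ m) x \<in> X" if x: "x \<in> ?S" for m x
  proof (cases "m < M")
    case True then show ?thesis using x by (auto simp: X_def)
  next
    case False
    obtain s where s: "s \<in> T" "x \<in> U s" using T(3) x by blast
    have ts: "trap f (p s) (a s) (r s) (c s)" "(f ^^ (p s * N s)) x \<in> cball (a s) (r s)" "p s > 0" using U s T(1) by blast+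
    have "p s * N s + p s \<le> M" unfolding M_def by (rule member_le_sum[OF s(1) _ T(2)]) simp
    then have le: "p s * N s + p s \<le> m" using False by simp
    define d i q where "d = m - (p s * N s + p s)" and "i = d mod p s" and "q = d div p s"
    have "m = i + (p s + (p s * q + p s * N s))"
      using le mod_mult_div_eq[of d "p s"] by (simp add: i_def q_def d_def)
    then have "(f ^^ m) x = (f ^^ i) ((f ^^ p s) ((f ^^ (p s * q)) ((f ^^ (p s * N s)) x)))" by (simp add: funpow_add)
    moreover have "(f ^^ (p s * q)) ((f ^^ (p s * N s)) x) \<in> cball (a s) (r s)" by (rule trap_invariant[OF ts(1,2)])
    moreover have "i < p s" using ts(3) by (simp add: i_def)
    ultimately show ?thesis using s(1) unfolding X_def by blast
  qed
  have PX: "postsing f \<subseteq> X"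
    unfolding postsing_def using inX compact_imp_closed[OF cX] by (intro closure_minimal) auto
  have XO: "X \<subseteq> bounded_orbit_set f"
  proof
    fix y assume "y \<in> X"
    then consider m x where "x \<in> ?S" "y = (f ^^ m) x"
      | s i z where "s \<in> T" "z \<in> cball (a s) (r s)" "y = (f ^^ i) ((f ^^ p s) z)"
      unfolding X_def by blast
    then show "y \<in> bounded_orbit_set f"
    proof cases
      case 1
      then show ?thesis using att attr_to_bounded_orbit[OF hol] bounded_orbit_set_image[OF fs] by (auto simp: all_attracted_def)
    next
      case 2
      then have "trap f (p s) (a s) (r s) (c s)" using U T(1) by blast
      then obtain b where "attr_to f (p s) z b" using trap_attr_to[OF hol] 2(2) by metis
      then have "z \<in> bounded_orbit_set f" by (rule attr_to_bounded_orbit[OF hol])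
      then have "(f ^^ (i + p s)) z \<in> bounded_orbit_set f" by (rule bounded_orbit_set_image[OF fs])
      then show ?thesis using 2(3) by (simp add: funpow_add)
    qed
  qed
  show ?thesis unfolding nonescaping_hyperbolic_def
    using fs PX XO bounded_orbit_set_subset_Fatou[OF hol] bounded_subset[OF compact_imp_bounded[OF cX]] by blast
qed

section \<open>Attracting cycles attract infinite singular orbits\<close>

text \<open>The disc without the horizontal ray that starts at the centre and points to the right
  (\<open>\<sigma> = 1\<close>) or to the left (\<open>\<sigma> = -1\<close>). Both are simply
  connected, and together they cover the punctured disc.\<close>

definition slit_disc :: "complex \<Rightarrow> real \<Rightarrow> real \<Rightarrow> complex set" where
  "slit_disc a r \<sigma> = {z \<in> ball a r. Im z \<noteq> Im a \<or> \<sigma> * (Re z - Re a) < 0}"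

lemma open_slit_disc: "open (slit_disc a r \<sigma>)"
proof -
  have "slit_disc a r \<sigma> = ball a r \<inter> ({z. Im z \<noteq> Im a} \<union> {z. \<sigma> * (Re z - Re a) < 0})"
    by (auto simp: slit_disc_def)
  moreover have "open {z. Im z \<noteq> Im a}" by (intro open_Collect_neq continuous_intros)
  moreover have "open {z. \<sigma> * (Re z - Re a) < 0}" by (intro open_Collect_less continuous_intros)
  ultimately show ?thesis by (simp add: open_Int open_Un)
qed

lemma starlike_slit_disc:
  assumes r: "r > 0" and \<sigma>: "\<bar>\<sigma>\<bar> = 1"
  shows "starlike (slit_disc a r \<sigma>)"
proof -
  have ss: "\<sigma> * \<sigma> = 1" using \<sigma> by (metis abs_mult_self_eq mult_1)
  define c where "c = a - of_real (\<sigma> * r / 2)"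
  have nc: "norm (of_real (\<sigma> * r / 2) :: complex) = r / 2"
    unfolding norm_of_real using r \<sigma> by (simp add: abs_mult)
  have cb: "c \<in> ball a r" using nc r by (simp add: c_def dist_norm del: of_real_divide of_real_mult)
  have Imc: "Im c = Im a" by (simp add: c_def)
  have "\<sigma> * (Re c - Re a) = - (\<sigma> * \<sigma>) * r / 2" by (simp add: c_def)
  then have cn: "\<sigma> * (Re c - Re a) < 0" unfolding ss using r by simp
  have cS: "c \<in> slit_disc a r \<sigma>" using cb cn by (simp add: slit_disc_def)
  have "w \<in> slit_disc a r \<sigma>" if z: "z \<in> slit_disc a r \<sigma>" and w: "w \<in> closed_segment c z" for z w
  proof -
    obtain t where t: "0 \<le> t" "t \<le> 1" "w = (1 - t) *\<^sub>R c + t *\<^sub>R z" using w by (auto simp: in_segment)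
    have zb: "z \<in> ball a r" using z by (simp add: slit_disc_def)
    have "w \<in> ball a r" using w convex_contains_segment[of "ball a r"] convex_ball[of a r] cb zb by blast
    moreover have "Im w \<noteq> Im a \<or> \<sigma> * (Re w - Re a) < 0"
    proof (cases "Im w = Im a")
      case True
      have iw: "Im w = (1 - t) * Im c + t * Im z" and rw: "Re w = (1 - t) * Re c + t * Re z" using t(3) by simp_all
      have imw: "Im w - Im a = t * (Im z - Im a)" unfolding iw Imc by (simp add: algebra_simps)
      have rew: "\<sigma> * (Re w - Re a) = (1 - t) * (\<sigma> * (Re c - Re a)) + t * (\<sigma> * (Re z - Re a))"
        unfolding rw by (simp add: algebra_simps)
      show ?thesis
      proof (cases "t = 0")
        case True
        have "\<sigma> * (Re w - Re a) = \<sigma> * (Re c - Re a)" unfolding rew True by simp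
        then show ?thesis using cn by linarith
      next
        case False
        then have "Im z = Im a" using imw True by simp
        then have neg: "\<sigma> * (Re z - Re a) < 0" using z by (simp add: slit_disc_def)
        have "(1 - t) * (\<sigma> * (Re c - Re a)) \<le> 0" using cn t by (intro mult_nonneg_nonpos[of "1 - t"]) linarith+
        moreover have "t * (\<sigma> * (Re z - Re a)) < 0" using neg t False by (intro mult_pos_neg[of t]) linarith+
        ultimately show ?thesis using rew by linarith
      qed
    qed simp
    ultimately show ?thesis by (simp add: slit_disc_def)
  qed
  then show ?thesis unfolding starlike_def using cS by blast
qed

text \<open>The puncture at the fixed point \<open>a\<close> is harmless: near \<open>a\<close> the inverse branch is the local
  inverse, which has no monodromy.\<close>

lemma inverse_branch_fixed_point:
  assumes f: "f \<in> Hol_star" and P: "sing_vals f \<subseteq> P" "f ` P \<subseteq> P" and r: "r > 0"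
    and BP: "ball a r \<inter> P \<subseteq> {a}" and a: "(f ^^ k) a = a" and d: "deriv (f ^^ k) a \<noteq> 0"
  obtains G where "G holomorphic_on ball a r" "G a = a" "\<And>z. z \<in> ball a r \<Longrightarrow> (f ^^ k) (G z) = z"
proof -
  let ?F = "f ^^ k"
  have holF: "?F holomorphic_on UNIV" by (rule holomorphic_on_funpow[OF Hol_star_holomorphic[OF f]])
  obtain r1 where r1: "r1 > 0" "inj_on ?F (ball a r1)"
    using has_complex_derivative_locally_injective[OF holF UNIV_I open_UNIV d] by blast
  have holFb: "?F holomorphic_on ball a r1" using holF holomorphic_on_subset by blast
  obtain l where l: "l holomorphic_on ?F ` ball a r1" "\<And>z. z \<in> ball a r1 \<Longrightarrow> l (?F z) = z"
    using holomorphic_has_inverse[OF holFb open_ball r1(2)] by metis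
  have "open (?F ` ball a r1)" using open_mapping_thm3[OF holFb open_ball r1(2)] .
  moreover have "a \<in> ?F ` ball a r1" using a r1(1) by (metis centre_in_ball image_eqI)
  ultimately obtain e where e: "e > 0" "ball a e \<subseteq> ?F ` ball a r1" using open_contains_ball by metis
  define \<beta> where "\<beta> = min e r"
  have \<beta>: "\<beta> > 0" "ball a \<beta> \<subseteq> ?F ` ball a r1" "ball a \<beta> \<subseteq> ball a r"
    using e r subset_ball[of \<beta> e a] by (auto simp: \<beta>_def)
  have holl: "l holomorphic_on ball a \<beta>" using l(1) \<beta>(2) holomorphic_on_subset by blast
  have la: "l a = a" using l(2)[of a] r1(1) a by simp
  have lin: "l w \<in> ball a r1 \<and> ?F (l w) = w" if w: "w \<in> ball a \<beta>" for w
  proof -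
    obtain z where "z \<in> ball a r1" "w = ?F z" using \<beta>(2) w by blast
    then show ?thesis using l(2) by simp
  qed
  \<comment> \<open>On a slit disc the branch exists by lifting. It is normalized at a point
    \<open>u\<close> near \<open>a\<close> to agree with the local inverse \<open>l\<close>, and
    hence agrees with \<open>l\<close> on the whole small slit disc.\<close>
  have ex: "\<exists>G. G holomorphic_on slit_disc a r \<sigma> \<and> (\<forall>z\<in>slit_disc a r \<sigma>. ?F (G z) = z) \<and>
      (\<forall>z\<in>slit_disc a \<beta> \<sigma>. G z = l z)" if \<sigma>: "\<bar>\<sigma>\<bar> = 1" for \<sigma>
  proof -
    let ?S = "slit_disc a r \<sigma>" and ?T = "slit_disc a \<beta> \<sigma>"
    have TS: "?T \<subseteq> ?S" "?T \<subseteq> ball a \<beta>" using \<beta>(3) by (auto simp: slit_disc_def)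
    have "?T \<noteq> {}" using starlike_slit_disc[OF \<beta>(1) \<sigma>, of a] by (auto simp: starlike_def)
    then obtain u where u: "u \<in> ?T" by blast
    have uS: "u \<in> ?S" using u TS by blast
    have Fu: "?F (l u) = u" using lin u TS by blast
    have SP: "?S \<inter> P = {}" using BP by (auto simp: slit_disc_def)
    obtain G where G: "G holomorphic_on ?S" "G u = l u" "\<And>z. z \<in> ?S \<Longrightarrow> ?F (G z) = z"
      using inverse_branch[OF f P starlike_imp_simply_connected[OF starlike_slit_disc[OF r \<sigma>]] open_slit_disc uS SP Fu]
      by metis
    have cG: "continuous_on ?T G" using G(1) TS holomorphic_on_imp_continuous_on continuous_on_subset by blast
    define N where "N = ?T \<inter> G -` ball a r1"
    have oN: "open N" unfolding N_def by (rule continuous_open_preimage[OF cG open_slit_disc open_ball])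
    have uN: "u \<in> N" using u G(2) lin TS by (auto simp: N_def)
    have NT: "N \<subseteq> ?T" by (auto simp: N_def)
    have eqN: "G z = l z" if z: "z \<in> N" for z
    proof (rule inj_onD[OF r1(2)])
      have "z \<in> ball a \<beta>" "z \<in> ?S" using z NT TS by blast+
      then show "?F (G z) = ?F (l z)" "l z \<in> ball a r1" using lin G(3) by simp_all
      show "G z \<in> ball a r1" using z by (simp add: N_def)
    qed
    have "G z = l z" if "z \<in> ?T" for z
      by (rule analytic_continuation_open[OF oN open_slit_disc _ starlike_imp_connected[OF starlike_slit_disc[OF \<beta>(1) \<sigma>]] NT _ _ _ that])
        (use uN eqN G(1) holl TS holomorphic_on_subset in blast)+
    then show ?thesis using G by blast
  qed
  obtain G1 where G1: "G1 holomorphic_on slit_disc a r 1" "\<And>z. z \<in> slit_disc a r 1 \<Longrightarrow> ?F (G1 z) = z"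
     "\<And>z. z \<in> slit_disc a \<beta> 1 \<Longrightarrow> G1 z = l z" using ex[of 1] by auto
  obtain G2 where G2: "G2 holomorphic_on slit_disc a r (-1)" "\<And>z. z \<in> slit_disc a r (-1) \<Longrightarrow> ?F (G2 z) = z"
     "\<And>z. z \<in> slit_disc a \<beta> (-1) \<Longrightarrow> G2 z = l z" using ex[of "-1"] by auto
  \<comment> \<open>On the upper and on the lower half disc the two branches coincide, since both
    extend \<open>l\<close>. The sign \<open>\<tau>\<close> lets the two halves be treated
    together.\<close>
  have half: "G1 z = G2 z" if z: "z \<in> ball a r" "Im z \<noteq> Im a" for z
  proof -
    define \<tau> where "\<tau> = sgn (Im z - Im a)"
    have \<tau>: "\<bar>\<tau>\<bar> = 1" "\<tau> * \<tau> = 1" using z(2) by (auto simp: \<tau>_def sgn_if)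
    define H where "H q = ball a q \<inter> {w. 0 < \<tau> * (Im w - Im a)}" for q
    have oH: "open (H q)" for q unfolding H_def by (intro open_Int open_ball open_Collect_less continuous_intros)
    have "{w. 0 < \<tau> * (Im w - Im a)} = {w. (\<i> * of_real \<tau>) \<bullet> w > \<tau> * Im a}" by (auto simp: inner_complex_def algebra_simps)
    then have cH: "connected (H q)" for q
      unfolding H_def by (intro convex_connected convex_Int convex_ball) (simp add: convex_halfspace_gt)
    have zH: "z \<in> H r" using z by (auto simp: H_def \<tau>_def sgn_if)
    have "a + \<i> * of_real (\<tau> * \<beta> / 2) \<in> H \<beta>"
    proof -
      have "norm (\<i> * of_real (\<tau> * \<beta> / 2) :: complex) = \<beta> / 2" using \<beta>(1) \<tau>(1) by (simp add: norm_mult abs_mult)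
      moreover have "\<tau> * (\<tau> * \<beta> / 2) > 0" using \<beta>(1) \<tau>(2) by (simp add: mult.assoc[symmetric])
      ultimately show ?thesis using \<beta>(1) by (simp add: H_def dist_norm)
    qed
    then have ne: "H \<beta> \<noteq> {}" by blast
    have Hs: "H q \<subseteq> slit_disc a q \<sigma>" for q \<sigma> by (auto simp: H_def slit_disc_def)
    have HH: "H \<beta> \<subseteq> H r" using \<beta>(3) by (auto simp: H_def)
    show ?thesis
      by (rule analytic_continuation_open[OF oH oH ne cH HH _ _ _ zH])
        (use G1 G2 Hs holomorphic_on_subset in \<open>metis subsetD\<close>)+
  qed
  define G where "G z = (if z \<in> ball a \<beta> then l z else if z \<in> slit_disc a r 1 then G1 z else G2 z)" for z
  have e1: "G z = G1 z" if "z \<in> slit_disc a r 1" for z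
  proof (cases "z \<in> ball a \<beta>")
    case True
    then have "z \<in> slit_disc a \<beta> 1" using that by (auto simp: slit_disc_def)
    then show ?thesis using True G1(3) by (simp add: G_def)
  qed (use that in \<open>simp add: G_def\<close>)
  have e2: "G z = G2 z" if "z \<in> slit_disc a r (-1)" for z
  proof (cases "z \<in> ball a \<beta>")
    case True
    then have "z \<in> slit_disc a \<beta> (-1)" using that by (auto simp: slit_disc_def)
    then show ?thesis using True G2(3) by (simp add: G_def)
  next
    case False
    show ?thesis
    proof (cases "z \<in> slit_disc a r 1")
      case True
      then have "Im z \<noteq> Im a" "z \<in> ball a r" using that by (auto simp: slit_disc_def)
      then show ?thesis using half e1[OF True] by simp
    qed (use False in \<open>simp add: G_def\<close>)
  qed
  have cover: "z \<in> ball a \<beta> \<or> z \<in> slit_disc a r 1 \<or> z \<in> slit_disc a r (-1)" if "z \<in> ball a r" for z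
  proof (cases "z = a")
    case False
    then have "Im z \<noteq> Im a \<or> Re z \<noteq> Re a" by (auto simp: complex_eq_iff)
    then show ?thesis using that by (auto simp: slit_disc_def)
  qed (use \<beta>(1) in simp)
  show ?thesis
  proof (rule that)
    have "G holomorphic_on slit_disc a r 1" using G1(1) e1 by (metis holomorphic_transform)
    moreover have "G holomorphic_on slit_disc a r (-1)" using G2(1) e2 by (metis holomorphic_transform)
    moreover have "G holomorphic_on ball a \<beta>" using holl by (rule holomorphic_transform) (simp add: G_def)
    ultimately have "G holomorphic_on (ball a \<beta> \<union> (slit_disc a r 1 \<union> slit_disc a r (-1)))"
      by (intro holomorphic_on_Un open_Un open_slit_disc open_ball)
    then show "G holomorphic_on ball a r" by (rule holomorphic_on_subset) (use cover in blast)
    show "G a = a" using la \<beta>(1) by (simp add: G_def)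
    fix z assume "z \<in> ball a r"
    from cover[OF this] show "?F (G z) = z"
    proof (elim disjE)
      assume "z \<in> ball a \<beta>" then show ?thesis using lin by (simp add: G_def)
    qed (use e1 e2 G1(2) G2(2) in auto)
  qed
qed

section \<open>Infinite singular orbits in attracting basins\<close>

lemma funpow_eventually_periodic:
  fixes f :: "'a \<Rightarrow> 'a"
  assumes "(f ^^ i) s = (f ^^ (i + d)) s" "n \<ge> i"
  shows "(f ^^ (n + d * k)) s = (f ^^ n) s"
proof (induction k)
  case (Suc k)
  define m where "m = n + d * k - i"
  have m: "n + d * k = m + i" "n + d * Suc k = m + (i + d)" using assms(2) by (auto simp: m_def)
  have "(f ^^ (n + d * Suc k)) s = (f ^^ m) ((f ^^ (i + d)) s)" unfolding m(2) by (subst funpow_add) simp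
  also have "\<dots> = (f ^^ (n + d * k)) s" unfolding assms(1)[symmetric] m(1) by (subst funpow_add) simp
  finally show ?case using Suc by simp
qed simp

text \<open>If no singular orbit meets the disc except at \<open>a\<close>, the inverse branches of
  all iterates that fix \<open>a\<close> live on the whole disc, with derivatives at
  \<open>a\<close> growing like powers of the inverse multiplier. Their images exhaust the plane up
  to one point and \<open>f\<close> is injective on them, which is impossible. The nonzero
  multiplier serves twice: for the inverse branches, and to keep the attracted orbit from landing on
  \<open>a\<close>.\<close>

lemma attracting_point_attracts_singular:
  assumes f: "f \<in> Hol_star" and a: "(f ^^ p) a = a" and mu: "deriv (f ^^ p) a \<noteq> 0" "norm (deriv (f ^^ p) a) < 1"
  shows "\<exists>s\<in>sing_vals f. \<exists>l. (\<lambda>m. (f ^^ (l + p * m)) s) \<longlonglongrightarrow> a \<and> (\<forall>i j. (f ^^ i) s = (f ^^ j) s \<longrightarrow> i = j)"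
proof -
  let ?g = "f ^^ p"
  have hol: "f holomorphic_on UNIV" by (rule Hol_star_holomorphic[OF f])
  have holg: "?g holomorphic_on UNIV" by (rule holomorphic_on_funpow[OF hol])
  obtain r1 where r1: "r1 > 0" "inj_on ?g (ball a r1)"
    using has_complex_derivative_locally_injective[OF holg UNIV_I open_UNIV mu(1)] by blast
  obtain r c where rc: "0 < r" "r < r1" "\<forall>\<^sub>F i in (sequentially::nat filter). trap f p a r c"
    using eventually_trap[OF hol a mu(2) luc_tendsto_const[of f sequentially] always_eventually[OF allI[OF hol]] r1(1)]
    by blast
  then have t: "trap f p a r c" by simp
  have inj: "inj_on ?g (cball a r)" using r1(2) by (rule inj_on_subset) (use rc in auto)
  have aB: "a \<in> cball a r" using rc by simp
  have conv: "(\<lambda>m. (f ^^ (p * m)) x) \<longlonglongrightarrow> a" if x: "x \<in> cball a r" for x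
  proof -
    obtain b where b: "\<And>x. x \<in> cball a r \<Longrightarrow> attr_to f p x b" using trap_attr_to[OF hol t] by metis
    have "(\<lambda>m. (f ^^ (p * m)) a) \<longlonglongrightarrow> b" using b[OF aB] by (simp add: attr_to_def)
    then have "b = a" using funpow_fixed[OF a] by (simp add: LIMSEQ_const_iff)
    then show ?thesis using b[OF x] by (simp add: attr_to_def)
  qed
  define P where "P = (\<Union>m. (f ^^ m) ` sing_vals f)"
  show ?thesis
  proof (cases "ball a r \<inter> P \<subseteq> {a}")
    case False
    then obtain s l where s: "s \<in> sing_vals f" "(f ^^ l) s \<in> ball a r" "(f ^^ l) s \<noteq> a"
      unfolding P_def by blast
    let ?y = "(f ^^ l) s"
    have y: "?y \<in> cball a r" using s(2) by simp
    \<comment> \<open>\<open>f ^^ p\<close> is injective on the disc and fixes \<open>a\<close>, so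
      an orbit that enters the disc elsewhere never reaches \<open>a\<close> in steps of
      \<open>p\<close>. Converging to \<open>a\<close> in this way, it cannot be eventually
      periodic.\<close>
    have ne: "(f ^^ (p * m)) ?y \<noteq> a" for m
    proof (induction m)
      case (Suc m)
      have "(f ^^ (p * Suc m)) ?y = ?g ((f ^^ (p * m)) ?y)" by (simp add: funpow_add)
      then show ?case using inj_onD[OF inj _ trap_invariant[OF t y, of m] aB] a Suc by metis
    qed (use s in simp)
    have eq: "(f ^^ (l + p * m)) s = (f ^^ (p * m)) ?y" for m by (metis add.commute comp_apply funpow_add)
    have lim: "(\<lambda>m. (f ^^ (l + p * m)) s) \<longlonglongrightarrow> a" using conv[OF y] by (simp only: eq)
    have noper: False if "(f ^^ i) s = (f ^^ (i + d)) s" "d > 0" for i d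
    proof -
      have p: "p > 0"
      proof (rule ccontr)
        assume "\<not> p > 0" then show False using mu(2) by (simp add: id_def)
      qed
      define n where "n = l + p * i"
      have "n \<ge> i" using p by (cases p) (auto simp: n_def)
      have "(f ^^ (l + p * (i + d * k))) s = (f ^^ n) s" for k
      proof -
        have "l + p * (i + d * k) = n + d * (p * k)" by (simp add: n_def algebra_simps)
        then show ?thesis using funpow_eventually_periodic[OF that(1) \<open>n \<ge> i\<close>, of "p * k"] by simp
      qed
      moreover have "(\<lambda>k. (f ^^ (l + p * (i + d * k))) s) \<longlonglongrightarrow> a"
        using LIMSEQ_subseq_LIMSEQ[OF lim, of "\<lambda>k. i + d * k"] that(2) by (simp add: strict_mono_def o_def)
      ultimately have "(f ^^ n) s = a" by (simp add: LIMSEQ_const_iff)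
      then show False using ne[of i] eq[of i] by (simp add: n_def)
    qed
    have "i = j" if "(f ^^ i) s = (f ^^ j) s" for i j
    proof (rule ccontr)
      assume "i \<noteq> j"
      then consider "i < j" | "j < i" by linarith
      then show False
      proof cases
        case 1 then show False using noper[of i "j - i"] that by simp
      next
        case 2 then show False using noper[of j "i - j"] that by simp
      qed
    qed
    then show ?thesis using s(1) lim by blast
  next
    case True
    have P: "sing_vals f \<subseteq> P" "f ` P \<subseteq> P"
    proof -
      have "(f ^^ 0) ` sing_vals f \<subseteq> P" unfolding P_def by blast
      then show "sing_vals f \<subseteq> P" by simp
      have "f ((f ^^ m) s) \<in> P" if "s \<in> sing_vals f" for m s
        unfolding P_def using that by (intro UN_I[of "Suc m"]) auto
      then show "f ` P \<subseteq> P" by (auto simp: P_def)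
    qed
    have "\<exists>G. G holomorphic_on ball a r \<and> G a = a \<and> (\<forall>z\<in>ball a r. (f ^^ (p * m)) (G z) = z)" for m
    proof -
      have "deriv (f ^^ (p * m)) a \<noteq> 0" using deriv_funpow_fixed[OF hol a] mu(1) by simp
      then show ?thesis using inverse_branch_fixed_point[OF f P rc(1) True funpow_fixed[OF a, of m]] by metis
    qed
    then obtain G where G: "\<And>m. G m holomorphic_on ball a r" "\<And>m. G m a = a"
       "\<And>m z. z \<in> ball a r \<Longrightarrow> (f ^^ (p * m)) (G m z) = z" by metis
    have aB': "a \<in> ball a r" using rc by simp
    have dG: "norm (deriv (G m) a) * norm (deriv ?g a) ^ m = 1" for m
    proof -
      have "deriv ((f ^^ (p * m)) \<circ> G m) a = deriv (f ^^ (p * m)) (G m a) * deriv (G m) a"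
        using funpow_differentiable[OF hol] holomorphic_on_imp_differentiable_at[OF G(1) open_ball aB']
        by (intro deriv_chain)
      moreover have "deriv ((f ^^ (p * m)) \<circ> G m) a = deriv (\<lambda>z. z) a"
      proof (rule deriv_cong_ev)
        show "\<forall>\<^sub>F x in nhds a. ((f ^^ (p * m)) \<circ> G m) x = x"
          using eventually_nhds_in_open[OF open_ball aB'] by eventually_elim (use G(3) in auto)
      qed simp
      ultimately have "deriv ?g a ^ m * deriv (G m) a = 1" using deriv_funpow_fixed[OF hol a] G(2) by simp
      then show ?thesis by (metis mult.commute norm_mult norm_one norm_power)
    qed
    define W where "W = (\<Union>m. G m ` ball a r)"
    \<comment> \<open>Two points outside \<open>W\<close> would be omitted by all
      \<open>G m\<close>, making the derivatives at \<open>a\<close> bounded; but by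
      \<open>dG\<close> they tend to infinity.\<close>
    have omit: "x = y" if xy: "x \<notin> W" "y \<notin> W" for x y
    proof (rule ccontr)
      assume "x \<noteq> y"
      let ?M = "Max {norm a, norm x, norm y}"
      have "\<exists>C. \<forall>m\<in>UNIV. \<forall>z\<in>cball a (r/2). norm (G m z) \<le> C"
      proof (rule normal_omit_two[OF open_ball convex_connected[OF convex_ball] aB' compact_cball,
            where I = UNIV and h = G and a = "\<lambda>_ _. x" and b = "\<lambda>_ _. y" and M = ?M and e = "norm (y - x)"])
        fix m z assume "z \<in> ball a r"
        then have "G m z \<in> W" unfolding W_def by blast
        then show "x \<noteq> y \<and> G m z \<noteq> x \<and> G m z \<noteq> y" using xy \<open>x \<noteq> y\<close> by blast
      qed (use G \<open>x \<noteq> y\<close> rc in auto)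
      then obtain C where C: "\<And>m z. z \<in> cball a (r/2) \<Longrightarrow> norm (G m z) \<le> C" by blast
      have dC: "norm (deriv (G m) a) \<le> C / (r/2)" for m
        by (rule norm_deriv_le_Cauchy[OF G(1) open_ball]) (use rc C in auto)
      define D where "D = max 1 (C / (r/2))"
      have D: "D > 0" "\<And>m. norm (deriv (G m) a) \<le> D" using dC by (auto simp: D_def intro: order_trans max.coboundedI2)
      have "(\<lambda>m. norm (deriv ?g a) ^ m) \<longlonglongrightarrow> 0" using mu(2) by (intro LIMSEQ_realpow_zero) auto
      then obtain m where m: "norm (deriv ?g a) ^ m < 1 / D"
        using D(1) order_tendstoD(2)[of _ 0 sequentially "1 / D"] by (fastforce simp: eventually_sequentially)
      have "1 \<le> D * norm (deriv ?g a) ^ m"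
        using dG[of m] mult_right_mono[OF D(2)[of m], of "norm (deriv ?g a) ^ m"] by simp
      moreover have "D * norm (deriv ?g a) ^ m < 1" using m D(1) by (simp add: field_simps)
      ultimately show False by linarith
    qed
    \<comment> \<open>Both sides are mapped by \<open>f ^^ (p * Suc m)\<close> to
      \<open>?g b\<close>, and this iterate is injective near \<open>a\<close>; agreement near
      \<open>a\<close> extends over the disc. It makes the images of the \<open>G m\<close> increase
      with \<open>m\<close>.\<close>
    have nest: "G (Suc m) (?g b) = G m b" if b: "b \<in> ball a r" for m b
    proof -
      have gB: "?g z \<in> ball a r" if "z \<in> ball a r" for z using t that unfolding trap_def by auto
      let ?F = "f ^^ (p * Suc m)"
      have holF: "?F holomorphic_on UNIV" by (rule holomorphic_on_funpow[OF hol])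
      have dF: "deriv ?F a \<noteq> 0" unfolding deriv_funpow_fixed[OF hol a] using mu(1) by simp
      obtain r2 where r2: "r2 > 0" "inj_on ?F (ball a r2)"
        using has_complex_derivative_locally_injective[OF holF UNIV_I open_UNIV dF] by blast
      have h1: "(\<lambda>z. G (Suc m) (?g z)) holomorphic_on ball a r"
        using holomorphic_on_compose_gen[OF _ G(1)[of "Suc m"], of ?g "ball a r"] gB holg holomorphic_on_subset
        by (fastforce simp: o_def)
      define N where "N = (ball a r \<inter> (\<lambda>z. G (Suc m) (?g z)) -` ball a r2) \<inter> (ball a r \<inter> G m -` ball a r2)"
      have oN: "open N" unfolding N_def
        using h1 G(1)[of m] by (intro open_Int continuous_open_preimage holomorphic_on_imp_continuous_on open_ball)
      have aN: "a \<in> N" using rc r2 G(2) a by (auto simp: N_def)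
      have NB: "N \<subseteq> ball a r" by (auto simp: N_def)
      have eqN: "G (Suc m) (?g z) = G m z" if z: "z \<in> N" for z
      proof (rule inj_onD[OF r2(2)])
        have zB: "z \<in> ball a r" using z NB by blast
        have "?F (G m z) = ?g ((f ^^ (p * m)) (G m z))" by (simp add: funpow_add)
        also have "\<dots> = ?g z" using G(3)[OF zB] by simp
        finally show "?F (G (Suc m) (?g z)) = ?F (G m z)" using G(3)[OF gB[OF zB], of "Suc m"] by simp
      qed (use z in \<open>auto simp: N_def\<close>)
      show ?thesis
        by (rule analytic_continuation_open[OF oN open_ball _ convex_connected[OF convex_ball] NB h1 G(1) eqN b]) (use aN in auto)
    qed
    have sub: "G m ` ball a r \<subseteq> G (m + i) ` ball a r" for m i
    proof (induction i)
      case (Suc i)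
      have st: "G (m + i) b \<in> G (m + Suc i) ` ball a r" if "b \<in> ball a r" for b
      proof -
        have "?g b \<in> ball a r" using t that unfolding trap_def by auto
        then show ?thesis using nest[OF that, of "m + i"] by (metis add_Suc_right image_eqI)
      qed
      have "G (m + i) ` ball a r \<subseteq> G (m + Suc i) ` ball a r" by (rule image_subsetI) (rule st)
      with Suc show ?case by (rule order_trans)
    qed simp
    have injW: "u = v" if uv: "u \<in> W" "v \<in> W" "f u = f v" for u v
    proof -
      obtain m n where mn: "u \<in> G m ` ball a r" "v \<in> G n ` ball a r" using uv(1,2) unfolding W_def by blast
      define M where "M = Suc (m + n)"
      have "u \<in> G M ` ball a r" "v \<in> G M ` ball a r"
        using mn sub[of m "Suc n"] sub[of n "Suc m"] by (auto simp: M_def add.commute)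
      then obtain b1 b2 where b: "b1 \<in> ball a r" "b2 \<in> ball a r" "u = G M b1" "v = G M b2" by blast
      have p: "p > 0"
      proof (rule ccontr)
        assume "\<not> p > 0" then show False using mu(2) by (simp add: id_def)
      qed
      then obtain q where q: "p * M = Suc q" by (metis M_def Suc_pred nat_0_less_mult_iff zero_less_Suc)
      have "(f ^^ (p * M)) u = (f ^^ (p * M)) v" unfolding q using uv(3) by (simp add: funpow_swap1)
      then show ?thesis using b G(3) by simp
    qed
    \<comment> \<open>One exceptional point \<open>x0\<close> outside \<open>W\<close> does no harm:
      a value taken twice would persist on an open set of values, while injectivity on
      \<open>W\<close> leaves only the value \<open>f x0\<close>.\<close>
    have "inj f"
    proof (rule injI, rule ccontr)
      fix x1 x2 assume x: "f x1 = f x2" "x1 \<noteq> x2"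
      obtain x0 where x0: "\<And>x. x \<notin> W \<Longrightarrow> x = x0" using omit by metis
      define e where "e = dist x1 x2 / 2"
      have e: "e > 0" using x(2) by (simp add: e_def)
      have disj: "ball x1 e \<inter> ball x2 e = {}"
      proof -
        have False if "z \<in> ball x1 e" "z \<in> ball x2 e" for z
          using that dist_triangle[of x1 x2 z] by (simp add: e_def dist_commute)
        then show ?thesis by blast
      qed
      define V where "V = f ` ball x1 e \<inter> f ` ball x2 e"
      have oV: "open V" unfolding V_def by (intro open_Int Hol_star_open_image[OF f] open_ball)
      have "f x1 \<in> f ` ball x1 e" "f x1 \<in> f ` ball x2 e" using x(1) e centre_in_ball image_eqI by metis+
      then have "f x1 \<in> V" by (simp add: V_def)
      have "V \<subseteq> {f x0}"
      proof
        fix v assume "v \<in> V"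
        then obtain u1 u2 where u: "u1 \<in> ball x1 e" "u2 \<in> ball x2 e" "v = f u1" "v = f u2" by (auto simp: V_def)
        then have "u1 \<noteq> u2" using disj by blast
        then have "u1 \<notin> W \<or> u2 \<notin> W" using injW u by metis
        then show "v \<in> {f x0}" using x0 u by blast
      qed
      from subset_singletonD[OF this] have "V = {f x0}" using \<open>f x1 \<in> V\<close> by auto
      then show False using oV not_open_singleton by metis
    qed
    then show ?thesis using Hol_star_not_inj[OF f] by blast
  qed
qed

section \<open>Holomorphic families\<close>

text \<open>Holomorphy in each variable separately, joined with continuity in the parameter for the
  locally uniform topology. The last clause is what controls derivatives in \<open>z\<close> along
  moving points.\<close>

definition hol_family :: "complex set \<Rightarrow> (complex \<Rightarrow> complex \<Rightarrow> complex) \<Rightarrow> bool" where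
  "hol_family D F \<longleftrightarrow> open D \<and> (\<forall>t\<in>D. F t holomorphic_on UNIV) \<and> (\<forall>z. (\<lambda>t. F t z) holomorphic_on D) \<and>
     (\<forall>t\<in>D. luc_tendsto F (F t) (nhds t))"

lemma hol_family_eventually_holomorphic:
  assumes "hol_family D F" "t \<in> D" "filterlim u (nhds t) \<Phi>"
  shows "\<forall>\<^sub>F i in \<Phi>. F (u i) holomorphic_on UNIV"
proof -
  have "\<forall>\<^sub>F x in nhds t. F x holomorphic_on UNIV"
    using eventually_nhds_in_open[of D t] assms(1,2) unfolding hol_family_def by (auto elim: eventually_mono)
  then show ?thesis using assms(3) unfolding filterlim_iff by blast
qed

lemma hol_family_deriv_tendsto:
  assumes F: "hol_family D F" "t0 \<in> D" and u: "filterlim u (nhds t0) \<Phi>" and z: "(z \<longlongrightarrow> z0) \<Phi>"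
  shows "((\<lambda>i. deriv (F (u i)) (z i)) \<longlongrightarrow> deriv (F t0) z0) \<Phi>"
proof (rule luc_tendsto_eval[OF _ _ z])
  have h: "F t0 holomorphic_on UNIV" using F by (simp add: hol_family_def)
  have "luc_tendsto F (F t0) (nhds t0)" using F by (simp add: hol_family_def)
  then show "luc_tendsto (\<lambda>i. deriv (F (u i))) (deriv (F t0)) \<Phi>"
    using luc_tendsto_filterlim[OF _ u] hol_family_eventually_holomorphic[OF F u] h
    by (intro luc_tendsto_deriv) auto
  show "continuous_on UNIV (deriv (F t0))"
    by (intro holomorphic_on_imp_continuous_on holomorphic_deriv h) simp
qed

lemma hol_family_deriv_near:
  assumes F: "hol_family D F" "t0 \<in> D" and e: "e > 0"
  obtains d where "d > 0" "\<And>t z. dist t t0 < d \<Longrightarrow> dist z z0 < d \<Longrightarrow> t \<in> D \<and> norm (deriv (F t) z - deriv (F t0) z0) < e"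
proof -
  have "((\<lambda>x. deriv (F (fst x)) (snd x)) \<longlongrightarrow> deriv (F t0) z0) (nhds t0 \<times>\<^sub>F nhds z0)"
    by (rule hol_family_deriv_tendsto[OF F filterlim_fst filterlim_snd])
  then have "\<forall>\<^sub>F x in nhds t0 \<times>\<^sub>F nhds z0. dist (deriv (F (fst x)) (snd x)) (deriv (F t0) z0) < e"
    using e by (rule tendstoD)
  then obtain P Q where PQ: "eventually P (nhds t0)" "eventually Q (nhds z0)"
      "\<And>t z. P t \<Longrightarrow> Q z \<Longrightarrow> dist (deriv (F t) z) (deriv (F t0) z0) < e"
    unfolding eventually_prod_filter by auto
  have "\<forall>\<^sub>F t in nhds t0. t \<in> D" using F by (intro eventually_nhds_in_open) (auto simp: hol_family_def)
  with PQ(1) have "\<forall>\<^sub>F t in nhds t0. P t \<and> t \<in> D" by (rule eventually_conj)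
  then obtain d1 where d1: "d1 > 0" "\<And>t. dist t t0 < d1 \<Longrightarrow> P t \<and> t \<in> D" unfolding eventually_nhds_metric by blast
  obtain d2 where d2: "d2 > 0" "\<And>z. dist z z0 < d2 \<Longrightarrow> Q z" using PQ(2) unfolding eventually_nhds_metric by blast
  show ?thesis by (rule that[of "min d1 d2"]) (use d1 d2 PQ(3) in \<open>auto simp: dist_norm\<close>)
qed

lemma linear_approx_bound:
  fixes g :: "complex \<Rightarrow> complex"
  assumes "convex S" "x \<in> S" "y \<in> S" "g holomorphic_on UNIV" "\<And>z. z \<in> S \<Longrightarrow> norm (deriv g z - c) \<le> e"
  shows "norm ((g x - g y) - c * (x - y)) \<le> e * norm (x - y)"
proof -
  have "norm ((g x - c * x) - (g y - c * y)) \<le> e * norm (x - y)"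
  proof (rule field_differentiable_bound[OF assms(1) _ _ assms(2,3)])
    fix z assume "z \<in> S"
    have "(g has_field_derivative deriv g z) (at z)"
      using assms(4) by (intro holomorphic_derivI[of g UNIV]) auto
    then have "((\<lambda>z. g z - c * z) has_field_derivative (deriv g z - c)) (at z)"
      by (auto intro!: derivative_eq_intros)
    then show "((\<lambda>z. g z - c * z) has_field_derivative (deriv g z - c)) (at z within S)"
      by (rule has_field_derivative_at_within)
    show "norm (deriv g z - c) \<le> e" by (rule assms(5)[OF \<open>z \<in> S\<close>])
  qed
  moreover have "(g x - c * x) - (g y - c * y) = (g x - g y) - c * (x - y)" by (simp add: algebra_simps)
  ultimately show ?thesis by simp
qed

text \<open>The chain rule in two variables: the increment splits into a change of the point, with
  quotient \<open>Q\<close>, and a change of the parameter at the fixed point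
  \<open>z0\<close>.\<close>

lemma hol_family_compose:
  assumes F: "hol_family D F" and \<phi>: "\<phi> holomorphic_on D"
  shows "(\<lambda>t. F t (\<phi> t)) holomorphic_on D"
proof -
  have oD: "open D" using F by (simp add: hol_family_def)
  have "\<exists>f'. ((\<lambda>t. F t (\<phi> t)) has_field_derivative f') (at t0)" if t0: "t0 \<in> D" for t0
  proof -
    define z0 where "z0 = \<phi> t0"
    define c where "c = deriv (F t0) z0"
    have d\<phi>: "(\<phi> has_field_derivative deriv \<phi> t0) (at t0)" by (rule holomorphic_derivI[OF \<phi> oD t0])
    have "(\<lambda>t. F t z0) holomorphic_on D" using F by (simp add: hol_family_def)
    then have dF: "((\<lambda>t. F t z0) has_field_derivative deriv (\<lambda>t. F t z0) t0) (at t0)"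
      by (rule holomorphic_derivI[OF _ oD t0])
    have c\<phi>: "(\<phi> \<longlongrightarrow> z0) (at t0)" using d\<phi> DERIV_isCont unfolding isCont_def z0_def by blast
    \<comment> \<open>Where \<open>\<phi> t\<close> returns to \<open>z0\<close> the quotient is
      undefined; the value \<open>c\<close> there lets \<open>Q\<close> tend to \<open>c\<close> at
      \<open>t0\<close>, and the product with \<open>\<phi> t - z0\<close> vanishes anyway.\<close>
    define Q where "Q t = (if \<phi> t = z0 then c else (F t (\<phi> t) - F t z0) / (\<phi> t - z0))" for t
    have Q: "(Q \<longlongrightarrow> c) (at t0)"
    proof (rule tendstoI)
      fix e :: real assume e: "e > 0"
      obtain d where d: "d > 0" "\<And>t z. dist t t0 < d \<Longrightarrow> dist z z0 < d \<Longrightarrow> t \<in> D \<and> norm (deriv (F t) z - c) < e/2"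
        using hol_family_deriv_near[OF F t0, of "e/2" z0] e unfolding c_def by (metis half_gt_zero)
      have "\<forall>\<^sub>F t in at t0. dist t t0 < d" using d(1) by (metis eventually_at)
      moreover have "\<forall>\<^sub>F t in at t0. dist (\<phi> t) z0 < d" using tendstoD[OF c\<phi> d(1)] .
      ultimately show "\<forall>\<^sub>F t in at t0. dist (Q t) c < e"
      proof eventually_elim
        case (elim t)
        show ?case
        proof (cases "\<phi> t = z0")
          case False
          have "t \<in> D" using d(2)[OF elim(1), of z0] d(1) by simp
          then have hF: "F t holomorphic_on UNIV" using F by (simp add: hol_family_def)
          have "norm ((F t (\<phi> t) - F t z0) - c * (\<phi> t - z0)) \<le> (e/2) * norm (\<phi> t - z0)"
            by (rule linear_approx_bound[OF convex_ball[of z0 d] _ _ hF])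
              (use d elim in \<open>auto simp: dist_commute less_imp_le\<close>)
          moreover have "Q t - c = ((F t (\<phi> t) - F t z0) - c * (\<phi> t - z0)) / (\<phi> t - z0)"
            using False by (simp add: Q_def field_simps)
          ultimately have "norm (Q t - c) \<le> e/2" using False by (simp add: norm_divide divide_le_eq)
          then show ?thesis using e by (simp add: dist_norm)
        qed (use e in \<open>simp add: Q_def\<close>)
      qed
    qed
    have "((\<lambda>t. Q t * ((\<phi> t - \<phi> t0) / (t - t0)) + (F t z0 - F t0 z0) / (t - t0)) \<longlongrightarrow>
        c * deriv \<phi> t0 + deriv (\<lambda>t. F t z0) t0) (at t0)"
      using d\<phi> dF by (intro tendsto_intros Q) (simp_all add: has_field_derivative_iff)
    moreover have "Q t * ((\<phi> t - \<phi> t0) / (t - t0)) + (F t z0 - F t0 z0) / (t - t0) =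
        (F t (\<phi> t) - F t0 (\<phi> t0)) / (t - t0)" for t
    proof -
      have "Q t * (\<phi> t - \<phi> t0) = F t (\<phi> t) - F t z0" by (simp add: Q_def z0_def)
      then show ?thesis by (simp add: z0_def times_divide_eq_right add_divide_distrib[symmetric])
    qed
    ultimately show ?thesis by (auto simp: has_field_derivative_iff)
  qed
  then show ?thesis using oD by (simp add: holomorphic_on_open)
qed

lemma hol_family_funpow:
  assumes F: "hol_family D F" shows "hol_family D (\<lambda>t. F t ^^ k)"
proof -
  have "(\<lambda>t. (F t ^^ k) z) holomorphic_on D" for z
  proof (induction k)
    case (Suc k)
    then show ?case using hol_family_compose[OF F] by simp
  qed (simp add: holomorphic_on_const)
  moreover have "luc_tendsto (\<lambda>t. F t ^^ k) (F t ^^ k) (nhds t)" if "t \<in> D" for t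
    using F that by (intro luc_tendsto_funpow) (auto simp: hol_family_def holomorphic_on_imp_continuous_on)
  ultimately show ?thesis using F holomorphic_on_funpow unfolding hol_family_def by blast
qed

text \<open>This makes multipliers of moving cycles holomorphic in the parameter. The derivative is
  a locally uniform limit of difference quotients with steps \<open>1 / (n + 1)\<close>, each
  holomorphic in \<open>t\<close>; uniform continuity on a compact cylinder gives the
  uniformity.\<close>

lemma hol_family_deriv_compose:
  assumes F: "hol_family D F" and \<psi>: "\<psi> holomorphic_on D"
  shows "(\<lambda>t. deriv (F t) (\<psi> t)) holomorphic_on D"
proof -
  have oD: "open D" using F by (simp add: hol_family_def)
  define h :: "nat \<Rightarrow> complex" where "h n = of_real (inverse (real (Suc n)))" for n
  have h: "h n \<noteq> 0" "norm (h n) = inverse (real (Suc n))" for n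
    by (simp_all only: h_def norm_of_real of_real_eq_0_iff) simp_all
  define q where "q n t = (F t (\<psi> t + h n) - F t (\<psi> t)) / h n" for n t
  show ?thesis
  proof (rule holomorphic_uniform_sequence[OF oD])
    show "q n holomorphic_on D" for n
      unfolding q_def using h by (intro holomorphic_intros hol_family_compose[OF F] \<psi>) auto
    fix x assume x: "x \<in> D"
    obtain d where d: "d > 0" "cball x d \<subseteq> D" using oD x open_contains_cball by metis
    have "compact (\<psi> ` cball x d)"
      using holomorphic_on_imp_continuous_on[OF \<psi>] d(2) by (intro compact_continuous_image) (auto intro: continuous_on_subset)
    then obtain R where R: "\<And>t. t \<in> cball x d \<Longrightarrow> norm (\<psi> t) \<le> R"
      using compact_imp_bounded by (force simp: bounded_iff)
    define X where "X = cball x d \<times> cball (0::complex) (R + 1)"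
    have "continuous_on X (\<lambda>y. deriv (F (fst y)) (snd y))"
      unfolding continuous_on_def
    proof
      fix y assume "y \<in> X"
      then have "fst y \<in> D" using d(2) by (auto simp: X_def)
      moreover have "filterlim fst (nhds (fst y)) (at y within X)" "(snd \<longlongrightarrow> snd y) (at y within X)"
        by (intro tendsto_fst tendsto_snd tendsto_ident_at)+
      ultimately show "((\<lambda>y. deriv (F (fst y)) (snd y)) \<longlongrightarrow> deriv (F (fst y)) (snd y)) (at y within X)"
        by (intro hol_family_deriv_tendsto[OF F])
    qed
    moreover have "compact X" unfolding X_def by (intro compact_Times compact_cball)
    ultimately have uc: "uniformly_continuous_on X (\<lambda>y. deriv (F (fst y)) (snd y))"
      by (rule compact_uniformly_continuous)
    have "uniform_limit (cball x d) q (\<lambda>t. deriv (F t) (\<psi> t)) sequentially"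
      unfolding uniform_limit_iff
    proof (intro allI impI)
      fix e :: real assume e: "e > 0"
      obtain \<delta> where \<delta>: "\<delta> > 0" "\<And>y y'. y \<in> X \<Longrightarrow> y' \<in> X \<Longrightarrow> dist y' y < \<delta> \<Longrightarrow>
          dist (deriv (F (fst y')) (snd y')) (deriv (F (fst y)) (snd y)) < e/2"
        using uc half_gt_zero[OF e] unfolding uniformly_continuous_on_def by blast
      have "(\<lambda>n. inverse (real (Suc n))) \<longlonglongrightarrow> 0" by (rule LIMSEQ_inverse_real_of_nat)
      then have "\<forall>\<^sub>F n in sequentially. inverse (real (Suc n)) < min \<delta> 1"
        using \<delta>(1) by (intro order_tendstoD(2)) auto
      then show "\<forall>\<^sub>F n in sequentially. \<forall>t\<in>cball x d. dist (q n t) (deriv (F t) (\<psi> t)) < e"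
      proof eventually_elim
        case (elim n)
        show ?case
        proof
          fix t assume t: "t \<in> cball x d"
          then have hF: "F t holomorphic_on UNIV" using F d(2) by (auto simp: hol_family_def)
          have n: "norm (h n) < \<delta>" "norm (h n) < 1" using elim h(2) by auto
          have "norm ((F t (\<psi> t + h n) - F t (\<psi> t)) - deriv (F t) (\<psi> t) * ((\<psi> t + h n) - \<psi> t)) \<le> (e/2) * norm ((\<psi> t + h n) - \<psi> t)"
          proof (rule linear_approx_bound[OF convex_cball[of "\<psi> t" "norm (h n)"] _ _ hF])
            fix z assume z: "z \<in> cball (\<psi> t) (norm (h n))"
            have "norm z \<le> R + 1" using z R[OF t] n(2) norm_triangle_sub[of z "\<psi> t"] by (simp add: dist_norm norm_minus_commute)
            then have "dist (deriv (F (fst (t, z))) (snd (t, z))) (deriv (F (fst (t, \<psi> t))) (snd (t, \<psi> t))) < e/2"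
              using t R[OF t] z n(1) by (intro \<delta>(2)) (auto simp: X_def dist_Pair_Pair dist_commute)
            then show "norm (deriv (F t) z - deriv (F t) (\<psi> t)) \<le> e/2" by (simp add: dist_norm)
          qed (auto simp: dist_norm)
          moreover have eq: "q n t - deriv (F t) (\<psi> t) =
              ((F t (\<psi> t + h n) - F t (\<psi> t)) - deriv (F t) (\<psi> t) * ((\<psi> t + h n) - \<psi> t)) / h n"
            using h(1)[of n] by (simp add: q_def diff_divide_distrib)
          ultimately have "norm (q n t - deriv (F t) (\<psi> t)) \<le> e/2"
            unfolding eq norm_divide using h(1)[of n] by (simp add: divide_le_eq)
          then show "dist (q n t) (deriv (F t) (\<psi> t)) < e" using e by (simp add: dist_norm)
        qed
      qed
    qed
    then show "\<exists>d>0. cball x d \<subseteq> D \<and> uniform_limit (cball x d) q (\<lambda>t. deriv (F t) (\<psi> t)) sequentially" using d by blast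
  qed
qed

text \<open>Locally uniform convergence is expressed as convergence along \<open>sequentially \<times>\<^sub>F nhds t\<close>.\<close>

lemma uniform_limit_imp_tendsto_prod:
  fixes \<phi> :: "nat \<Rightarrow> complex \<Rightarrow> complex"
  assumes D: "open D" "t \<in> D" and v: "continuous_on D v"
    and u: "\<And>K. compact K \<Longrightarrow> K \<subseteq> D \<Longrightarrow> uniform_limit K \<phi> v sequentially"
  shows "((\<lambda>x. \<phi> (fst x) (snd x)) \<longlongrightarrow> v t) (sequentially \<times>\<^sub>F nhds t)"
proof (rule tendstoI)
  fix e :: real assume e: "e > 0"
  obtain d where d: "d > 0" "cball t d \<subseteq> D" using D open_contains_cball by metis
  have "\<forall>\<^sub>F n in sequentially. \<forall>x\<in>cball t d. dist (\<phi> n x) (v x) < e/2"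
    using u[OF compact_cball d(2)] half_gt_zero[OF e] unfolding uniform_limit_iff by blast
  moreover have "\<forall>\<^sub>F x in nhds t. x \<in> cball t d \<and> dist (v x) (v t) < e/2"
  proof -
    have "isCont v t" using v D by (simp add: continuous_on_eq_continuous_at)
    then have "(v \<longlongrightarrow> v t) (nhds t)" unfolding isCont_def by (rule tendsto_at_iff_tendsto_nhds[THEN iffD1])
    then have "\<forall>\<^sub>F x in nhds t. dist (v x) (v t) < e/2" using half_gt_zero[OF e] by (rule tendstoD)
    moreover have "\<forall>\<^sub>F x in nhds t. x \<in> ball t d" using d(1) by (intro eventually_nhds_in_open) auto
    ultimately show ?thesis by eventually_elim auto
  qed
  ultimately show "\<forall>\<^sub>F x in sequentially \<times>\<^sub>F nhds t. dist (\<phi> (fst x) (snd x)) (v t) < e"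
    unfolding eventually_prod_filter
  proof (intro exI conjI allI impI)
    fix n x assume "\<forall>x\<in>cball t d. dist (\<phi> n x) (v x) < e/2" "x \<in> cball t d \<and> dist (v x) (v t) < e/2"
    then show "dist (\<phi> (fst (n, x)) (snd (n, x))) (v t) < e"
      using dist_triangle[of "\<phi> n x" "v t" "v x"] by force
  qed
qed

lemma eventually_prod_nhds_seq:
  assumes "\<forall>\<^sub>F x in sequentially \<times>\<^sub>F nhds t. P (fst x) (snd x)"
  obtains U where "open U" "t \<in> U" "\<forall>\<^sub>F n in sequentially. \<forall>x\<in>U. P n x"
proof -
  obtain A B where AB: "eventually A sequentially" "eventually B (nhds t)" "\<And>n x. A n \<Longrightarrow> B x \<Longrightarrow> P n x"
    using assms unfolding eventually_prod_filter by auto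
  obtain U where U: "open U" "t \<in> U" "\<forall>x\<in>U. B x" using AB(2) unfolding eventually_nhds by blast
  have "\<forall>\<^sub>F n in sequentially. \<forall>x\<in>U. P n x" using AB(1) by eventually_elim (use U AB(3) in blast)
  then show ?thesis using U that by blast
qed

text \<open>The local bounds \<open>M\<close> are replaced by their maximum over a finite subcover,
  which monotonicity in \<open>M\<close> permits. Properties without a bound are treated as constant
  in \<open>M\<close>.\<close>

lemma eventually_on_compact:
  fixes K :: "'a::topological_space set"
  assumes K: "compact K" and loc: "\<And>t. t \<in> K \<Longrightarrow> \<exists>U. open U \<and> t \<in> U \<and> (\<exists>M::real. \<forall>\<^sub>F n in sequentially. \<forall>x\<in>U. Q n x M)"
    and mono: "\<And>n x M M'. Q n x M \<Longrightarrow> M \<le> M' \<Longrightarrow> Q n x M'"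
  shows "\<exists>M. \<forall>\<^sub>F n in sequentially. \<forall>x\<in>K. Q n x M"
proof -
  have "\<forall>t\<in>K. \<exists>U. open U \<and> t \<in> U \<and> (\<exists>M. \<forall>\<^sub>F n in sequentially. \<forall>x\<in>U. Q n x M)" using loc by blast
  from bchoice[OF this] obtain U
    where U: "\<forall>t\<in>K. open (U t) \<and> t \<in> U t \<and> (\<exists>M. \<forall>\<^sub>F n in sequentially. \<forall>x\<in>U t. Q n x M)" by blast
  then have "\<forall>t\<in>K. \<exists>M. \<forall>\<^sub>F n in sequentially. \<forall>x\<in>U t. Q n x M" by blast
  from bchoice[OF this] obtain M where M: "\<forall>t\<in>K. \<forall>\<^sub>F n in sequentially. \<forall>x\<in>U t. Q n x (M t)" by blast
  have UM: "open (U t) \<and> t \<in> U t \<and> (\<forall>\<^sub>F n in sequentially. \<forall>x\<in>U t. Q n x (M t))" if "t \<in> K" for t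
    using U M that by blast
  obtain T where T: "T \<subseteq> K" "finite T" "K \<subseteq> (\<Union>t\<in>T. U t)"
    using compactE_image[OF K, of K U] UM by blast
  have "\<forall>\<^sub>F n in sequentially. \<forall>t\<in>T. \<forall>x\<in>U t. Q n x (M t)"
    using T UM by (intro eventually_ball_finite) auto
  then have "\<forall>\<^sub>F n in sequentially. \<forall>x\<in>K. Q n x (Max (M ` T))"
  proof eventually_elim
    case (elim n)
    show ?case
    proof
      fix x assume "x \<in> K"
      then obtain t where t: "t \<in> T" "x \<in> U t" using T(3) by blast
      then have "Q n x (M t)" using elim by blast
      moreover have "M t \<le> Max (M ` T)" using T(2) t(1) by simp
      ultimately show "Q n x (Max (M ` T))" by (rule mono)
    qed
  qed
  then show ?thesis by blast
qed

lemma tendsto_prod_imp_uniform_limit: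
  fixes \<phi> :: "nat \<Rightarrow> complex \<Rightarrow> complex"
  assumes K: "compact K" and D: "open D" "K \<subseteq> D" and v: "continuous_on D v"
    and lim: "\<And>t. t \<in> K \<Longrightarrow> ((\<lambda>x. \<phi> (fst x) (snd x)) \<longlongrightarrow> v t) (sequentially \<times>\<^sub>F nhds t)"
  shows "uniform_limit K \<phi> v sequentially"
  unfolding uniform_limit_iff
proof (intro allI impI)
  fix e :: real assume e: "e > 0"
  have "\<exists>M::real. \<forall>\<^sub>F n in sequentially. \<forall>x\<in>K. dist (\<phi> n x) (v x) < e"
  proof (rule eventually_on_compact[OF K])
    fix t assume t: "t \<in> K"
    have tD: "t \<in> D" using t D by blast
    have "isCont v t" using v D tD by (simp add: continuous_on_eq_continuous_at)
    then have "(v \<longlongrightarrow> v t) (nhds t)" unfolding isCont_def by (rule tendsto_at_iff_tendsto_nhds[THEN iffD1])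
    then have vlim: "((\<lambda>x. v (snd x)) \<longlongrightarrow> v t) (sequentially \<times>\<^sub>F nhds t)"
      by (rule filterlim_compose[OF _ filterlim_snd])
    have "\<forall>\<^sub>F x in sequentially \<times>\<^sub>F nhds t. dist (\<phi> (fst x) (snd x)) (v (snd x)) < e"
      using order_tendstoD(2)[OF tendsto_dist[OF lim[OF t] vlim], of e] e by simp
    then obtain U where "open U" "t \<in> U" "\<forall>\<^sub>F n in sequentially. \<forall>x\<in>U. dist (\<phi> n x) (v x) < e"
      by (rule eventually_prod_nhds_seq)
    then show "\<exists>U. open U \<and> t \<in> U \<and> (\<exists>M::real. \<forall>\<^sub>F n in sequentially. \<forall>x\<in>U. dist (\<phi> n x) (v x) < e)" by blast
  qed
  then show "\<forall>\<^sub>F n in sequentially. \<forall>x\<in>K. dist (\<phi> n x) (v x) < e" by blast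
qed

lemma eventually_bounded_imp_bounded:
  fixes \<phi> :: "nat \<Rightarrow> 'a::topological_space \<Rightarrow> complex"
  assumes K: "compact K" and ev: "\<forall>\<^sub>F n in sequentially. \<forall>x\<in>K. norm (\<phi> n x) \<le> M"
    and cont: "\<And>n. continuous_on K (\<phi> n)"
  shows "\<exists>B. \<forall>n. \<forall>x\<in>K. norm (\<phi> n x) \<le> B"
proof -
  obtain N where N: "\<And>n x. n \<ge> N \<Longrightarrow> x \<in> K \<Longrightarrow> norm (\<phi> n x) \<le> M" using ev unfolding eventually_sequentially by blast
  have "\<exists>b. \<forall>x\<in>K. norm (\<phi> n x) \<le> b" for n
    using compact_imp_bounded[OF compact_continuous_image[OF cont K]] by (force simp: bounded_iff)
  then obtain b where b: "\<And>n x. x \<in> K \<Longrightarrow> norm (\<phi> n x) \<le> b n" by metis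
  have "norm (\<phi> n x) \<le> \<bar>M\<bar> + (\<Sum>i<N. \<bar>b i\<bar>)" if "x \<in> K" for n x
  proof (cases "n < N")
    case True
    have "norm (\<phi> n x) \<le> \<bar>b n\<bar>" using b[OF that, of n] by simp
    also have "\<dots> \<le> (\<Sum>i<N. \<bar>b i\<bar>)" using True by (intro member_le_sum) auto
    finally show ?thesis by simp
  next
    case False
    have "norm (\<phi> n x) \<le> M" using N False that by simp
    moreover have "0 \<le> (\<Sum>i<N. \<bar>b i\<bar>)" by (intro sum_nonneg) auto
    ultimately show ?thesis by linarith
  qed
  then show ?thesis by blast
qed

section \<open>Limits of families of hyperbolic maps\<close>

text \<open>An eventually periodic orbit converges along multiples of \<open>p\<close> only by being
  eventually constant there, so \<open>a\<close> is itself an orbit point and inherits the period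
  \<open>k - i\<close>.\<close>

lemma attr_to_of_repeat:
  assumes hol: "f holomorphic_on UNIV" and at: "attr_to f p s a" and rep: "(f ^^ i) s = (f ^^ k) s" "i < k"
  shows "attr_to f (k - i) s a"
proof -
  define d where "d = k - i"
  have d: "d > 0" "k = i + d" using rep(2) by (auto simp: d_def)
  have p: "p > 0" by (rule attr_to_pos[OF at])
  have rep': "(f ^^ i) s = (f ^^ (i + d)) s" using rep(1) d(2) by simp
  note per = funpow_eventually_periodic[OF rep']
  have pi: "p * i \<ge> i" using p by (cases p) auto
  have "(\<lambda>m. (f ^^ (p * m)) s) \<longlonglongrightarrow> a" using at by (simp add: attr_to_def)
  from LIMSEQ_subseq_LIMSEQ[OF this, of "\<lambda>m. i + d * m"] have "(\<lambda>m. (f ^^ (p * (i + d * m))) s) \<longlonglongrightarrow> a"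
    using d(1) by (simp add: strict_mono_def o_def)
  moreover have "(f ^^ (p * (i + d * m))) s = (f ^^ (p * i)) s" for m
  proof -
    have "p * (i + d * m) = p * i + d * (p * m)" by (simp add: algebra_simps)
    then show ?thesis using per[OF pi, of "p * m"] by simp
  qed
  ultimately have a: "a = (f ^^ (p * i)) s" by (simp add: LIMSEQ_const_iff)
  have "(f ^^ d) a = (f ^^ (p * i + d * 1)) s" unfolding a by (metis add.commute comp_apply funpow_add mult_1_right)
  also have "\<dots> = a" unfolding a by (rule per[OF pi])
  finally have "attr_to f d s a" using attr_to_period[OF hol at] d(1) by blast
  then show ?thesis by (simp add: d_def)
qed

text \<open>The limits coincide along common multiples of \<open>d\<close> and \<open>e\<close>, so
  the limit point has both periods and hence their difference.\<close>

lemma attr_to_diff: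
  assumes hol: "f holomorphic_on UNIV" and at: "attr_to f d s a" "attr_to f e s b" and ed: "e < d"
  shows "attr_to f (d - e) s a"
proof -
  have pos: "d > 0" "e > 0" using attr_to_pos at by blast+
  have la: "(\<lambda>m. (f ^^ (d * m)) s) \<longlonglongrightarrow> a" "(\<lambda>m. (f ^^ (e * m)) s) \<longlonglongrightarrow> b" using at by (auto simp: attr_to_def)
  have "(\<lambda>m. (f ^^ (d * (e * m))) s) \<longlonglongrightarrow> a"
    using LIMSEQ_subseq_LIMSEQ[OF la(1), of "\<lambda>m. e * m"] pos by (simp add: strict_mono_def o_def)
  moreover have "(\<lambda>m. (f ^^ (e * (d * m))) s) \<longlonglongrightarrow> b"
    using LIMSEQ_subseq_LIMSEQ[OF la(2), of "\<lambda>m. d * m"] pos by (simp add: strict_mono_def o_def)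
  moreover have "(\<lambda>m. (f ^^ (d * (e * m))) s) = (\<lambda>m. (f ^^ (e * (d * m))) s)" by (simp add: mult.left_commute)
  ultimately have "a = b" using LIMSEQ_unique by metis
  then have fa: "(f ^^ d) a = a" "(f ^^ e) a = a" using at by (auto simp: attr_to_def)
  have "(f ^^ (d - e)) ((f ^^ e) a) = (f ^^ d) a" using ed by (metis comp_apply funpow_add le_add_diff_inverse2 less_imp_le)
  then have "(f ^^ (d - e)) a = a" using fa by simp
  then show ?thesis using attr_to_period[OF hol at(1)] ed by simp
qed

text \<open>The repetition puts the orbit point number \<open>i\<close> on the cycle already, so a
  period of the limit is a period of the orbit from there on.\<close>

lemma attr_to_repeat_period:
  assumes hol: "f holomorphic_on UNIV" and at: "attr_to f e s a" and rep: "(f ^^ i) s = (f ^^ k) s" "i < k"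
  shows "(f ^^ (i + e)) s = (f ^^ i) s"
proof -
  define d where "d = k - i"
  have d: "d > 0" "k = i + d" using rep(2) by (auto simp: d_def)
  have e: "e > 0" by (rule attr_to_pos[OF at])
  have rep': "(f ^^ i) s = (f ^^ (i + d)) s" using rep(1) d(2) by simp
  have "(\<lambda>m. (f ^^ (e * m)) ((f ^^ i) s)) \<longlonglongrightarrow> (f ^^ i) a"
    using attr_to_image[OF hol at, of i] by (simp add: attr_to_def)
  from LIMSEQ_subseq_LIMSEQ[OF this, of "\<lambda>m. d * m"]
  have "(\<lambda>m. (f ^^ (e * (d * m))) ((f ^^ i) s)) \<longlonglongrightarrow> (f ^^ i) a" using d by (simp add: strict_mono_def o_def)
  moreover have "(f ^^ (e * (d * m))) ((f ^^ i) s) = (f ^^ i) s" for m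
  proof -
    have "(f ^^ (e * (d * m))) ((f ^^ i) s) = (f ^^ (i + d * (e * m))) s"
    proof -
      have eq: "i + d * (e * m) = e * (d * m) + i" by (simp add: mult.left_commute)
      show ?thesis unfolding eq by (simp add: funpow_add)
    qed
    then show ?thesis using funpow_eventually_periodic[OF rep' order_refl, of "e * m"] by simp
  qed
  ultimately have ia: "(f ^^ i) s = (f ^^ i) a" by (simp add: LIMSEQ_const_iff)
  have "(f ^^ (i + e)) s = (f ^^ e) ((f ^^ i) a)" unfolding ia[symmetric] by (metis add.commute comp_apply funpow_add)
  also have "\<dots> = (f ^^ i) ((f ^^ e) a)" by (rule funpow_commute_apply)
  also have "\<dots> = (f ^^ i) s" using at ia by (simp add: attr_to_def)
  finally show ?thesis .
qed

text \<open>Countability is the form in which the identity theorem is used: countable sets can be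
  united, leave a connected open set connected when removed, and contain no nonempty open
  set.\<close>

lemma holomorphic_zero_or_countable:
  assumes "f holomorphic_on D" "open D" "connected D" "\<xi> \<in> D" "f \<xi> \<noteq> 0"
  shows "countable {z \<in> D. f z = 0}"
proof (cases "f constant_on D")
  case True
  then have E: "{z \<in> D. f z = 0} = {}" using assms(4,5) by (auto simp: constant_on_def)
  show ?thesis unfolding E by simp
next
  case False
  obtain C :: "nat \<Rightarrow> complex set" where C: "\<And>n. compact (C n)" "\<Union>(range C) = D"
    using open_Union_compact_subsets[OF assms(2)] by metis
  have "fsigma D" using fsigma.intros[of C] C compact_imp_closed by metis
  then show ?thesis using holomorphic_countable_zeros[OF assms(1-3)] False by blast
qed

lemma exists_strict_mono_choice:
  assumes "\<And>k. \<forall>\<^sub>F n in sequentially. P k (n::nat)"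
  obtains r where "strict_mono (r :: nat \<Rightarrow> nat)" "\<And>k. P k (r k)"
proof -
  have "\<exists>r. \<forall>k. P k (r k) \<and> r k < r (Suc k)"
  proof (rule dependent_nat_choice)
    show "\<exists>n. P 0 n" using eventually_happens'[OF sequentially_bot assms] .
    fix n k assume "P k n"
    have "\<forall>\<^sub>F m in sequentially. P (Suc k) m \<and> n < m" using assms eventually_gt_at_top by (rule eventually_conj)
    then show "\<exists>m. P (Suc k) m \<and> n < m" using eventually_happens'[OF sequentially_bot] by blast
  qed
  then show ?thesis using that by (metis strict_mono_Suc_iff)
qed

text \<open>The situation over one complex parameter, with approximating maps \<open>F\<close> and
  limit \<open>G\<close>. Hausdorff convergence of the singular sets enters as \<open>upper\<close>,
  uniform for nearby parameters, and as \<open>lower\<close>, at each parameter; \<open>sel\<close>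
  moves singular values holomorphically.\<close>

locale limit_family =
  fixes D :: "complex set" and F :: "nat \<Rightarrow> complex \<Rightarrow> complex \<Rightarrow> complex" and G :: "complex \<Rightarrow> complex \<Rightarrow> complex"
  assumes conn: "connected D"
    and famF: "\<And>n. hol_family D (F n)" and famG: "hol_family D G"
    and lim: "\<And>t. t \<in> D \<Longrightarrow> luc_tendsto (\<lambda>x. F (fst x) (snd x)) (G t) (sequentially \<times>\<^sub>F nhds t)"
    and HolG: "\<And>t. t \<in> D \<Longrightarrow> G t \<in> Hol_star_b"
    and attF: "\<And>n t. t \<in> D \<Longrightarrow> all_attracted (F n t)"
    and sel: "\<And>n t s. t \<in> D \<Longrightarrow> s \<in> sing_vals (F n t) \<Longrightarrow>
        \<exists>w. w holomorphic_on D \<and> w t = s \<and> (\<forall>t\<in>D. w t \<in> sing_vals (F n t))"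
    and upper: "\<And>t U. t \<in> D \<Longrightarrow> open U \<Longrightarrow> sing_vals (G t) \<subseteq> U \<Longrightarrow>
        \<forall>\<^sub>F x in sequentially \<times>\<^sub>F nhds t. sing_vals (F (fst x) (snd x)) \<subseteq> U"
    and lower: "\<And>t s e. t \<in> D \<Longrightarrow> s \<in> sing_vals (G t) \<Longrightarrow> e > 0 \<Longrightarrow>
        \<forall>\<^sub>F n in sequentially. \<exists>y\<in>sing_vals (F n t). dist y s < e"
    and stab: "\<And>t. t \<in> D \<Longrightarrow> all_attracted (G t) \<Longrightarrow> \<forall>\<^sub>F t' in nhds t. all_attracted (G t')"
begin

lemma openD: "open D" using famG by (simp add: hol_family_def)

lemma holG: "t \<in> D \<Longrightarrow> G t holomorphic_on UNIV" using famG by (simp add: hol_family_def)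

lemma holF: "t \<in> D \<Longrightarrow> F n t holomorphic_on UNIV" using famF by (simp add: hol_family_def)

lemma HolG': "t \<in> D \<Longrightarrow> G t \<in> Hol_star" using HolG by (simp add: Hol_star_b_def)

definition selection :: "nat \<Rightarrow> (complex \<Rightarrow> complex) \<Rightarrow> bool" where
  "selection n w \<longleftrightarrow> w holomorphic_on D \<and> (\<forall>t\<in>D. w t \<in> sing_vals (F n t))"

text \<open>Singular values of the limit maps are followed as limits of moving singular values of
  the approximating maps, along a subsequence \<open>r\<close>. In this way \<open>v\<close>
  inherits orbit bounds from the \<open>F n\<close>.\<close>

definition approx_by :: "(nat \<Rightarrow> nat) \<Rightarrow> (nat \<Rightarrow> complex \<Rightarrow> complex) \<Rightarrow> (complex \<Rightarrow> complex) \<Rightarrow> bool" where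
  "approx_by r w v \<longleftrightarrow> strict_mono r \<and> (\<forall>j. selection (r j) (w j)) \<and> v holomorphic_on D \<and>
     (\<forall>K. compact K \<longrightarrow> K \<subseteq> D \<longrightarrow> uniform_limit K w v sequentially)"

text \<open>\<open>lower\<close> supplies nearby singular values of the approximating maps,
  \<open>sel\<close> lets them move, \<open>upper\<close> bounds them locally uniformly, and
  Montel's theorem extracts the limit.\<close>

lemma approx_exists:
  assumes t: "t \<in> D" and s: "s \<in> sing_vals (G t)"
  obtains r w v where "approx_by r w v" "v t = s"
proof -
  have ev: "\<forall>\<^sub>F n in sequentially. \<exists>y\<in>sing_vals (F n t). dist y s < inverse (real (Suc k))" for k
    by (rule lower[OF t s]) simp
  obtain r where r: "strict_mono (r :: nat \<Rightarrow> nat)" "\<And>k. \<exists>y\<in>sing_vals (F (r k) t). dist y s < inverse (real (Suc k))"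
    using exists_strict_mono_choice[where P = "\<lambda>k n. \<exists>y\<in>sing_vals (F n t). dist y s < inverse (real (Suc k))", OF ev] by blast
  then obtain y where y: "\<And>k. y k \<in> sing_vals (F (r k) t)" "\<And>k. dist (y k) s < inverse (real (Suc k))" by metis
  have ys: "y \<longlonglongrightarrow> s"
  proof (rule metric_LIMSEQ_I)
    fix e :: real assume "e > 0"
    then obtain N where N: "inverse (real (Suc N)) < e" using reals_Archimedean by blast
    have "dist (y n) s < e" if "n \<ge> N" for n
    proof -
      have "inverse (real (Suc n)) \<le> inverse (real (Suc N))" using that by (simp add: field_simps)
      then show ?thesis using y(2)[of n] N by linarith
    qed
    then show "\<exists>no. \<forall>n\<ge>no. dist (y n) s < e" by blast
  qed
  have "\<exists>w. selection (r k) w \<and> w t = y k" for k using sel[OF t y(1)] unfolding selection_def by blast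
  then obtain w where w: "\<And>k. selection (r k) (w k)" "\<And>k. w k t = y k" by metis
  have bd: "\<exists>B. \<forall>k. \<forall>x\<in>K. norm (w k x) \<le> B" if K: "compact K" "K \<subseteq> D" for K
  proof -
    have "\<exists>M. \<forall>\<^sub>F k in sequentially. \<forall>x\<in>K. norm (w k x) \<le> M"
    proof (rule eventually_on_compact[OF K(1)])
      fix u assume "u \<in> K"
      then have u: "u \<in> D" using K by blast
      obtain M where M: "sing_vals (G u) \<subseteq> ball 0 M"
        using HolG[OF u] bounded_subset_ballD[of "sing_vals (G u)" 0] by (auto simp: Hol_star_b_def)
      have "\<forall>\<^sub>F x in sequentially \<times>\<^sub>F nhds u. sing_vals (F (fst x) (snd x)) \<subseteq> ball 0 M \<and> snd x \<in> D"
        using eventually_conj[OF upper[OF u open_ball M]]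
          filterlim_snd[unfolded filterlim_iff, rule_format, OF eventually_nhds_in_open[OF openD u]] by blast
      then obtain U where U: "open U" "u \<in> U" "\<forall>\<^sub>F n in sequentially. \<forall>x\<in>U. sing_vals (F n x) \<subseteq> ball 0 M \<and> x \<in> D"
        using eventually_prod_nhds_seq[of "\<lambda>n x. sing_vals (F n x) \<subseteq> ball 0 M \<and> x \<in> D" u] by blast
      have "\<forall>\<^sub>F k in sequentially. \<forall>x\<in>U. sing_vals (F (r k) x) \<subseteq> ball 0 M \<and> x \<in> D"
        by (rule eventually_subseq[OF r(1) U(3)])
      then have "\<forall>\<^sub>F k in sequentially. \<forall>x\<in>U. norm (w k x) \<le> M"
      proof eventually_elim
        case (elim k)
        show ?case
        proof
          fix x assume "x \<in> U"
          then have "sing_vals (F (r k) x) \<subseteq> ball 0 M" "x \<in> D" using elim by blast+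
          then have "w k x \<in> ball 0 M" using w(1)[of k] unfolding selection_def by blast
          then show "norm (w k x) \<le> M" by simp
        qed
      qed
      then show "\<exists>U. open U \<and> u \<in> U \<and> (\<exists>M. \<forall>\<^sub>F k in sequentially. \<forall>x\<in>U. norm (w k x) \<le> M)" using U by blast
    qed linarith
    then obtain M where M: "\<forall>\<^sub>F k in sequentially. \<forall>x\<in>K. norm (w k x) \<le> M" by blast
    have "continuous_on K (w k)" for k
      using w(1) K(2) holomorphic_on_imp_continuous_on continuous_on_subset unfolding selection_def by blast
    then show ?thesis by (rule eventually_bounded_imp_bounded[OF K(1) M])
  qed
  obtain v q where v: "v holomorphic_on D" "strict_mono (q :: nat \<Rightarrow> nat)" "\<And>x. x \<in> D \<Longrightarrow> (\<lambda>n. w (q n) x) \<longlonglongrightarrow> v x"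
      "\<And>K. compact K \<Longrightarrow> K \<subseteq> D \<Longrightarrow> uniform_limit K (w \<circ> q) v sequentially"
  proof (rule Montel[OF openD, of "range w" w])
    show "\<exists>B. \<forall>h\<in>range w. \<forall>z\<in>K. norm (h z) \<le> B" if "compact K" "K \<subseteq> D" for K using bd[OF that] by blast
    show "h holomorphic_on D" if "h \<in> range w" for h using that w(1) unfolding selection_def by blast
  qed blast+
  have "approx_by (r \<circ> q) (w \<circ> q) v"
    unfolding approx_by_def using strict_mono_o[OF r(1) v(2)] w(1) v(1,4) by simp
  moreover have "v t = s"
  proof (rule LIMSEQ_unique[OF v(3)[OF t]])
    show "(\<lambda>n. w (q n) t) \<longlonglongrightarrow> s" using LIMSEQ_subseq_LIMSEQ[OF ys v(2)] by (simp add: w(2) o_def)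
  qed
  ultimately show ?thesis by (rule that)
qed

lemma approx_tendsto:
  assumes a: "approx_by r w v" and t: "t \<in> D"
  shows "((\<lambda>x. w (fst x) (snd x)) \<longlongrightarrow> v t) (sequentially \<times>\<^sub>F nhds t)"
  using a by (intro uniform_limit_imp_tendsto_prod[OF openD t])
    (auto simp: approx_by_def holomorphic_on_imp_continuous_on)

lemma lim_subseq:
  assumes r: "strict_mono r" and t: "t \<in> D"
  shows "luc_tendsto (\<lambda>x. F (r (fst x)) (snd x)) (G t) (sequentially \<times>\<^sub>F nhds t)"
proof -
  have "filterlim (\<lambda>x. (r (fst x), snd x)) (sequentially \<times>\<^sub>F nhds t) (sequentially \<times>\<^sub>F nhds t)"
    by (intro filterlim_Pair filterlim_snd filterlim_compose[OF filterlim_subseq[OF r] filterlim_fst])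
  from luc_tendsto_filterlim[OF lim[OF t] this] show ?thesis by simp
qed

lemma eventually_holF: "t \<in> D \<Longrightarrow> \<forall>\<^sub>F x in sequentially \<times>\<^sub>F nhds t. F (r (fst x)) (snd x) holomorphic_on UNIV"
  by (rule eventually_mono[OF filterlim_snd[unfolded filterlim_iff, rule_format, OF eventually_nhds_in_open[OF openD]]])
    (simp_all add: holF)

lemma approx_orbit_tendsto:
  assumes a: "approx_by r w v" and t: "t \<in> D"
  shows "((\<lambda>x. (F (r (fst x)) (snd x) ^^ k) (w (fst x) (snd x))) \<longlongrightarrow> (G t ^^ k) (v t)) (sequentially \<times>\<^sub>F nhds t)"
proof -
  have c: "continuous_on UNIV (G t)" by (rule holomorphic_on_imp_continuous_on[OF holG[OF t]])
  have "strict_mono r" using a by (simp add: approx_by_def)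
  from luc_tendsto_eval[OF luc_tendsto_funpow[OF lim_subseq[OF this t] c] continuous_on_funpow[OF c] approx_tendsto[OF a t]]
  show ?thesis .
qed

text \<open>A point outside the closed set \<open>sing_vals (G t)\<close> has a neighbourhood that,
  by \<open>upper\<close>, the singular values of all late approximating maps avoid, among them
  those converging to \<open>v t\<close>.\<close>

lemma approx_in:
  assumes a: "approx_by r w v" and t: "t \<in> D" shows "v t \<in> sing_vals (G t)"
proof (rule ccontr)
  assume "v t \<notin> sing_vals (G t)"
  moreover have "closed (sing_vals (G t))" by (rule sing_vals_covering(1)[OF HolG'[OF t]])
  ultimately obtain e where e: "e > 0" "cball (v t) e \<inter> sing_vals (G t) = {}"
    by (metis Compl_iff Int_commute disjoint_eq_subset_Compl open_Compl open_contains_cball)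
  have U: "sing_vals (G t) \<subseteq> - cball (v t) e" using e(2) by blast
  have "\<forall>\<^sub>F x in sequentially \<times>\<^sub>F nhds t. sing_vals (F (fst x) (snd x)) \<subseteq> - cball (v t) e"
    by (rule upper[OF t _ U]) (simp add: open_Compl)
  then obtain V where V: "open V" "t \<in> V" "\<forall>\<^sub>F n in sequentially. \<forall>x\<in>V. sing_vals (F n x) \<subseteq> - cball (v t) e"
    using eventually_prod_nhds_seq[of "\<lambda>n x. sing_vals (F n x) \<subseteq> - cball (v t) e" t] by blast
  have r: "strict_mono r" and s: "\<And>j. selection (r j) (w j)" using a by (auto simp: approx_by_def)
  have "\<forall>\<^sub>F j in sequentially. \<forall>x\<in>V. sing_vals (F (r j) x) \<subseteq> - cball (v t) e" by (rule eventually_subseq[OF r V(3)])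
  moreover have ul: "uniform_limit K w v sequentially" if "compact K" "K \<subseteq> D" for K
    using a that unfolding approx_by_def by blast
  have "uniform_limit {t} w v sequentially" by (rule ul) (use t in auto)
  then have "(\<lambda>j. w j t) \<longlonglongrightarrow> v t" by (rule tendsto_uniform_limitI) simp
  then have "\<forall>\<^sub>F j in sequentially. dist (w j t) (v t) < e" using e(1) by (rule tendstoD)
  ultimately have "\<forall>\<^sub>F j in sequentially. False"
  proof eventually_elim
    case (elim j)
    have "w j t \<in> - cball (v t) e" using elim(1) V(2) s[of j] t unfolding selection_def by blast
    then show ?case using elim(2) by (simp add: dist_commute)
  qed
  then show False by simp
qed

lemma orbit_holomorphic:
  assumes "selection n w" shows "(\<lambda>t. (F n t ^^ k) (w t)) holomorphic_on D"
  using hol_family_compose[OF hol_family_funpow[OF famF]] assms unfolding selection_def by blast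

lemma limit_orbit_holomorphic:
  assumes "v holomorphic_on D" shows "(\<lambda>t. (G t ^^ k) (v t)) holomorphic_on D"
  using hol_family_compose[OF hol_family_funpow[OF famG]] assms by blast

lemma approx_orbit_uniform_limit:
  assumes a: "approx_by r w v" and K: "compact K" "K \<subseteq> D"
  shows "uniform_limit K (\<lambda>j t. (F (r j) t ^^ k) (w j t)) (\<lambda>t. (G t ^^ k) (v t)) sequentially"
proof (rule tendsto_prod_imp_uniform_limit[OF K(1) openD K(2)])
  show "continuous_on D (\<lambda>t. (G t ^^ k) (v t))"
    using limit_orbit_holomorphic a holomorphic_on_imp_continuous_on unfolding approx_by_def by blast
qed (use approx_orbit_tendsto[OF a] K(2) in blast)

text \<open>For fixed \<open>n\<close>, which periods the limit cycle of a singular orbit has does not depend on the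
  parameter: the condition is open by stability and closed by Vitali's theorem.\<close>

lemma period_constant:
  assumes w: "selection n w" and t: "t \<in> D" and at: "attr_to (F n t) d (w t) a" and u: "u \<in> D"
  shows "\<exists>b. attr_to (F n u) d (w u) b"
proof -
  have d: "d > 0" by (rule attr_to_pos[OF at])
  have holw: "w holomorphic_on D" and ws: "\<And>t. t \<in> D \<Longrightarrow> w t \<in> sing_vals (F n t)" using w by (auto simp: selection_def)
  have stable: "\<exists>M. \<forall>\<^sub>F y in nhds x. (\<exists>b\<in>ball c 1. attr_to (F n y) p (w y) b) \<and> (\<forall>m. norm ((F n y ^^ m) (w y)) \<le> M)"
    if x: "x \<in> D" "attr_to (F n x) p (w x) c" for x p c
  proof -
    have "isCont w x" using holomorphic_on_imp_continuous_on[OF holw] openD x(1) by (simp add: continuous_on_eq_continuous_at)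
    then have wx: "(w \<longlongrightarrow> w x) (nhds x)" unfolding isCont_def by (rule tendsto_at_iff_tendsto_nhds[THEN iffD1])
    have l: "luc_tendsto (F n) (F n x) (nhds x)" using famF x(1) by (simp add: hol_family_def)
    have h: "\<forall>\<^sub>F y in nhds x. F n y holomorphic_on UNIV"
      using hol_family_eventually_holomorphic[OF famF x(1) filterlim_ident] .
    show ?thesis using attr_to_stable[OF holF[OF x(1)] x(2) l h wx zero_less_one] by metis
  qed
  define \<phi> where "\<phi> m x = (F n x ^^ (d * m)) (w x)" for m x
  have hol\<phi>: "\<phi> m holomorphic_on D" for m unfolding \<phi>_def by (rule orbit_holomorphic[OF w])
  \<comment> \<open>Each parameter has some attracting cycle, possibly with another period, and
    stability bounds the whole orbit for nearby parameters; compactness then bounds all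
    \<open>\<phi> m\<close> at once.\<close>
  have bd: "\<exists>B. \<forall>m. \<forall>x\<in>K. norm (\<phi> m x) \<le> B" if K: "compact K" "K \<subseteq> D" for K
  proof -
    have "\<exists>M. \<forall>\<^sub>F k in sequentially. \<forall>x\<in>K. \<forall>m. norm (\<phi> m x) \<le> M"
    proof (rule eventually_on_compact[OF K(1)])
      fix x assume "x \<in> K"
      then have x: "x \<in> D" using K by blast
      then obtain p c where "attr_to (F n x) p (w x) c" using attF ws unfolding all_attracted_def by blast
      then obtain M where "\<forall>\<^sub>F y in nhds x. (\<exists>b\<in>ball c 1. attr_to (F n y) p (w y) b) \<and> (\<forall>m. norm ((F n y ^^ m) (w y)) \<le> M)"
        using stable[OF x] by blast
      then obtain U where "open U" "x \<in> U" "\<forall>y\<in>U. \<forall>m. norm ((F n y ^^ m) (w y)) \<le> M"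
        unfolding eventually_nhds by blast
      then show "\<exists>U. open U \<and> x \<in> U \<and> (\<exists>M. \<forall>\<^sub>F k in sequentially. \<forall>x\<in>U. \<forall>m. norm (\<phi> m x) \<le> M)"
        unfolding \<phi>_def by (intro exI[of _ U] conjI exI[of _ M] always_eventually allI) auto
    qed (meson order_trans)
    then show ?thesis by auto
  qed
  obtain M where "\<forall>\<^sub>F y in nhds t. (\<exists>b\<in>ball a 1. attr_to (F n y) d (w y) b) \<and> (\<forall>m. norm ((F n y ^^ m) (w y)) \<le> M)"
    using stable[OF t at] by blast
  then have "\<forall>\<^sub>F y in nhds t. (\<exists>b. attr_to (F n y) d (w y) b) \<and> y \<in> D"
    using eventually_nhds_in_open[OF openD t] by eventually_elim blast
  then obtain V where V: "open V" "t \<in> V" "\<forall>y\<in>V. (\<exists>b. attr_to (F n y) d (w y) b) \<and> y \<in> D"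
    unfolding eventually_nhds by blast
  then obtain g where g: "\<And>y. y \<in> V \<Longrightarrow> attr_to (F n y) d (w y) (g y)" by metis
  have limV: "(\<lambda>m. \<phi> m y) \<longlonglongrightarrow> g y" if "y \<in> V" for y using g[OF that] by (simp add: attr_to_def \<phi>_def)
  have V': "V \<noteq> {}" "V \<subseteq> D" using V by auto
  obtain A where A: "\<And>z. z \<in> D \<Longrightarrow> (\<lambda>m. \<phi> m z) \<longlonglongrightarrow> A z"
    using vitali_convergence[OF openD conn hol\<phi> bd V(1) V' limV] by metis
  \<comment> \<open>At \<open>u\<close> the orbit is attracted to some \<open>b\<close> with some
    period \<open>p\<close>. Along common multiples of \<open>d\<close> and \<open>p\<close> the
    limit is also \<open>A u\<close>, so \<open>b\<close> has the period \<open>d\<close> as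
    well.\<close>
  obtain p b where pb: "attr_to (F n u) p (w u) b" using attF[OF u] ws[OF u] unfolding all_attracted_def by blast
  have p: "p > 0" by (rule attr_to_pos[OF pb])
  have "(\<lambda>m. (F n u ^^ (d * (p * m))) (w u)) \<longlonglongrightarrow> A u"
    using LIMSEQ_subseq_LIMSEQ[OF A[OF u], of "\<lambda>m. p * m"] p by (simp add: strict_mono_def o_def \<phi>_def)
  moreover have "(\<lambda>m. (F n u ^^ (p * m)) (w u)) \<longlonglongrightarrow> b" using pb by (simp add: attr_to_def)
  then have "(\<lambda>m. (F n u ^^ (p * (d * m))) (w u)) \<longlonglongrightarrow> b"
    using LIMSEQ_subseq_LIMSEQ[of "\<lambda>m. (F n u ^^ (p * m)) (w u)" b "\<lambda>m. d * m"] d by (simp add: strict_mono_def o_def)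
  ultimately have Ab: "A u = b" by (simp add: mult.left_commute LIMSEQ_unique)
  have "(F n u ^^ d) (A u) = A u"
  proof (rule LIMSEQ_unique)
    show "(\<lambda>m. \<phi> (Suc m) u) \<longlonglongrightarrow> A u" using LIMSEQ_Suc[OF A[OF u]] .
    have "(\<lambda>m. (F n u ^^ d) (\<phi> m u)) \<longlonglongrightarrow> (F n u ^^ d) (A u)"
      by (rule tendsto_funpow[OF holomorphic_on_imp_continuous_on[OF holF[OF u]] A[OF u]])
    then show "(\<lambda>m. \<phi> (Suc m) u) \<longlonglongrightarrow> (F n u ^^ d) (A u)" by (simp add: \<phi>_def funpow_add)
  qed
  then show ?thesis using attr_to_period[OF holF[OF u] pb] d Ab by blast
qed

text \<open>The coincidences may happen at different parameters \<open>x\<close> and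
  \<open>y\<close>; constancy of the periods brings \<open>k - j\<close> from \<open>y\<close> to
  \<open>x\<close>, where it can be subtracted from \<open>k - i\<close>.\<close>

lemma hits_at_most_one:
  assumes w: "selection n w" and ij: "i < j" "j < k"
    and x: "x \<in> D" "(F n x ^^ i) (w x) = (F n x ^^ k) (w x)"
    and y: "y \<in> D" "(F n y ^^ j) (w y) = (F n y ^^ k) (w y)"
  shows "(F n x ^^ i) (w x) = (F n x ^^ j) (w x)"
proof -
  have ws: "\<And>t. t \<in> D \<Longrightarrow> w t \<in> sing_vals (F n t)" using w by (auto simp: selection_def)
  obtain p a where "attr_to (F n x) p (w x) a" using attF ws x(1) unfolding all_attracted_def by blast
  then have 1: "attr_to (F n x) (k - i) (w x) a" using attr_to_of_repeat[OF holF] x ij by simp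
  obtain p b where "attr_to (F n y) p (w y) b" using attF ws y(1) unfolding all_attracted_def by blast
  then have "attr_to (F n y) (k - j) (w y) b" using attr_to_of_repeat[OF holF] y ij by simp
  then obtain c where 2: "attr_to (F n x) (k - j) (w x) c" using period_constant[OF w y(1) _ x(1)] by blast
  have "attr_to (F n x) ((k - i) - (k - j)) (w x) a"
    by (rule attr_to_diff[OF holF[OF x(1)] 1 2]) (use ij in simp)
  then have "attr_to (F n x) (j - i) (w x) a" using ij by simp
  from attr_to_repeat_period[OF holF[OF x(1)] this x(2)] show ?thesis using ij by simp
qed

text \<open>At most one of the indices 0, 1, 2 is hit anywhere in \<open>X\<close>, so one pair is
  omitted throughout \<open>X\<close>, though the pair depends on \<open>n\<close> and
  \<open>k\<close>.\<close>

lemma omits_two: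
  assumes w: "selection n w" and k: "k \<ge> 3" and X: "X \<subseteq> D"
    and distinct: "\<And>x i j. x \<in> X \<Longrightarrow> i < j \<Longrightarrow> j < 3 \<Longrightarrow> (F n x ^^ i) (w x) \<noteq> (F n x ^^ j) (w x)"
  shows "\<exists>i j. i < j \<and> j < 3 \<and> (\<forall>x\<in>X. (F n x ^^ k) (w x) \<noteq> (F n x ^^ i) (w x) \<and> (F n x ^^ k) (w x) \<noteq> (F n x ^^ j) (w x))"
proof -
  define hit where "hit i \<longleftrightarrow> (\<exists>x\<in>X. (F n x ^^ i) (w x) = (F n x ^^ k) (w x))" for i
  have one: "\<not> (hit i \<and> hit j)" if "i < j" "j < 3" for i j
  proof
    assume "hit i \<and> hit j"
    then obtain x y where "x \<in> X" "(F n x ^^ i) (w x) = (F n x ^^ k) (w x)" "y \<in> X" "(F n y ^^ j) (w y) = (F n y ^^ k) (w y)"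
      unfolding hit_def by blast
    then have "(F n x ^^ i) (w x) = (F n x ^^ j) (w x)"
      using hits_at_most_one[OF w that(1), of k x y] that(2) k X by auto
    then show False using distinct[OF \<open>x \<in> X\<close> that] by blast
  qed
  have "\<exists>i j. i < j \<and> j < 3 \<and> \<not> hit i \<and> \<not> hit j"
  proof (cases "hit 0")
    case True
    then show ?thesis using one[of 0 1] one[of 0 2] by (intro exI[of _ 1] exI[of _ 2]) auto
  next
    case False
    show ?thesis
    proof (cases "hit 1")
      case True
      then show ?thesis using False one[of 1 2] by (intro exI[of _ 0] exI[of _ 2]) auto
    next
      case F1: False
      then show ?thesis using False by (intro exI[of _ 0] exI[of _ 1]) auto
    qed
  qed
  then show ?thesis unfolding hit_def by metis
qed

end

lemma uncountable_open:
  fixes U :: "complex set"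
  assumes "open U" "x \<in> U" shows "uncountable U"
proof -
  obtain e where "e > 0" "ball x e \<subseteq> U" using assms open_contains_ball by metis
  then show ?thesis using uncountable_ball[of e x] countable_subset by blast
qed

lemma continuous_on_nonzero_bound_below:
  fixes f :: "complex \<Rightarrow> complex"
  assumes "compact K" "continuous_on K f" "\<And>x. x \<in> K \<Longrightarrow> f x \<noteq> 0"
  obtains e where "e > 0" "\<And>x. x \<in> K \<Longrightarrow> e \<le> norm (f x)"
proof (cases "K = {}")
  case True then show ?thesis using that[of 1] by simp
next
  case False
  then obtain x0 where "x0 \<in> K" "\<And>x. x \<in> K \<Longrightarrow> norm (f x0) \<le> norm (f x)"
    using continuous_attains_inf[OF assms(1) False, of "\<lambda>x. norm (f x)"] assms(2) by (auto intro: continuous_on_norm)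
  then show ?thesis using that[of "norm (f x0)"] assms(3) by auto
qed

lemma eventually_separated_bounded:
  fixes a b :: "nat \<Rightarrow> complex \<Rightarrow> complex"
  assumes K: "compact K" and u: "uniform_limit K a A sequentially" "uniform_limit K b B sequentially"
    and c: "continuous_on K A" "continuous_on K B" and ne: "\<And>x. x \<in> K \<Longrightarrow> A x \<noteq> B x"
  obtains e M where "e > 0" "\<forall>\<^sub>F j in sequentially. \<forall>x\<in>K. e \<le> norm (a j x - b j x) \<and> norm (a j x) \<le> M \<and> norm (b j x) \<le> M"
proof -
  obtain e where e: "e > 0" "\<And>x. x \<in> K \<Longrightarrow> e \<le> norm (A x - B x)"
    by (rule continuous_on_nonzero_bound_below[OF K continuous_on_diff[OF c]]) (use ne in auto)
  have "\<exists>M. \<forall>x\<in>K. norm (A x) \<le> M" "\<exists>M. \<forall>x\<in>K. norm (B x) \<le> M"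
    using compact_imp_bounded[OF compact_continuous_image[OF c(1) K]] compact_imp_bounded[OF compact_continuous_image[OF c(2) K]]
    by (auto simp: bounded_iff)
  then obtain M1 M2 where M: "\<And>x. x \<in> K \<Longrightarrow> norm (A x) \<le> M1" "\<And>x. x \<in> K \<Longrightarrow> norm (B x) \<le> M2" by blast
  define \<delta> where "\<delta> = e / 3"
  have d: "\<delta> > 0" using e by (simp add: \<delta>_def)
  have "\<forall>\<^sub>F j in sequentially. \<forall>x\<in>K. dist (a j x) (A x) < \<delta>" using u(1) d by (auto simp: uniform_limit_iff)
  moreover have "\<forall>\<^sub>F j in sequentially. \<forall>x\<in>K. dist (b j x) (B x) < \<delta>" using u(2) d by (auto simp: uniform_limit_iff)
  ultimately have "\<forall>\<^sub>F j in sequentially. \<forall>x\<in>K. \<delta> \<le> norm (a j x - b j x) \<and>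
      norm (a j x) \<le> max M1 M2 + \<delta> \<and> norm (b j x) \<le> max M1 M2 + \<delta>"
  proof eventually_elim
    case (elim j)
    show ?case
    proof
      fix x assume x: "x \<in> K"
      have da: "norm (a j x - A x) < \<delta>" "norm (b j x - B x) < \<delta>" using elim x by (auto simp: dist_norm)
      have "norm (A x - B x) \<le> norm (a j x - A x) + norm (a j x - b j x) + norm (b j x - B x)"
        using norm_triangle_ineq4[of "(a j x - b j x)" "(a j x - A x)"] norm_triangle_ineq[of "(a j x - b j x) - (a j x - A x)" "b j x - B x"]
        by (simp add: algebra_simps)
      then have "\<delta> \<le> norm (a j x - b j x)" using e(2)[OF x] da by (simp add: \<delta>_def)
      moreover have "norm (a j x) \<le> max M1 M2 + \<delta>" using M(1)[OF x] da(1) norm_triangle_sub[of "a j x" "A x"] by linarith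
      moreover have "norm (b j x) \<le> max M1 M2 + \<delta>" using M(2)[OF x] da(2) norm_triangle_sub[of "b j x" "B x"] by linarith
      ultimately show "\<delta> \<le> norm (a j x - b j x) \<and> norm (a j x) \<le> max M1 M2 + \<delta> \<and> norm (b j x) \<le> max M1 M2 + \<delta>" by blast
    qed
  qed
  then show ?thesis using that d by blast
qed

section \<open>Uniform bounds for singular orbits\<close>

context limit_family
begin

definition orbits_bounded_near :: "(nat \<Rightarrow> nat) \<Rightarrow> (nat \<Rightarrow> complex \<Rightarrow> complex) \<Rightarrow> complex \<Rightarrow> bool" where
  "orbits_bounded_near r w t \<longleftrightarrow> (\<exists>U. open U \<and> t \<in> U \<and> (\<exists>M. \<forall>\<^sub>F j in sequentially. \<forall>x\<in>U. \<forall>k. norm ((F (r j) x ^^ k) (w j x)) \<le> M))"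

text \<open>Attraction for the limit map is stable when index, parameter and singular value change
  together, and stability includes the orbit bound.\<close>

lemma orbits_bounded_near_attracted:
  assumes a: "approx_by r w v" and t: "t \<in> D" and at: "all_attracted (G t)"
  shows "orbits_bounded_near r w t"
proof -
  obtain p b where pb: "attr_to (G t) p (v t) b" using at approx_in[OF a t] unfolding all_attracted_def by blast
  have r: "strict_mono r" using a by (simp add: approx_by_def)
  obtain M where M: "\<forall>\<^sub>F x in sequentially \<times>\<^sub>F nhds t. 
      (\<exists>c\<in>ball b 1. attr_to (F (r (fst x)) (snd x)) p (w (fst x) (snd x)) c) \<and>
      (\<forall>m. norm ((F (r (fst x)) (snd x) ^^ m) (w (fst x) (snd x))) \<le> M)"
    by (rule attr_to_stable[OF holG[OF t] pb lim_subseq[OF r t] eventually_holF[OF t] approx_tendsto[OF a t] zero_less_one])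
  have "\<forall>\<^sub>F x in sequentially \<times>\<^sub>F nhds t. \<forall>m. norm ((F (r (fst x)) (snd x) ^^ m) (w (fst x) (snd x))) \<le> M"
    using M by (rule eventually_mono) blast
  then obtain U where "open U" "t \<in> U" "\<forall>\<^sub>F j in sequentially. \<forall>x\<in>U. \<forall>m. norm ((F (r j) x ^^ m) (w j x)) \<le> M"
    by (rule eventually_prod_nhds_seq)
  then show ?thesis unfolding orbits_bounded_near_def by (intro exI[of _ U] conjI exI[of _ M])
qed

text \<open>Montel's theorem with two omitted moving values, away from the coincidences of the first
  three orbit points; the exceptional parameters are isolated and treated by the maximum principle.\<close>

lemma orbits_bounded_spread:
  assumes a: "approx_by r w v" and K: "cball c \<rho> \<subseteq> D"
    and dist: "\<And>x i j. x \<in> cball c \<rho> \<Longrightarrow> i < j \<Longrightarrow> j < 3 \<Longrightarrow> (G x ^^ i) (v x) \<noteq> (G x ^^ j) (v x)"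
    and x: "x \<in> ball c \<rho>" "orbits_bounded_near r w x" and y: "y \<in> ball c \<rho>"
  shows "orbits_bounded_near r w y"
proof -
  let ?o = "\<lambda>j k t. (F (r j) t ^^ k) (w j t)"
  have sels: "selection (r j) (w j)" for j using a by (simp add: approx_by_def)
  have holv: "v holomorphic_on D" using a by (simp add: approx_by_def)
  have ball: "ball c \<rho> \<subseteq> D" using K by auto
  have ul: "uniform_limit (cball c \<rho>) (\<lambda>j. ?o j k) (\<lambda>t. (G t ^^ k) (v t)) sequentially" for k
    by (rule approx_orbit_uniform_limit[OF a compact_cball K])
  have cont: "continuous_on (cball c \<rho>) (\<lambda>t. (G t ^^ k) (v t))" for k
    using limit_orbit_holomorphic[OF holv] K holomorphic_on_imp_continuous_on continuous_on_subset by blast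
  define Q where "Q i j e M \<longleftrightarrow> (\<forall>\<^sub>F n in sequentially. \<forall>t\<in>cball c \<rho>.
      e \<le> norm (?o n i t - ?o n j t) \<and> norm (?o n i t) \<le> M \<and> norm (?o n j t) \<le> M)" for i j and e M :: real
  have "\<exists>e M. e > 0 \<and> Q i j e M" if ij: "i < j" "j < 3" for i j
  proof -
    obtain e M where "e > 0" "Q i j e M"
      unfolding Q_def
      by (rule eventually_separated_bounded[OF compact_cball ul[of i] ul[of j] cont[of i] cont[of j] dist[OF _ ij]])
    then show ?thesis by blast
  qed
  then obtain e M where eQ: "\<And>i j. i < j \<Longrightarrow> j < 3 \<Longrightarrow> e i j > 0 \<and> Q i j (e i j) (M i j)" by metis
  have eM: "e i j > 0" "\<forall>\<^sub>F n in sequentially. \<forall>t\<in>cball c \<rho>. e i j \<le> norm (?o n i t - ?o n j t) \<and>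
      norm (?o n i t) \<le> M i j \<and> norm (?o n j t) \<le> M i j" if "i < j" "j < 3" for i j
    using eQ[OF that] unfolding Q_def by blast+
  obtain U M0 where U: "open U" "x \<in> U" "\<forall>\<^sub>F j in sequentially. \<forall>x\<in>U. \<forall>k. norm (?o j k x) \<le> M0"
    using x(2) unfolding orbits_bounded_near_def by blast
  define e0 where "e0 = Min {e 0 1, e 0 2, e 1 2}"
  define M1 where "M1 = Max {M0, M 0 1, M 0 2, M 1 2}"
  have e0: "e0 > 0" using eM(1)[of 0 1] eM(1)[of 0 2] eM(1)[of 1 2] by (simp add: e0_def)
  have pairs: "(i, j) \<in> {(0, 1), (0, 2), (1, 2)}" if "i < j" "j < 3" for i j :: nat using that by auto
  have e0le: "e0 \<le> e i j" "M i j \<le> M1" if "i < j" "j < 3" for i j using pairs[OF that] by (auto simp: e0_def M1_def)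
  have "\<forall>\<^sub>F n in sequentially. (\<forall>x\<in>U. \<forall>k. norm (?o n k x) \<le> M0) \<and>
     (\<forall>p\<in>{(0, 1), (0, 2), (1, 2)}. \<forall>t\<in>cball c \<rho>. e (fst p) (snd p) \<le> norm (?o n (fst p) t - ?o n (snd p) t) \<and>
        norm (?o n (fst p) t) \<le> M (fst p) (snd p) \<and> norm (?o n (snd p) t) \<le> M (fst p) (snd p))"
  proof (rule eventually_conj[OF U(3)], rule eventually_ball_finite)
    show "\<forall>p\<in>{(0, 1), (0, 2), (1, 2)}. \<forall>\<^sub>F n in sequentially.
       \<forall>t\<in>cball c \<rho>. e (fst p) (snd p) \<le> norm (?o n (fst p) t - ?o n (snd p) t) \<and>
        norm (?o n (fst p) t) \<le> M (fst p) (snd p) \<and> norm (?o n (snd p) t) \<le> M (fst p) (snd p)"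
    proof
      fix p :: "nat \<times> nat" assume "p \<in> {(0, 1), (0, 2), (1, 2)}"
      then have "fst p < snd p" "snd p < 3" by auto
      from eM(2)[OF this] show "\<forall>\<^sub>F n in sequentially.
       \<forall>t\<in>cball c \<rho>. e (fst p) (snd p) \<le> norm (?o n (fst p) t - ?o n (snd p) t) \<and>
        norm (?o n (fst p) t) \<le> M (fst p) (snd p) \<and> norm (?o n (snd p) t) \<le> M (fst p) (snd p)" .
    qed
  qed simp
  then obtain N where N: "\<And>n k. n \<ge> N \<Longrightarrow> norm (?o n k x) \<le> M0"
     and N': "\<And>n i j t. n \<ge> N \<Longrightarrow> i < j \<Longrightarrow> j < 3 \<Longrightarrow> t \<in> cball c \<rho> \<Longrightarrow>
        e i j \<le> norm (?o n i t - ?o n j t) \<and> norm (?o n i t) \<le> M i j \<and> norm (?o n j t) \<le> M i j"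
    unfolding eventually_sequentially using U(2) pairs by fastforce
  \<comment> \<open>The family to be bounded is indexed by map and time; the omitted pair
    \<open>\<iota> p\<close> varies with the index, which the criterion with moving omitted values
    allows.\<close>
  define I where "I = {p :: nat \<times> nat. fst p \<ge> N \<and> snd p \<ge> 3}"
  have "\<exists>i j. i < j \<and> j < 3 \<and> (\<forall>t\<in>ball c \<rho>. ?o n k t \<noteq> ?o n i t \<and> ?o n k t \<noteq> ?o n j t)" if nk: "n \<ge> N" "k \<ge> 3" for n k
  proof (rule omits_two[OF sels nk(2) ball])
    fix t i j assume "t \<in> ball c \<rho>" "i < j" "j < (3::nat)"
    then show "?o n i t \<noteq> ?o n j t" using N'[OF nk(1), of i j t] eM(1)[of i j] by auto
  qed
  then have "\<forall>p\<in>I. \<exists>ij. fst ij < snd ij \<and> snd ij < (3::nat) \<and>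
      (\<forall>t\<in>ball c \<rho>. ?o (fst p) (snd p) t \<noteq> ?o (fst p) (fst ij) t \<and> ?o (fst p) (snd p) t \<noteq> ?o (fst p) (snd ij) t)"
    unfolding I_def by force
  from bchoice[OF this] obtain \<iota> where \<iota>: "\<And>p. p \<in> I \<Longrightarrow> fst (\<iota> p) < snd (\<iota> p) \<and> snd (\<iota> p) < (3::nat) \<and>
      (\<forall>t\<in>ball c \<rho>. ?o (fst p) (snd p) t \<noteq> ?o (fst p) (fst (\<iota> p)) t \<and> ?o (fst p) (snd p) t \<noteq> ?o (fst p) (snd (\<iota> p)) t)"
    by blast
  obtain d where d: "d > 0" "cball y d \<subseteq> ball c \<rho>" using y open_contains_cball open_ball by metis
  have holo: "?o n k holomorphic_on ball c \<rho>" for n k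
    using orbit_holomorphic[OF sels] ball holomorphic_on_subset by blast
  have "\<exists>B. \<forall>p\<in>I. \<forall>z\<in>cball y d. norm (?o (fst p) (snd p) z) \<le> B"
  proof (rule normal_omit_two[OF open_ball convex_connected[OF convex_ball] x(1) compact_cball d(2),
        where a = "\<lambda>p. ?o (fst p) (fst (\<iota> p))" and b = "\<lambda>p. ?o (fst p) (snd (\<iota> p))" and M = M1 and e = e0])
    fix p assume p: "p \<in> I"
    have n: "fst p \<ge> N" and i: "fst (\<iota> p) < snd (\<iota> p)" "snd (\<iota> p) < 3" using p \<iota>[OF p] by (auto simp: I_def)
    show "norm (?o (fst p) (snd p) x) \<le> M1" using N[OF n, of "snd p"] by (simp add: M1_def)
    have xc: "x \<in> cball c \<rho>" using x(1) by simp
    show "e0 \<le> norm (?o (fst p) (snd (\<iota> p)) x - ?o (fst p) (fst (\<iota> p)) x)"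
      using N'[OF n i xc] e0le[OF i] by (simp add: norm_minus_commute)
    fix z assume z: "z \<in> ball c \<rho>"
    then have zc: "z \<in> cball c \<rho>" by simp
    have "?o (fst p) (fst (\<iota> p)) z \<noteq> ?o (fst p) (snd (\<iota> p)) z" using N'[OF n i zc] eM(1)[OF i] by auto
    then show "?o (fst p) (fst (\<iota> p)) z \<noteq> ?o (fst p) (snd (\<iota> p)) z \<and>
        ?o (fst p) (snd p) z \<noteq> ?o (fst p) (fst (\<iota> p)) z \<and> ?o (fst p) (snd p) z \<noteq> ?o (fst p) (snd (\<iota> p)) z"
      using \<iota>[OF p] z by blast
    show "norm (?o (fst p) (fst (\<iota> p)) z) \<le> M1 \<and> norm (?o (fst p) (snd (\<iota> p)) z) \<le> M1"
      using N'[OF n i zc] e0le[OF i] by linarith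
  qed (use holo e0 in auto)
  then obtain B where B: "\<And>n k z. n \<ge> N \<Longrightarrow> k \<ge> 3 \<Longrightarrow> z \<in> cball y d \<Longrightarrow> norm (?o n k z) \<le> B"
    unfolding I_def by fastforce
  \<comment> \<open>Times below 3 are the comparison orbits themselves and get the bound
    \<open>M1\<close> from their uniform convergence.\<close>
  have "norm (?o n k z) \<le> max B M1" if n: "n \<ge> N" and z: "z \<in> ball y d" for n k z
  proof (cases "k \<ge> 3")
    case True
    then have "norm (?o n k z) \<le> B" using B[OF n True, of z] z by simp
    then show ?thesis by simp
  next
    case False
    have zc: "z \<in> cball c \<rho>" using z d(2) by (meson ball_subset_cball subsetD)
    have "k = 0 \<or> k = 1 \<or> k = 2" using False by linarith
    then have "norm (?o n k z) \<le> M 0 1 \<or> norm (?o n k z) \<le> M 0 2"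
      using N'[OF n, of 0 1 z] N'[OF n, of 0 2 z] zc by auto
    then have "norm (?o n k z) \<le> M1" using e0le(2)[of 0 1] e0le(2)[of 0 2] by force
    then show ?thesis by simp
  qed
  then have "\<forall>\<^sub>F n in sequentially. \<forall>z\<in>ball y d. \<forall>k. norm (?o n k z) \<le> max B M1"
    unfolding eventually_sequentially by blast
  then show ?thesis unfolding orbits_bounded_near_def using d(1) by (intro exI[of _ "ball y d"]) auto
qed

text \<open>Coincidences among the first three orbit points form a countable set \<open>Z\<close>,
  so boundedness spreads over the connected set \<open>D - Z\<close>. At points of \<open>Z\<close>
  it is recovered from a surrounding circle, and the bound passes from the approximating orbits to
  their limits.\<close>

lemma limit_orbits_bounded:
  assumes a: "approx_by r w v" and t1: "t1 \<in> D" "all_attracted (G t1)"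
    and distinct: "\<And>i j. i < j \<Longrightarrow> j < 3 \<Longrightarrow> \<exists>x\<in>D. (G x ^^ i) (v x) \<noteq> (G x ^^ j) (v x)"
    and K: "compact K" "K \<subseteq> D"
  shows "\<exists>B. \<forall>k. \<forall>x\<in>K. norm ((G x ^^ k) (v x)) \<le> B"
proof -
  let ?o = "\<lambda>j k t. (F (r j) t ^^ k) (w j t)"
  let ?O = "\<lambda>k t. (G t ^^ k) (v t)"
  have sels: "selection (r j) (w j)" for j using a by (simp add: approx_by_def)
  have holO: "?O k holomorphic_on D" for k using limit_orbit_holomorphic a unfolding approx_by_def by blast
  define Z where "Z = (\<Union>p\<in>{(0, 1), (0, 2), (1, 2)}. {x \<in> D. ?O (fst p) x - ?O (snd p) x = 0})"
  have cZ: "countable Z"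
    unfolding Z_def
  proof (rule countable_UN)
    show "countable {(0::nat, 1::nat), (0, 2), (1, 2)}" by simp
    fix p :: "nat \<times> nat" assume p: "p \<in> {(0, 1), (0, 2), (1, 2)}"
    then obtain x where "x \<in> D" "?O (fst p) x - ?O (snd p) x \<noteq> 0" using distinct[of "fst p" "snd p"] by auto
    then show "countable {x \<in> D. ?O (fst p) x - ?O (snd p) x = 0}"
      by (intro holomorphic_zero_or_countable[OF _ openD conn]) (auto intro!: holomorphic_intros holO)
  qed
  have notZ: "?O i x \<noteq> ?O j x" if "x \<in> D - Z" "i < j" "j < 3" for x i j
  proof -
    have "(i, j) \<in> {(0, 1), (0, 2), (1, 2)}" using that(2,3) by auto
    then show ?thesis using that(1) unfolding Z_def by fastforce
  qed
  have DZ: "D - Z = {x \<in> D. ?O 0 x - ?O 1 x \<noteq> 0} \<inter> {x \<in> D. ?O 0 x - ?O 2 x \<noteq> 0} \<inter> {x \<in> D. ?O 1 x - ?O 2 x \<noteq> 0}"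
    by (auto simp: Z_def)
  have "open {x \<in> D. ?O i x - ?O j x \<noteq> 0}" for i j
  proof -
    have "continuous_on D (\<lambda>x. ?O i x - ?O j x)" by (intro continuous_on_diff holomorphic_on_imp_continuous_on holO)
    then have "open (D \<inter> (\<lambda>x. ?O i x - ?O j x) -` (- {0}))" using openD by (intro continuous_open_preimage) auto
    moreover have "D \<inter> (\<lambda>x. ?O i x - ?O j x) -` (- {0}) = {x \<in> D. ?O i x - ?O j x \<noteq> 0}" by auto
    ultimately show ?thesis by simp
  qed
  then have oDZ: "open (D - Z)" unfolding DZ by (intro open_Int)
  have conDZ: "connected (D - Z)"
    using path_connected_open_diff_countable[OF _ openD conn cZ] path_connected_imp_connected by simp
  obtain V where V: "open V" "t1 \<in> V" "\<forall>x\<in>V. all_attracted (G x) \<and> x \<in> D"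
    using eventually_conj[OF stab[OF t1] eventually_nhds_in_open[OF openD t1(1)]] unfolding eventually_nhds by blast
  \<comment> \<open>The starting parameter \<open>t1\<close> may itself lie in \<open>Z\<close>; the
    hyperbolic parameters around it form an uncountable set and so include one outside
    \<open>Z\<close>.\<close>
  have "\<not> V \<subseteq> Z" using uncountable_open[OF V(1,2)] cZ countable_subset by blast
  then obtain t2 where t2: "t2 \<in> V" "t2 \<notin> Z" by blast
  have good2: "orbits_bounded_near r w t2" using orbits_bounded_near_attracted[OF a] V(3) t2(1) by blast
  have t2D: "t2 \<in> D - Z" using V(3) t2 by blast
  have goodDZ: "orbits_bounded_near r w y" if y: "y \<in> D - Z" for y
  proof (rule connected_induction_simple[where P = "orbits_bounded_near r w", OF conDZ t2D y good2])
    fix c assume "c \<in> D - Z"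
    then obtain \<rho> where \<rho>: "\<rho> > 0" "cball c \<rho> \<subseteq> D - Z" using oDZ open_contains_cball by metis
    have sp: "orbits_bounded_near r w y" if "x \<in> ball c \<rho>" "y \<in> ball c \<rho>" "orbits_bounded_near r w x" for x y
    proof (rule orbits_bounded_spread[OF a _ _ that(1,3,2)])
      show "?O i x \<noteq> ?O j x" if "x \<in> cball c \<rho>" "i < j" "j < 3" for x i j using notZ \<rho>(2) that by blast
    qed (use \<rho> in blast)
    show "\<exists>T. openin (top_of_set (D - Z)) T \<and> c \<in> T \<and> (\<forall>x\<in>T. \<forall>y\<in>T. orbits_bounded_near r w x \<longrightarrow> orbits_bounded_near r w y)"
    proof (rule exI[of _ "ball c \<rho>"], intro conjI)
      show "openin (top_of_set (D - Z)) (ball c \<rho>)"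
        using \<rho>(2) ball_subset_cball[of c \<rho>] by (intro open_subset) blast+
      show "c \<in> ball c \<rho>" using \<rho>(1) by simp
      show "\<forall>x\<in>ball c \<rho>. \<forall>y\<in>ball c \<rho>. orbits_bounded_near r w x \<longrightarrow> orbits_bounded_near r w y" using sp by blast
    qed
  qed
  have good: "orbits_bounded_near r w y" if y: "y \<in> D" for y
  proof (cases "y \<in> Z")
    case False then show ?thesis using goodDZ y by blast
  next
    case True
    have "\<exists>\<rho>>0. \<forall>x\<in>ball y \<rho> - {y}. ?O i x \<noteq> ?O j x" if ij: "i < j" "j < 3" for i j
    proof (cases "?O i y = ?O j y")
      case True
      obtain \<beta> where \<beta>: "\<beta> \<in> D" "?O i \<beta> \<noteq> ?O j \<beta>" using distinct[OF ij] by blast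
      have h: "(\<lambda>x. ?O i x - ?O j x) holomorphic_on D" by (intro holomorphic_intros holO)
      show ?thesis
      proof (rule isolated_zeros[OF h openD conn y _ \<beta>(1)])
        fix \<rho> assume \<rho>: "0 < \<rho>" "\<And>z. z \<in> ball y \<rho> - {y} \<Longrightarrow> ?O i z - ?O j z \<noteq> 0"
        have "?O i z \<noteq> ?O j z" if "z \<in> ball y \<rho> - {y}" for z using \<rho>(2)[OF that] by simp
        then show ?thesis using \<rho>(1) by blast
      qed (use True \<beta>(2) in simp_all)
    next
      case False
      have o: "open {x \<in> D. ?O i x - ?O j x \<noteq> 0}" by fact
      have yin: "y \<in> {x \<in> D. ?O i x - ?O j x \<noteq> 0}" using False y by simp
      obtain \<rho> where \<rho>: "\<rho> > 0" "ball y \<rho> \<subseteq> {x \<in> D. ?O i x - ?O j x \<noteq> 0}"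
        using open_contains_ball[THEN iffD1, rule_format, OF o yin] by blast
      have "?O i z \<noteq> ?O j z" if "z \<in> ball y \<rho> - {y}" for z
      proof -
        have "z \<in> {x \<in> D. ?O i x - ?O j x \<noteq> 0}" using \<rho>(2) that by blast
        then show ?thesis by simp
      qed
      then show ?thesis using \<rho>(1) by blast
    qed
    then obtain \<rho>' where \<rho>': "\<And>i j. i < j \<Longrightarrow> j < 3 \<Longrightarrow> \<rho>' i j > (0::real)"
        "\<And>i j x. i < j \<Longrightarrow> j < 3 \<Longrightarrow> x \<in> ball y (\<rho>' i j) - {y} \<Longrightarrow> ?O i x \<noteq> ?O j x" by metis
    obtain \<rho>0 where \<rho>0: "\<rho>0 > 0" "cball y \<rho>0 \<subseteq> D" using openD y open_contains_cball by metis
    \<comment> \<open>Halved radii place the circle strictly inside the punctured balls without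
      coincidences; the maximum principle then carries the bound to its interior.\<close>
    define \<rho> where "\<rho> = Min {\<rho>0, \<rho>' 0 1 / 2, \<rho>' 0 2 / 2, \<rho>' 1 2 / 2}"
    have \<rho>: "\<rho> > 0" "\<rho> \<le> \<rho>0" "\<rho> < \<rho>' 0 1" "\<rho> < \<rho>' 0 2" "\<rho> < \<rho>' 1 2"
      using \<rho>0(1) \<rho>'(1)[of 0 1] \<rho>'(1)[of 0 2] \<rho>'(1)[of 1 2] by (auto simp: \<rho>_def min_def)
    have cD: "cball y \<rho> \<subseteq> D" using \<rho>0(2) \<rho>(2) by (meson order_trans subset_cball)
    have sph: "sphere y \<rho> \<subseteq> D - Z"
    proof
      fix x assume x: "x \<in> sphere y \<rho>"
      then have "x \<in> ball y (\<rho>' 0 1) - {y}" "x \<in> ball y (\<rho>' 0 2) - {y}" "x \<in> ball y (\<rho>' 1 2) - {y}"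
        using \<rho> by auto
      then have "?O 0 x \<noteq> ?O 1 x" "?O 0 x \<noteq> ?O 2 x" "?O 1 x \<noteq> ?O 2 x"
        using \<rho>'(2)[of 0 1 x] \<rho>'(2)[of 0 2 x] \<rho>'(2)[of 1 2 x] by simp_all
      moreover have "x \<in> D" using x cD sphere_cball by blast
      ultimately show "x \<in> D - Z" unfolding DZ by simp
    qed
    have "\<exists>M. \<forall>\<^sub>F j in sequentially. \<forall>x\<in>sphere y \<rho>. \<forall>k. norm (?o j k x) \<le> M"
    proof (rule eventually_on_compact[OF compact_sphere])
      fix x assume "x \<in> sphere y \<rho>"
      then have "orbits_bounded_near r w x" using goodDZ sph by blast
      then show "\<exists>U. open U \<and> x \<in> U \<and> (\<exists>M. \<forall>\<^sub>F j in sequentially. \<forall>x\<in>U. \<forall>k. norm (?o j k x) \<le> M)"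
        unfolding orbits_bounded_near_def .
    qed (meson order_trans)
    then obtain M where M: "\<forall>\<^sub>F j in sequentially. \<forall>x\<in>sphere y \<rho>. \<forall>k. norm (?o j k x) \<le> M" by blast
    then have "\<forall>\<^sub>F j in sequentially. \<forall>x\<in>ball y \<rho>. \<forall>k. norm (?o j k x) \<le> M"
    proof eventually_elim
      case (elim j)
      show ?case
      proof (intro ballI allI)
        fix x k assume x: "x \<in> ball y \<rho>"
        have hol: "?o j k holomorphic_on D" by (rule orbit_holomorphic[OF sels])
        show "norm (?o j k x) \<le> M"
        proof (rule maximum_modulus_frontier[of "?o j k" "ball y \<rho>"])
          show "?o j k holomorphic_on interior (ball y \<rho>)" using hol cD
            by (metis ball_subset_cball holomorphic_on_subset interior_subset order_trans)
          show "continuous_on (closure (ball y \<rho>)) (?o j k)"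
            using holomorphic_on_imp_continuous_on[OF hol] cD \<rho>(1) continuous_on_subset by (metis closure_ball)
          show "norm (?o j k z) \<le> M" if "z \<in> frontier (ball y \<rho>)" for z
            using that elim \<rho>(1) by (auto simp: frontier_ball)
        qed (use x in auto)
      qed
    qed
    then show ?thesis unfolding orbits_bounded_near_def using \<rho>(1) by (intro exI[of _ "ball y \<rho>"]) auto
  qed
  have "\<exists>M. \<forall>\<^sub>F j in sequentially. \<forall>x\<in>K. \<forall>k. norm (?O k x) \<le> M"
  proof (rule eventually_on_compact[OF K(1)])
    fix x assume "x \<in> K"
    then have x: "x \<in> D" using K(2) by blast
    obtain U M where U: "open U" "x \<in> U" "\<forall>\<^sub>F j in sequentially. \<forall>x\<in>U. \<forall>k. norm (?o j k x) \<le> M"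
      using good[OF x] unfolding orbits_bounded_near_def by blast
    have "norm (?O k z) \<le> M" if z: "z \<in> U \<inter> D" for z k
    proof (rule tendsto_upperbound)
      have "uniform_limit {z} (\<lambda>j t. ?o j k t) (?O k) sequentially"
        by (rule approx_orbit_uniform_limit[OF a]) (use z in auto)
      then have "(\<lambda>j. ?o j k z) \<longlonglongrightarrow> ?O k z" by (rule tendsto_uniform_limitI) simp
      then show "(\<lambda>j. norm (?o j k z)) \<longlonglongrightarrow> norm (?O k z)" by (rule tendsto_norm)
      show "\<forall>\<^sub>F j in sequentially. norm (?o j k z) \<le> M" using U(3) by (rule eventually_mono) (use z in blast)
    qed simp
    then show "\<exists>U. open U \<and> x \<in> U \<and> (\<exists>M. \<forall>\<^sub>F j in sequentially. \<forall>x\<in>U. \<forall>k. norm (?O k x) \<le> M)"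
      using U(1,2) x openD by (intro exI[of _ "U \<inter> D"] conjI exI[of _ M] always_eventually allI) auto
  qed (meson order_trans)
  then show ?thesis by auto
qed

end

section \<open>Persistence of attracting cycles\<close>

context limit_family
begin

lemma limit_tendsto_nhds:
  assumes "v holomorphic_on D" "t \<in> D" shows "(v \<longlongrightarrow> v t) (nhds t)"
proof -
  have "isCont v t" using holomorphic_on_imp_continuous_on[OF assms(1)] openD assms(2) by (simp add: continuous_on_eq_continuous_at)
  then show ?thesis unfolding isCont_def by (rule tendsto_at_iff_tendsto_nhds[THEN iffD1])
qed

lemma luc_tendsto_limit_family: "t \<in> D \<Longrightarrow> luc_tendsto G (G t) (nhds t)"
  using famG by (simp add: hol_family_def)

lemma eventually_holG: "t \<in> D \<Longrightarrow> \<forall>\<^sub>F y in nhds t. G y holomorphic_on UNIV"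
  by (rule hol_family_eventually_holomorphic[OF famG _ filterlim_ident])

lemma limit_attr_stable:
  assumes v: "v holomorphic_on D" and t: "t \<in> D" and at: "attr_to (G t) p (v t) c"
  obtains V where "open V" "t \<in> V" "V \<subseteq> D" "\<And>y. y \<in> V \<Longrightarrow> \<exists>b. attr_to (G y) p (v y) b"
proof -
  obtain M where "\<forall>\<^sub>F y in nhds t. (\<exists>b\<in>ball c 1. attr_to (G y) p (v y) b) \<and> (\<forall>m. norm ((G y ^^ m) (v y)) \<le> M)"
    by (rule attr_to_stable[OF holG[OF t] at luc_tendsto_limit_family[OF t] eventually_holG[OF t] limit_tendsto_nhds[OF v t] zero_less_one])
  then have "\<forall>\<^sub>F y in nhds t. (\<exists>b. attr_to (G y) p (v y) b) \<and> y \<in> D"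
    using eventually_nhds_in_open[OF openD t] by eventually_elim blast
  then obtain V where "open V" "t \<in> V" "\<forall>y\<in>V. (\<exists>b. attr_to (G y) p (v y) b) \<and> y \<in> D"
    unfolding eventually_nhds by blast
  then show ?thesis using that by blast
qed

text \<open>A limit cycle that stopped being attracting would be repelling somewhere, hence hit exactly
  by the orbits converging to it, for uncountably many parameters and so identically.\<close>

lemma persistent_attraction:
  assumes v: "v holomorphic_on D"
    and bd: "\<And>K. compact K \<Longrightarrow> K \<subseteq> D \<Longrightarrow> \<exists>B. \<forall>k. \<forall>x\<in>K. norm ((G x ^^ k) (v x)) \<le> B"
    and free: "\<And>i k. i < k \<Longrightarrow> \<exists>x\<in>D. (G x ^^ i) (v x) \<noteq> (G x ^^ k) (v x)"
    and V: "open V" "V \<noteq> {}" "V \<subseteq> D" and p: "p > 0"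
    and lim0: "\<And>x. x \<in> V \<Longrightarrow> (\<lambda>m. (G x ^^ (l + p * m)) (v x)) \<longlonglongrightarrow> A0 x"
    and attr0: "\<And>x. x \<in> V \<Longrightarrow> norm (deriv (G x ^^ p) (A0 x)) < 1"
  obtains A where "A holomorphic_on D" "\<And>x. x \<in> V \<Longrightarrow> A x = A0 x"
    "\<And>x. x \<in> D \<Longrightarrow> (\<lambda>m. (G x ^^ (l + p * m)) (v x)) \<longlonglongrightarrow> A x"
    "\<And>x. x \<in> D \<Longrightarrow> (G x ^^ p) (A x) = A x" "\<And>x. x \<in> D \<Longrightarrow> norm (deriv (G x ^^ p) (A x)) < 1"
proof -
  define \<phi> where "\<phi> m x = (G x ^^ (l + p * m)) (v x)" for m x
  have hol\<phi>: "\<phi> m holomorphic_on D" for m unfolding \<phi>_def by (rule limit_orbit_holomorphic[OF v])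
  have bd\<phi>: "\<exists>B. \<forall>m. \<forall>x\<in>K. norm (\<phi> m x) \<le> B" if "compact K" "K \<subseteq> D" for K
    using bd[OF that] unfolding \<phi>_def by blast
  have lim\<phi>: "(\<lambda>m. \<phi> m x) \<longlonglongrightarrow> A0 x" if "x \<in> V" for x using lim0[OF that] by (simp add: \<phi>_def)
  obtain A where A: "A holomorphic_on D" "\<And>x. x \<in> D \<Longrightarrow> (\<lambda>m. \<phi> m x) \<longlonglongrightarrow> A x" "\<And>x. x \<in> V \<Longrightarrow> A x = A0 x"
    using vitali_convergence[OF openD conn hol\<phi> bd\<phi> V lim\<phi>] by metis
  have \<phi>Suc: "\<phi> (Suc m) x = (G x ^^ p) (\<phi> m x)" for m x
  proof -
    have "l + p * Suc m = p + (l + p * m)" by simp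
    then show ?thesis unfolding \<phi>_def by (simp only: funpow_add comp_apply)
  qed
  have fixA: "(G x ^^ p) (A x) = A x" if x: "x \<in> D" for x
  proof (rule LIMSEQ_unique)
    have "(\<lambda>m. (G x ^^ p) (\<phi> m x)) \<longlonglongrightarrow> (G x ^^ p) (A x)"
      by (rule tendsto_funpow[OF holomorphic_on_imp_continuous_on[OF holG[OF x]] A(2)[OF x]])
    then show "(\<lambda>m. \<phi> (Suc m) x) \<longlonglongrightarrow> (G x ^^ p) (A x)" by (simp add: \<phi>Suc)
    show "(\<lambda>m. \<phi> (Suc m) x) \<longlonglongrightarrow> A x" by (rule LIMSEQ_Suc[OF A(2)[OF x]])
  qed
  define \<mu> where "\<mu> x = deriv (G x ^^ p) (A x)" for x
  have famp: "hol_family D (\<lambda>x. G x ^^ p)" by (rule hol_family_funpow[OF famG])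
  have hol\<mu>: "\<mu> holomorphic_on D" unfolding \<mu>_def by (rule hol_family_deriv_compose[OF famp A(1)])
  obtain x0 where x0: "x0 \<in> V" using V(2) by blast
  have "norm (\<mu> t) < 1" if t: "t \<in> D" for t
  proof (rule ccontr)
    assume nt: "\<not> norm (\<mu> t) < 1"
    \<comment> \<open>Modulus at least 1 at \<open>t\<close> and below 1 on \<open>V\<close> exclude
      a constant multiplier, so by the maximum principle the modulus exceeds 1 somewhere.\<close>
    have "\<exists>t2\<in>D. 1 < norm (\<mu> t2)"
    proof (rule ccontr)
      assume "\<not> ?thesis"
      then have le: "\<And>z. z \<in> D \<Longrightarrow> norm (\<mu> z) \<le> norm (\<mu> t)" using nt by (meson not_le order_trans)
      have "\<mu> constant_on D" by (rule maximum_modulus_principle[OF hol\<mu> openD conn openD subset_refl t le])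
      then have "\<mu> x0 = \<mu> t" using x0 V(3) t unfolding constant_on_def by (metis subsetD)
      then show False using nt attr0[OF x0] A(3)[OF x0] by (simp add: \<mu>_def)
    qed
    then obtain t2 where t2: "t2 \<in> D" "1 < norm (\<mu> t2)" by blast
    \<comment> \<open>With an error \<open>\<eta>\<close> in the derivative the expansion factor is
      still at least \<open>norm (\<mu> t2) - \<eta> = 1\<close>. Not shrinking is enough: an orbit
      that never meets \<open>A x\<close> then cannot converge to it.\<close>
    define \<eta> where "\<eta> = norm (\<mu> t2) - 1"
    have "\<eta> > 0" using t2 by (simp add: \<eta>_def)
    then obtain d where d: "d > 0" "\<And>x z. dist x t2 < d \<Longrightarrow> dist z (A t2) < d \<Longrightarrow> x \<in> D \<and> norm (deriv (G x ^^ p) z - \<mu> t2) < \<eta>"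
      using hol_family_deriv_near[OF famp t2(1), of \<eta> "A t2"] unfolding \<mu>_def by metis
    have d2: "d / 2 > 0" using d(1) by simp
    have "\<forall>\<^sub>F x in nhds t2. dist (A x) (A t2) < d/2" using limit_tendsto_nhds[OF A(1) t2(1)] d2 by (rule tendstoD)
    moreover have "\<forall>\<^sub>F x in nhds t2. x \<in> ball t2 d" using d(1) by (intro eventually_nhds_in_open) auto
    ultimately have "\<forall>\<^sub>F x in nhds t2. dist (A x) (A t2) < d/2 \<and> x \<in> ball t2 d" by (rule eventually_conj)
    then obtain N where N: "open N" "t2 \<in> N" "\<forall>x\<in>N. dist (A x) (A t2) < d/2 \<and> x \<in> ball t2 d"
      unfolding eventually_nhds by blast
    have hit: "\<exists>m. \<phi> m x = A x" if x: "x \<in> N" for x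
    proof (rule ccontr)
      assume no: "\<not> ?thesis"
      have dx: "dist x t2 < d" "dist (A x) (A t2) < d/2" using N(3) x by (auto simp: dist_commute)
      have xD: "x \<in> D" using d(2)[OF dx(1), of "A t2"] d(1) by simp
      obtain M where M: "\<And>m. m \<ge> M \<Longrightarrow> dist (\<phi> m x) (A x) < d/2"
        using tendstoD[OF A(2)[OF xD] d2] unfolding eventually_sequentially by blast
      have step: "norm (\<phi> m x - A x) \<le> norm (\<phi> (Suc m) x - A x)" if m: "m \<ge> M" for m
      proof -
        have "dist (\<phi> m x) (A t2) < d" using dist_triangle[of "\<phi> m x" "A t2" "A x"] M[OF m] dx(2) by linarith
        then have in1: "\<phi> m x \<in> ball (A t2) d" by (simp add: dist_commute)
        have in2: "A x \<in> ball (A t2) d" using dx(2) d(1) by (simp add: dist_commute)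
        have "norm (((G x ^^ p) (\<phi> m x) - (G x ^^ p) (A x)) - \<mu> t2 * (\<phi> m x - A x)) \<le> \<eta> * norm (\<phi> m x - A x)"
        proof (rule linear_approx_bound[OF convex_ball in1 in2 holomorphic_on_funpow[OF holG[OF xD]]])
          fix z assume "z \<in> ball (A t2) d"
          then show "norm (deriv (G x ^^ p) z - \<mu> t2) \<le> \<eta>" using d(2)[OF dx(1), of z] by (simp add: dist_commute)
        qed
        then have "norm ((\<phi> (Suc m) x - A x) - \<mu> t2 * (\<phi> m x - A x)) \<le> \<eta> * norm (\<phi> m x - A x)"
          by (simp add: \<phi>Suc fixA[OF xD])
        then have "norm (\<mu> t2 * (\<phi> m x - A x)) \<le> norm (\<phi> (Suc m) x - A x) + \<eta> * norm (\<phi> m x - A x)"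
          using norm_triangle_sub[of "\<mu> t2 * (\<phi> m x - A x)" "\<phi> (Suc m) x - A x"] by (simp add: norm_minus_commute)
        then have "norm (\<mu> t2) * norm (\<phi> m x - A x) \<le> norm (\<phi> (Suc m) x - A x) + (norm (\<mu> t2) - 1) * norm (\<phi> m x - A x)"
          by (simp add: norm_mult \<eta>_def)
        then show ?thesis by (simp add: algebra_simps)
      qed
      have far: "norm (\<phi> M x - A x) \<le> norm (\<phi> (M + n) x - A x)" for n
      proof (induction n)
        case (Suc n)
        then show ?case using step[of "M + n"] by simp
      qed simp
      have "norm (\<phi> M x - A x) > 0" using no by simp
      then obtain M' where M': "\<And>m. m \<ge> M' \<Longrightarrow> dist (\<phi> m x) (A x) < norm (\<phi> M x - A x)"
        using tendstoD[OF A(2)[OF xD]] unfolding eventually_sequentially by blast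
      show False using M'[of "M + M'"] far[of M'] by (simp add: dist_norm)
    qed
    have ND: "N \<subseteq> D" using N(3) d(2)[of _ "A t2"] d(1) by (auto simp: dist_commute)
    \<comment> \<open>An open set of parameters is covered by countably many coincidence sets, so
      one of them is uncountable and that coincidence is identical; the orbit would then be periodic
      from there on for every parameter, against \<open>free\<close>.\<close>
    have "\<exists>m. uncountable {x \<in> D. \<phi> m x - A x = 0}"
    proof (rule ccontr)
      assume "\<not> ?thesis"
      then have "countable (\<Union>m. {x \<in> D. \<phi> m x - A x = 0})" by (intro countable_UN) auto
      moreover have "N \<subseteq> (\<Union>m. {x \<in> D. \<phi> m x - A x = 0})" using hit ND by fastforce
      ultimately show False using uncountable_open[OF N(1,2)] countable_subset by blast
    qed
    then obtain m where m: "uncountable {x \<in> D. \<phi> m x - A x = 0}" by blast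
    have h: "(\<lambda>x. \<phi> m x - A x) holomorphic_on D" by (intro holomorphic_intros hol\<phi> A(1))
    have all: "\<phi> m x = A x" if "x \<in> D" for x
      using holomorphic_zero_or_countable[OF h openD conn that] m by auto
    have "\<exists>x\<in>D. (G x ^^ (l + p * m)) (v x) \<noteq> (G x ^^ (l + p * Suc m)) (v x)" by (rule free) (use p in simp)
    then obtain x where x: "x \<in> D" "\<phi> m x \<noteq> \<phi> (Suc m) x" unfolding \<phi>_def by blast
    then show False using all[OF x(1)] fixA[OF x(1)] by (simp add: \<phi>Suc)
  qed
  then show ?thesis using that[OF A(1,3)] A(2) fixA unfolding \<mu>_def \<phi>_def by blast
qed

theorem all_attracted_limit:
  assumes t1: "t1 \<in> D" "all_attracted (G t1)" and t: "t \<in> D"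
  shows "all_attracted (G t)"
  unfolding all_attracted_def
proof
  fix s assume "s \<in> sing_vals (G t)"
  then obtain r w v where a: "approx_by r w v" and vt: "v t = s" using approx_exists[OF t] by blast
  have v: "v holomorphic_on D" using a by (simp add: approx_by_def)
  obtain p c where pc: "attr_to (G t1) p (v t1) c" using t1(2) approx_in[OF a t1(1)] unfolding all_attracted_def by blast
  show "\<exists>p a. attr_to (G t) p s a"
  proof (cases "\<exists>i k. i < k \<and> (\<forall>x\<in>D. (G x ^^ i) (v x) = (G x ^^ k) (v x))")
    case False
    then have free: "\<exists>x\<in>D. (G x ^^ i) (v x) \<noteq> (G x ^^ k) (v x)" if "i < k" for i k using that by blast
    obtain V where V: "open V" "t1 \<in> V" "V \<subseteq> D" "\<And>y. y \<in> V \<Longrightarrow> \<exists>b. attr_to (G y) p (v y) b"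
      using limit_attr_stable[OF v t1(1) pc] by blast
    then obtain A0 where A0: "\<And>y. y \<in> V \<Longrightarrow> attr_to (G y) p (v y) (A0 y)" by metis
    have ne: "V \<noteq> {}" using V(2) by blast
    have bd: "\<exists>B. \<forall>k. \<forall>x\<in>K. norm ((G x ^^ k) (v x)) \<le> B" if "compact K" "K \<subseteq> D" for K
      by (rule limit_orbits_bounded[OF a t1 free that])
    have l0: "(\<lambda>m. (G x ^^ (0 + p * m)) (v x)) \<longlonglongrightarrow> A0 x" and n0: "norm (deriv (G x ^^ p) (A0 x)) < 1" if "x \<in> V" for x
      using A0[OF that] by (auto simp: attr_to_def)
    obtain A where "\<And>x. x \<in> D \<Longrightarrow> (\<lambda>m. (G x ^^ (0 + p * m)) (v x)) \<longlonglongrightarrow> A x"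
        "\<And>x. x \<in> D \<Longrightarrow> (G x ^^ p) (A x) = A x" "\<And>x. x \<in> D \<Longrightarrow> norm (deriv (G x ^^ p) (A x)) < 1"
      by (rule persistent_attraction[OF v bd free V(1) ne V(3) attr_to_pos[OF pc] l0 n0]) (assumption | rule that)+
    then have "attr_to (G t) p s (A t)" using t vt unfolding attr_to_def by force
    then show ?thesis by blast
  next
    \<comment> \<open>The orbit of \<open>v\<close> is eventually periodic for all parameters, with
      cycle point \<open>A\<close>. Such an orbit does not detect whether the cycle attracts, so the
      multiplier has to be controlled through another singular value.\<close>
    case True
    then obtain i k where ik: "i < k" "\<And>x. x \<in> D \<Longrightarrow> (G x ^^ i) (v x) = (G x ^^ k) (v x)" by blast
    define q where "q = k - i"
    have q: "q > 0" "k = q + i" using ik(1) by (auto simp: q_def)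
    define A where "A x = (G x ^^ i) (v x)" for x
    have A: "A holomorphic_on D" unfolding A_def by (rule limit_orbit_holomorphic[OF v])
    have fixA: "(G x ^^ q) (A x) = A x" if "x \<in> D" for x
      using ik(2)[OF that] by (simp add: A_def q(2) funpow_add)
    define \<mu> where "\<mu> x = deriv (G x ^^ q) (A x)" for x
    have hol\<mu>: "\<mu> holomorphic_on D"
      unfolding \<mu>_def by (rule hol_family_deriv_compose[OF hol_family_funpow[OF famG] A])
    have attrA: "norm (\<mu> x) < 1" if x: "x \<in> D" "all_attracted (G x)" for x
    proof -
      obtain p' c' where "attr_to (G x) p' (v x) c'" using x(2) approx_in[OF a x(1)] unfolding all_attracted_def by blast
      then have "attr_to (G x) (k - i) (v x) c'" using attr_to_of_repeat[OF holG[OF x(1)] _ ik(2)[OF x(1)] ik(1)] by blast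
      then have "attr_to (G x) q (A x) ((G x ^^ i) c')" unfolding q_def A_def by (rule attr_to_image[OF holG[OF x(1)]])
      moreover from this have "(\<lambda>m. (G x ^^ (q * m)) (A x)) \<longlonglongrightarrow> (G x ^^ i) c'" by (simp add: attr_to_def)
      then have "(G x ^^ i) c' = A x" using funpow_fixed[OF fixA[OF x(1)]] by (simp add: LIMSEQ_const_iff)
      ultimately show ?thesis by (simp add: attr_to_def \<mu>_def)
    qed
    have "norm (\<mu> t) < 1"
    proof (cases "\<forall>x\<in>D. \<mu> x = 0")
      case True then show ?thesis using t by simp
    next
      case False
      then obtain \<xi> where "\<xi> \<in> D" "\<mu> \<xi> \<noteq> 0" by blast
      then have cz: "countable {x \<in> D. \<mu> x = 0}" by (rule holomorphic_zero_or_countable[OF hol\<mu> openD conn])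
      obtain V1 where V1: "open V1" "t1 \<in> V1" "\<forall>x\<in>V1. all_attracted (G x) \<and> x \<in> D"
        using eventually_conj[OF stab[OF t1] eventually_nhds_in_open[OF openD t1(1)]] unfolding eventually_nhds by blast
      \<comment> \<open>A hyperbolic parameter with nonzero multiplier is wanted, since there the
        cycle attracts a singular value with infinite orbit.\<close>
      have "\<not> V1 \<subseteq> {x \<in> D. \<mu> x = 0}" using uncountable_open[OF V1(1,2)] cz countable_subset by blast
      then obtain t' where t': "t' \<in> D" "all_attracted (G t')" "\<mu> t' \<noteq> 0" using V1(3) by blast
      obtain s' l where s': "s' \<in> sing_vals (G t')" "(\<lambda>m. (G t' ^^ (l + q * m)) s') \<longlonglongrightarrow> A t'"
          "\<And>i j. (G t' ^^ i) s' = (G t' ^^ j) s' \<Longrightarrow> i = j"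
        using attracting_point_attracts_singular[OF HolG'[OF t'(1)] fixA[OF t'(1)]] t'(3) attrA[OF t'(1,2)]
        unfolding \<mu>_def by blast
      obtain r' w' u where u: "approx_by r' w' u" "u t' = s'" using approx_exists[OF t'(1) s'(1)] by blast
      have holu: "u holomorphic_on D" using u(1) by (simp add: approx_by_def)
      have free: "\<exists>x\<in>D. (G x ^^ i) (u x) \<noteq> (G x ^^ k) (u x)" if "i < k" for i k
        using s'(3)[of i k] t'(1) that u(2) by (intro bexI[of _ t']) auto
      have bd: "\<exists>B. \<forall>k. \<forall>x\<in>K. norm ((G x ^^ k) (u x)) \<le> B" if "compact K" "K \<subseteq> D" for K
        by (rule limit_orbits_bounded[OF u(1) t1 free that])
      \<comment> \<open>One trap around \<open>A t'\<close> contains both the cycle point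
        \<open>A x\<close> and a late orbit point of \<open>u x\<close> for all \<open>x\<close>
        near \<open>t'\<close>. All points of a trap share their limit, so the orbit of
        \<open>u x\<close> tends to \<open>A x\<close>.\<close>
      obtain \<rho> e where tr: "0 < \<rho>" "\<forall>\<^sub>F x in nhds t'. trap (G x) q (A t') \<rho> e"
        using eventually_trap[OF holG[OF t'(1)] fixA[OF t'(1)] _ luc_tendsto_limit_family[OF t'(1)] eventually_holG[OF t'(1)] zero_less_one]
          attrA[OF t'(1,2)] unfolding \<mu>_def by blast
      obtain N where N: "dist ((G t' ^^ (l + q * N)) s') (A t') < \<rho>"
        using tendstoD[OF s'(2) tr(1)] unfolding eventually_sequentially by blast
      have limN: "((\<lambda>x. (G x ^^ (l + q * N)) (u x)) \<longlongrightarrow> (G t' ^^ (l + q * N)) s') (nhds t')"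
        using limit_tendsto_nhds[OF limit_orbit_holomorphic[OF holu] t'(1)] u(2) by metis
      have 1: "\<forall>\<^sub>F x in nhds t'. dist ((G x ^^ (l + q * N)) (u x)) (A t') < \<rho>"
        using tendsto_dist[OF limN tendsto_const] N by (rule order_tendstoD)
      have 2: "\<forall>\<^sub>F x in nhds t'. dist (A x) (A t') < \<rho>" using limit_tendsto_nhds[OF A t'(1)] tr(1) by (rule tendstoD)
      have "\<forall>\<^sub>F x in nhds t'. x \<in> D \<and> (\<lambda>m. (G x ^^ (l + q * m)) (u x)) \<longlonglongrightarrow> A x \<and> norm (deriv (G x ^^ q) (A x)) < 1"
        using 1 2 tr(2) eventually_nhds_in_open[OF openD t'(1)]
      proof eventually_elim
        case (elim x)
        obtain b where b: "\<And>z. z \<in> cball (A t') \<rho> \<Longrightarrow> attr_to (G x) q z b" using trap_attr_to[OF holG[OF elim(4)] elim(3)] by metis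
        have Ax: "attr_to (G x) q (A x) b" using elim(2) by (intro b) (simp add: dist_commute)
        then have "(\<lambda>m. (G x ^^ (q * m)) (A x)) \<longlonglongrightarrow> b" by (simp add: attr_to_def)
        then have bA: "b = A x" using funpow_fixed[OF fixA[OF elim(4)]] by (simp add: LIMSEQ_const_iff)
        have "attr_to (G x) q ((G x ^^ (l + q * N)) (u x)) b" using elim(1) by (intro b) (simp add: dist_commute)
        then have "(\<lambda>m. (G x ^^ (q * m)) ((G x ^^ (l + q * N)) (u x))) \<longlonglongrightarrow> A x" by (simp add: attr_to_def bA)
        moreover have "(G x ^^ (q * m)) ((G x ^^ (l + q * N)) (u x)) = (G x ^^ (l + q * (m + N))) (u x)" for m
        proof -
          have eq: "l + q * (m + N) = q * m + (l + q * N)" by (simp add: algebra_simps)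
          show ?thesis unfolding eq by (subst funpow_add) simp
        qed
        ultimately have "(\<lambda>m. (G x ^^ (l + q * (m + N))) (u x)) \<longlonglongrightarrow> A x" by simp
        then have "(\<lambda>m. (G x ^^ (l + q * m)) (u x)) \<longlonglongrightarrow> A x" by (rule LIMSEQ_offset)
        then show ?case using Ax bA elim(4) by (simp add: attr_to_def)
      qed
      then obtain V where V: "open V" "t' \<in> V"
        "\<forall>x\<in>V. x \<in> D \<and> (\<lambda>m. (G x ^^ (l + q * m)) (u x)) \<longlonglongrightarrow> A x \<and> norm (deriv (G x ^^ q) (A x)) < 1"
        unfolding eventually_nhds by blast
      have V': "V \<noteq> {}" "V \<subseteq> D" using V by auto
      have lA: "(\<lambda>m. (G x ^^ (l + q * m)) (u x)) \<longlonglongrightarrow> A x" and nA: "norm (deriv (G x ^^ q) (A x)) < 1"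
        if "x \<in> V" for x using V(3) that by blast+
      obtain A' where A': "A' holomorphic_on D" "\<And>x. x \<in> V \<Longrightarrow> A' x = A x"
          "\<And>x. x \<in> D \<Longrightarrow> norm (deriv (G x ^^ q) (A' x)) < 1"
        by (rule persistent_attraction[OF holu bd free V(1) V' q(1) lA nA]) (assumption | rule that)+
      \<comment> \<open>The limit of the second singular orbit continues the cycle point from
        \<open>V\<close> to all of \<open>D\<close>, so its attracting multiplier is that of the
        original cycle.\<close>
      have "A' t = A t"
        by (rule analytic_continuation_open[OF V(1) openD V'(1) conn V'(2) A'(1) A A'(2) t])
      then show ?thesis using A'(3)[OF t] by (simp add: \<mu>_def)
    qed
    then have "attr_to (G t) q (A t) (A t)"
      using fixA[OF t] funpow_fixed[OF fixA[OF t]] by (simp add: attr_to_def \<mu>_def)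
    then have "attr_to (G t) q ((G t ^^ i) s) (A t)" by (simp add: A_def vt)
    then show ?thesis using attr_to_preimage[OF holG[OF t]] by blast
  qed
qed

end

section \<open>The metrics and the charts\<close>

lemma luc_metric_close:
  assumes d: "luc_metric d" and f: "f \<in> entire" and e: "e > 0"
  shows "\<exists>\<delta>>0. \<forall>g\<in>entire. d f g < \<delta> \<longrightarrow> (\<forall>z\<in>cball 0 R. dist (f z) (g z) < e)"
proof -
  interpret Metric_space entire d using d by (simp add: luc_metric_def)
  \<comment> \<open>Asking for a bound \<open>e' < e\<close> valid on the whole disc, rather than
    for strict inequality at each point, makes openness immediate: the gap \<open>e - e'\<close> is
    the room for perturbation.\<close>
  define U where "U = {g \<in> entire. \<exists>e'<e. \<forall>z\<in>cball 0 R. dist (f z) (g z) \<le> e'}"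
  have op: "openin mtopology \<U> \<longleftrightarrow> \<U> \<subseteq> entire \<and> (\<forall>f\<in>\<U>. \<exists>K \<epsilon>. compact K \<and> \<epsilon> > 0 \<and>
      {g \<in> entire. \<forall>z\<in>K. dist (f z) (g z) < \<epsilon>} \<subseteq> \<U>)" for \<U>
    using d unfolding luc_metric_def by blast
  have "openin mtopology U"
    unfolding op
  proof (intro conjI ballI)
    show "U \<subseteq> entire" by (auto simp: U_def)
    fix g assume "g \<in> U"
    then obtain e' where g: "g \<in> entire" "e' < e" "\<forall>z\<in>cball 0 R. dist (f z) (g z) \<le> e'" by (auto simp: U_def)
    have "{h \<in> entire. \<forall>z\<in>cball 0 R. dist (g z) (h z) < (e - e') / 2} \<subseteq> U"
    proof
      fix h assume h: "h \<in> {h \<in> entire. \<forall>z\<in>cball 0 R. dist (g z) (h z) < (e - e') / 2}"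
      have "dist (f z) (h z) \<le> (e + e') / 2" if z: "z \<in> cball 0 R" for z
      proof -
        have "dist (g z) (h z) < (e - e') / 2" "dist (f z) (g z) \<le> e'" using h g(3) z by blast+
        then show ?thesis using dist_triangle[of "f z" "h z" "g z"] by (simp add: field_simps)
      qed
      moreover have "(e + e') / 2 < e" using g(2) by simp
      ultimately show "h \<in> U" using h unfolding U_def by blast
    qed
    then show "\<exists>K \<epsilon>. compact K \<and> \<epsilon> > 0 \<and> {h \<in> entire. \<forall>z\<in>K. dist (g z) (h z) < \<epsilon>} \<subseteq> U"
      using g(2) by (intro exI[of _ "cball 0 R"] exI[of _ "(e - e') / 2"]) auto
  qed
  moreover have "f \<in> U" using f e by (auto simp: U_def intro!: exI[of _ 0])
  ultimately obtain \<delta> where \<delta>: "\<delta> > 0" "mball f \<delta> \<subseteq> U" unfolding openin_mtopology by blast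
  have "\<forall>z\<in>cball 0 R. dist (f z) (g z) < e" if g: "g \<in> entire" "d f g < \<delta>" for g
  proof -
    have "g \<in> U" using \<delta>(2) f g by (auto simp: in_mball)
    then show ?thesis unfolding U_def by fastforce
  qed
  then show ?thesis using \<delta>(1) by blast
qed

section \<open>Spherical distance and Hausdorff distance\<close>

lemma chordal_bound: "norm (z - w) \<le> sqrt (1 + norm z ^ 2) * sqrt (1 + norm (w::complex) ^ 2)"
proof -
  let ?a = "norm z" and ?b = "norm w"
  have "(?a + ?b) ^ 2 \<le> (1 + ?a ^ 2) * (1 + ?b ^ 2)"
  proof -
    have "(1 + ?a ^ 2) * (1 + ?b ^ 2) - (?a + ?b) ^ 2 = (1 - ?a * ?b) ^ 2" by (simp add: power2_eq_square algebra_simps)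
    then show ?thesis using zero_le_power2[of "1 - ?a * ?b"] by linarith
  qed
  then have "?a + ?b \<le> sqrt ((1 + ?a ^ 2) * (1 + ?b ^ 2))" by (rule real_le_rsqrt)
  then show ?thesis using norm_triangle_ineq4[of z w] by (simp add: real_sqrt_mult)
qed

lemma chordal_quotient:
  fixes z w :: complex
  defines "q \<equiv> norm (z - w) / (sqrt (1 + norm z ^ 2) * sqrt (1 + norm w ^ 2))"
  shows "0 \<le> q" "q \<le> 1"
proof -
  have "sqrt (1 + norm z ^ 2) * sqrt (1 + norm w ^ 2) > 0" by (intro mult_pos_pos) (auto intro: add_pos_nonneg)
  then show "0 \<le> q" "q \<le> 1" using chordal_bound[of z w] by (auto simp: q_def)
qed

text \<open>Spherical distances are at most \<open>pi\<close>, so 4 is an admissible radius in the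
  Hausdorff distance of nonempty sets.\<close>

lemma sph_dist_less_4: "sph_dist z w < 4"
proof -
  let ?q = "norm (z - w) / (sqrt (1 + norm z ^ 2) * sqrt (1 + norm w ^ 2))"
  have q: "-1 \<le> ?q" "?q \<le> 1" using chordal_quotient[of z w] by linarith+
  have "sph_dist z w \<le> 2 * (pi / 2)"
    unfolding sph_dist_def using arcsin_ubound[OF q] by (intro mult_left_mono) simp_all
  then show ?thesis using pi_less_4 by simp
qed

lemma sph_dist_commute: "sph_dist z w = sph_dist w z"
  by (simp add: sph_dist_def norm_minus_commute mult.commute)

text \<open>Half the spherical distance dominates the chordal quotient \<open>x / N\<close>, but
  \<open>N\<close> itself grows with the unknown distance \<open>x\<close>. The first term of the
  minimum lets that contribution be absorbed on the left, the second makes the remainder smaller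
  than \<open>e\<close>.\<close>

lemma sph_dist_imp_close:
  assumes R: "R > 0" and e: "e > 0" and z: "norm z \<le> R"
    and s: "sph_dist z w < min (1 / (1 + R)) (e / (1 + R) ^ 2)"
  shows "dist z w < e"
proof -
  define x where "x = norm (z - w)"
  define N where "N = sqrt (1 + norm z ^ 2) * sqrt (1 + norm w ^ 2)"
  have N: "N > 0" unfolding N_def by (intro mult_pos_pos) (auto intro: add_pos_nonneg)
  have sq: "sqrt (1 + t ^ 2) \<le> 1 + t" if "t \<ge> 0" for t :: real
    using that by (intro real_le_lsqrt) (auto simp: power2_eq_square algebra_simps)
  have q: "0 \<le> x / N" "x / N \<le> 1" using chordal_quotient[of z w] by (auto simp: x_def N_def)
  have "x / N = sin (arcsin (x / N))" using q by simp
  also have "\<dots> \<le> arcsin (x / N)" using q arcsin_le_arcsin[of 0 "x / N"] by (intro sin_x_le_x) auto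
  finally have "2 * (x / N) \<le> sph_dist z w" by (simp add: sph_dist_def x_def N_def)
  then have xs: "2 * x \<le> sph_dist z w * N" using N by (simp add: field_simps)
  have "norm w \<le> R + x" using z norm_triangle_sub[of w z] by (simp add: x_def norm_minus_commute)
  then have "N \<le> (1 + R) * (1 + (R + x))"
    unfolding N_def using z R sq[of "norm z"] sq[of "norm w"] by (intro mult_mono) auto
  moreover have s0: "sph_dist z w \<ge> 0" using \<open>2 * (x / N) \<le> sph_dist z w\<close> q by linarith
  ultimately have "2 * x \<le> sph_dist z w * ((1 + R) * (1 + (R + x)))"
    using xs mult_left_mono[of N _ "sph_dist z w"] by (meson order_trans)
  then have main: "2 * x \<le> (sph_dist z w * (1 + R)) * (1 + R) + (sph_dist z w * (1 + R)) * x" by (simp add: algebra_simps)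
  have a1: "sph_dist z w * (1 + R) < 1" using s R by (simp add: field_simps)
  have "sph_dist z w < e / (1 + R) ^ 2" using s by simp
  then have "sph_dist z w * (1 + R) ^ 2 < e" using R by (simp add: pos_less_divide_eq)
  then have a2: "sph_dist z w * (1 + R) * (1 + R) < e" by (simp add: power2_eq_square mult.assoc)
  have "x \<ge> 0" by (simp add: x_def)
  then have "(sph_dist z w * (1 + R)) * x \<le> 1 * x" using a1 by (intro mult_right_mono) auto
  then have "x < e" using main a2 by linarith
  then show ?thesis by (simp add: x_def dist_norm)
qed

lemma Hausdorff_dist_set_nonempty:
  assumes "A \<noteq> {}" "B \<noteq> {}"
  shows "{\<epsilon>. \<epsilon> > 0 \<and> A \<subseteq> sph_nbhd \<epsilon> B \<and> B \<subseteq> sph_nbhd \<epsilon> A} \<noteq> {}"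
proof -
  have "(4::real) \<in> {\<epsilon>. \<epsilon> > 0 \<and> A \<subseteq> sph_nbhd \<epsilon> B \<and> B \<subseteq> sph_nbhd \<epsilon> A}"
    using assms sph_dist_less_4 by (auto simp: sph_nbhd_def)
  then show ?thesis by blast
qed

lemma Hausdorff_dist_nonneg: "A \<noteq> {} \<Longrightarrow> B \<noteq> {} \<Longrightarrow> Hausdorff_dist A B \<ge> 0"
  unfolding Hausdorff_dist_def using Hausdorff_dist_set_nonempty by (intro cInf_greatest) auto

text \<open>Boundedness of \<open>A\<close> turns spherical into Euclidean closeness with a single
  \<open>\<delta>\<close>, for arbitrary nonempty \<open>B\<close>.\<close>

lemma Hausdorff_dist_close:
  assumes A: "A \<noteq> {}" "bounded A" and e: "e > 0"
  shows "\<exists>\<delta>>0. \<forall>B. B \<noteq> {} \<longrightarrow> Hausdorff_dist A B < \<delta> \<longrightarrow>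
      (\<forall>b\<in>B. \<exists>a\<in>A. dist a b < e) \<and> (\<forall>a\<in>A. \<exists>b\<in>B. dist a b < e)"
proof -
  obtain R where R: "R > 0" "\<And>a. a \<in> A \<Longrightarrow> norm a \<le> R" using A(2) by (auto simp: bounded_pos)
  define \<delta> where "\<delta> = min (1 / (1 + R)) (e / (1 + R) ^ 2)"
  have "\<delta> > 0" using R(1) e by (simp add: \<delta>_def)
  moreover have "(\<forall>b\<in>B. \<exists>a\<in>A. dist a b < e) \<and> (\<forall>a\<in>A. \<exists>b\<in>B. dist a b < e)"
    if B: "B \<noteq> {}" "Hausdorff_dist A B < \<delta>" for B
  proof -
    obtain \<epsilon> where \<epsilon>: "\<epsilon> < \<delta>" "A \<subseteq> sph_nbhd \<epsilon> B" "B \<subseteq> sph_nbhd \<epsilon> A"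
      using cInf_lessD[OF Hausdorff_dist_set_nonempty[OF A(1) B(1)]] B(2) unfolding Hausdorff_dist_def by blast
    have close: "dist a b < e" if "a \<in> A" "sph_dist a b < \<epsilon>" for a b
      using sph_dist_imp_close[OF R(1) e R(2)[OF that(1)]] that(2) \<epsilon>(1) unfolding \<delta>_def by simp
    show ?thesis
    proof (intro conjI ballI)
      fix b assume "b \<in> B"
      then obtain a where a: "a \<in> A" "sph_dist b a < \<epsilon>" using \<epsilon>(3) by (auto simp: sph_nbhd_def)
      then have "dist a b < e" using close[OF a(1)] by (simp add: sph_dist_commute)
      then show "\<exists>a\<in>A. dist a b < e" using a(1) by blast
    next
      fix a assume a: "a \<in> A"
      then obtain b where b: "b \<in> B" "sph_dist a b < \<epsilon>" using \<epsilon>(2) by (auto simp: sph_nbhd_def)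
      then show "\<exists>b\<in>B. dist a b < e" using close[OF a] by blast
    qed
  qed
  ultimately show ?thesis by blast
qed

text \<open>The filter is arbitrary since three limits are needed: in the parameter at fixed index,
  in index and parameter together, and in the index alone. Both summands of \<open>chi_dyn\<close>
  are nonnegative, so smallness of the sum controls each.\<close>

lemma chi_dyn_continuity:
  assumes d: "luc_metric d" and Hol: "\<And>x. Fm x \<in> Hol_star_b"
    and cont: "continuous_wrt D (chi_dyn d) Fm"
    and conv: "\<And>\<delta>. \<delta> > 0 \<Longrightarrow> \<forall>\<^sub>F i in \<Phi>. D x0 (y i) < \<delta>"
  shows "luc_tendsto (\<lambda>i. Fm (y i)) (Fm x0) \<Phi>" (is ?luc)
    and "\<And>U. open U \<Longrightarrow> sing_vals (Fm x0) \<subseteq> U \<Longrightarrow> \<forall>\<^sub>F i in \<Phi>. sing_vals (Fm (y i)) \<subseteq> U"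
    and "\<And>s e. s \<in> sing_vals (Fm x0) \<Longrightarrow> e > 0 \<Longrightarrow> \<forall>\<^sub>F i in \<Phi>. \<exists>y\<in>sing_vals (Fm (y i)). dist y s < e"
proof -
  have Hs: "Fm x \<in> Hol_star" "bounded (sing_vals (Fm x))" for x using Hol[of x] by (auto simp: Hol_star_b_def)
  have ent: "Fm x \<in> entire" for x using Hs by (simp add: Hol_star_def)
  have ne: "sing_vals (Fm x) \<noteq> {}" for x by (rule sing_vals_nonempty[OF Hs(1)])
  interpret Metric_space entire d using d by (simp add: luc_metric_def)
  have small: "\<forall>\<^sub>F i in \<Phi>. d (Fm x0) (Fm (y i)) < \<epsilon> \<and> Hausdorff_dist (sing_vals (Fm x0)) (sing_vals (Fm (y i))) < \<epsilon>"
    if "\<epsilon> > 0" for \<epsilon>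
  proof -
    obtain \<delta> where \<delta>: "\<delta> > 0" "\<And>z. D x0 z < \<delta> \<Longrightarrow> chi_dyn d (Fm x0) (Fm z) < \<epsilon>"
      using cont \<open>\<epsilon> > 0\<close> unfolding continuous_wrt_def by blast
    from conv[OF \<delta>(1)] show ?thesis
    proof eventually_elim
      case (elim i)
      have "0 \<le> d (Fm x0) (Fm (y i))" by simp
      moreover have "0 \<le> Hausdorff_dist (sing_vals (Fm x0)) (sing_vals (Fm (y i)))" by (rule Hausdorff_dist_nonneg[OF ne ne])
      ultimately show ?case using \<delta>(2)[OF elim] unfolding chi_dyn_def by linarith
    qed
  qed
  show ?luc
    unfolding luc_tendsto_def uniform_limit_iff
  proof (intro allI impI)
    fix R e :: real assume "e > 0"
    then obtain \<delta> where \<delta>: "\<delta> > 0" "\<forall>g\<in>entire. d (Fm x0) g < \<delta> \<longrightarrow> (\<forall>z\<in>cball 0 R. dist (Fm x0 z) (g z) < e)"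
      using luc_metric_close[OF d ent] by blast
    from small[OF \<delta>(1)] show "\<forall>\<^sub>F i in \<Phi>. \<forall>z\<in>cball 0 R. dist (Fm (y i) z) (Fm x0 z) < e"
    proof eventually_elim
      case (elim i)
      then have "\<forall>z\<in>cball 0 R. dist (Fm x0 z) (Fm (y i) z) < e" using \<delta>(2) ent by blast
      then show ?case by (simp add: dist_commute)
    qed
  qed
  have H: "\<forall>\<^sub>F i in \<Phi>. (\<forall>b\<in>sing_vals (Fm (y i)). \<exists>a\<in>sing_vals (Fm x0). dist a b < e) \<and>
       (\<forall>a\<in>sing_vals (Fm x0). \<exists>b\<in>sing_vals (Fm (y i)). dist a b < e)" if "e > 0" for e
  proof -
    obtain \<delta> where \<delta>: "\<delta> > 0" "\<And>B. B \<noteq> {} \<Longrightarrow> Hausdorff_dist (sing_vals (Fm x0)) B < \<delta> \<Longrightarrow>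
      (\<forall>b\<in>B. \<exists>a\<in>sing_vals (Fm x0). dist a b < e) \<and> (\<forall>a\<in>sing_vals (Fm x0). \<exists>b\<in>B. dist a b < e)"
      using Hausdorff_dist_close[OF ne Hs(2) \<open>e > 0\<close>] by blast
    from small[OF \<delta>(1)] show ?thesis 
    proof eventually_elim
      case (elim i)
      show ?case by (rule \<delta>(2)[OF ne]) (use elim in simp)
    qed
  qed
  show "\<forall>\<^sub>F i in \<Phi>. sing_vals (Fm (y i)) \<subseteq> U" if U: "open U" "sing_vals (Fm x0) \<subseteq> U" for U
  proof -
    have "compact (sing_vals (Fm x0))"
      using sing_vals_covering(1)[OF Hs(1)] Hs(2) by (simp add: compact_eq_bounded_closed)
    then obtain e where e: "e > 0" "(\<Union>a\<in>sing_vals (Fm x0). ball a e) \<subseteq> U"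
      using compact_subset_open_imp_ball_epsilon_subset[OF _ U] by blast
    from H[OF e(1)] show ?thesis
    proof eventually_elim
      case (elim i)
      show ?case
      proof
        fix b assume "b \<in> sing_vals (Fm (y i))"
        then obtain a where "a \<in> sing_vals (Fm x0)" "b \<in> ball a e" using elim unfolding mem_ball by blast
        then show "b \<in> U" using e(2) by blast
      qed
    qed
  qed
  show "\<forall>\<^sub>F i in \<Phi>. \<exists>b\<in>sing_vals (Fm (y i)). dist b s < e" if s: "s \<in> sing_vals (Fm x0)" "e > 0" for s e
    using H[OF s(2)] by eventually_elim (use s(1) in \<open>metis dist_commute\<close>)
qed

text \<open>Attraction is stable jointly in the map and in the starting point; compactness of the
  singular set leaves finitely many neighbourhoods, which contain the perturbed singular set by
  \<open>upper\<close>.\<close>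

lemma all_attracted_stable:
  assumes f: "f \<in> Hol_star_b" and att: "all_attracted f"
    and g: "luc_tendsto g f \<Phi>" "\<And>i. g i holomorphic_on UNIV"
    and upper: "\<And>U. open U \<Longrightarrow> sing_vals f \<subseteq> U \<Longrightarrow> \<forall>\<^sub>F i in \<Phi>. sing_vals (g i) \<subseteq> U"
  shows "\<forall>\<^sub>F i in \<Phi>. all_attracted (g i)"
proof -
  have fs: "f \<in> Hol_star" "bounded (sing_vals f)" using f by (auto simp: Hol_star_b_def)
  have hol: "f holomorphic_on UNIV" by (rule Hol_star_holomorphic[OF fs(1)])
  have cS: "compact (sing_vals f)"
    using sing_vals_covering(1)[OF fs(1)] fs(2) by (simp add: compact_eq_bounded_closed)
  have "\<exists>U. open U \<and> s \<in> U \<and> (\<forall>\<^sub>F i in \<Phi>. \<forall>y\<in>U. \<exists>p b. attr_to (g i) p y b)" if s: "s \<in> sing_vals f" for s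
  proof -
    obtain p a where pa: "attr_to f p s a" using att s unfolding all_attracted_def by blast
    have l: "luc_tendsto (\<lambda>x. g (fst x)) f (\<Phi> \<times>\<^sub>F nhds s)" by (rule luc_tendsto_filterlim[OF g(1) filterlim_fst])
    have h: "\<forall>\<^sub>F x in \<Phi> \<times>\<^sub>F nhds s. g (fst x) holomorphic_on UNIV" by (intro always_eventually allI g(2))
    obtain M where "\<forall>\<^sub>F x in \<Phi> \<times>\<^sub>F nhds s. (\<exists>b\<in>ball a 1. attr_to (g (fst x)) p (snd x) b) \<and>
        (\<forall>m. norm ((g (fst x) ^^ m) (snd x)) \<le> M)"
      by (rule attr_to_stable[OF hol pa l h filterlim_snd zero_less_one])
    then have "\<forall>\<^sub>F x in \<Phi> \<times>\<^sub>F nhds s. \<exists>b. attr_to (g (fst x)) p (snd x) b" by (rule eventually_mono) blast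
    then obtain P Q where PQ: "eventually P \<Phi>" "eventually Q (nhds s)" "\<And>i y. P i \<Longrightarrow> Q y \<Longrightarrow> \<exists>b. attr_to (g i) p y b"
      unfolding eventually_prod_filter by auto
    obtain U where U: "open U" "s \<in> U" "\<forall>y\<in>U. Q y" using PQ(2) unfolding eventually_nhds by blast
    have "\<forall>\<^sub>F i in \<Phi>. \<forall>y\<in>U. \<exists>p b. attr_to (g i) p y b" using PQ(1) by (rule eventually_mono) (use U(3) PQ(3) in blast)
    then show ?thesis using U by blast
  qed
  then have "\<forall>s\<in>sing_vals f. \<exists>U. open U \<and> s \<in> U \<and> (\<forall>\<^sub>F i in \<Phi>. \<forall>y\<in>U. \<exists>p b. attr_to (g i) p y b)" by blast
  from bchoice[OF this] obtain U where
    U: "\<forall>s\<in>sing_vals f. open (U s) \<and> s \<in> U s \<and> (\<forall>\<^sub>F i in \<Phi>. \<forall>y\<in>U s. \<exists>p b. attr_to (g i) p y b)" by blast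
  obtain T where T: "T \<subseteq> sing_vals f" "finite T" "sing_vals f \<subseteq> (\<Union>s\<in>T. U s)"
    using compactE_image[OF cS, of "sing_vals f" U] U by blast
  have "\<forall>\<^sub>F i in \<Phi>. sing_vals (g i) \<subseteq> (\<Union>s\<in>T. U s)" by (rule upper[OF _ T(3)]) (use T(1) U in blast)
  moreover have "\<forall>\<^sub>F i in \<Phi>. \<forall>s\<in>T. \<forall>y\<in>U s. \<exists>p b. attr_to (g i) p y b"
    by (rule eventually_ball_finite[OF T(2)]) (use T(1) U in blast)
  ultimately show ?thesis
  proof eventually_elim
    case (elim i)
    then show ?case unfolding all_attracted_def by blast
  qed
qed

lemma chi_prod_nhds:
  assumes "\<delta> > 0" shows "\<forall>\<^sub>F l in nhds l0. chi_prod (n, l0) (n, l) < \<delta>"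
  using assms unfolding chi_prod_def chi_enat_def eventually_nhds_metric by (auto simp: dist_commute)

lemma chi_prod_infinity:
  assumes \<delta>: "\<delta> > 0" shows "\<forall>\<^sub>F x in sequentially \<times>\<^sub>F nhds l0. chi_prod (\<infinity>, l0) (enat (fst x), snd x) < \<delta>"
proof -
  have "(\<lambda>n. (1/2::real) ^ (n + 1)) \<longlonglongrightarrow> 0" by (intro LIMSEQ_ignore_initial_segment LIMSEQ_realpow_zero) auto
  then have "\<forall>\<^sub>F n in sequentially. (1/2::real) ^ (n + 1) < \<delta> / 2" using half_gt_zero[OF \<delta>] by (rule order_tendstoD)
  moreover have "\<forall>\<^sub>F l in nhds l0. dist l0 l < \<delta> / 2"
    unfolding eventually_nhds_metric using \<delta> by (intro exI[of _ "\<delta> / 2"]) (auto simp: dist_commute)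
  ultimately show ?thesis
    unfolding eventually_prod_filter
  proof (intro exI conjI allI impI)
    fix n l assume "(1/2::real) ^ (n + 1) < \<delta> / 2" "dist l0 l < \<delta> / 2"
    then show "chi_prod (\<infinity>, l0) (enat (fst (n, l)), snd (n, l)) < \<delta>" by (simp add: chi_prod_def chi_enat_def)
  qed
qed

section \<open>Charts and complex lines\<close>

lemma norm_vector_scalar_mult: "norm (c *s (v :: complex ^ 'n)) = norm c * norm v"
proof -
  have "norm (c *s v) = sqrt (\<Sum>i\<in>UNIV. (norm c * norm (v $ i)) ^ 2)" by (simp add: norm_vec_def L2_set_def norm_mult)
  also have "\<dots> = sqrt (norm c ^ 2 * (\<Sum>i\<in>UNIV. norm (v $ i) ^ 2))" by (simp add: power_mult_distrib sum_distrib_left)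
  also have "\<dots> = norm c * norm v" by (simp add: norm_vec_def L2_set_def real_sqrt_mult)
  finally show ?thesis .
qed

lemma coord_subspace_closed: "closed (coord_subspace I)"
proof -
  have eq: "coord_subspace I = (\<Inter>i\<in>-I. {v. v $ i = 0})" by (auto simp: coord_subspace_def)
  show ?thesis unfolding eq by (intro closed_INT ballI closed_Collect_eq continuous_intros)
qed

lemma coord_subspace_convex: "convex (coord_subspace I)"
  by (auto simp: coord_subspace_def convex_def)

lemma coord_subspace_line: "v \<in> coord_subspace I \<Longrightarrow> w \<in> coord_subspace I \<Longrightarrow> v + c *s (w - v) \<in> coord_subspace I"
  by (auto simp: coord_subspace_def)

lemma bounded_linear_vector_scalar: "bounded_linear (\<lambda>t. t *s (u :: complex ^ 'n))"
proof (rule bounded_linear_intro[where K = "norm u"])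
  show "(x + y) *s u = x *s u + y *s u" for x y by (simp add: vec_eq_iff algebra_simps)
  show "(r *\<^sub>R x) *s u = r *\<^sub>R (x *s u)" for r x by (simp add: vec_eq_iff)
  show "norm (x *s u) \<le> norm x * norm u" for x by (simp add: norm_vector_scalar_mult)
qed

text \<open>In a chart two nearby points are joined by a complex line. Radius
  \<open>\<rho> / 3\<close> for \<open>N\<close> leaves room for a parameter disc that contains 0
  and 1 in its interior and stays over the closed ball of radius \<open>\<rho>\<close>. Compactness
  of \<open>C\<close> allows the kernel property to be used on the whole disc.\<close>

lemma atlas_neighbourhood:
  fixes \<A> :: "('m::metric_space set \<times> ('m \<Rightarrow> complex ^ 'n::finite)) set"
  assumes atlas: "complex_atlas \<A>" and X: "open X" "x \<in> X"
  obtains N C where "open N" "connected N" "x \<in> N" "N \<subseteq> C" "compact C" "C \<subseteq> X"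
    "\<And>y z. y \<in> N \<Longrightarrow> z \<in> N \<Longrightarrow> \<exists>R \<iota>. R > 1 \<and> \<iota> 0 = y \<and> \<iota> 1 = z \<and> continuous_on (ball 0 R) \<iota> \<and>
        \<iota> ` ball 0 R \<subseteq> C \<and> (\<forall>h. holomorphic_mfd \<A> h \<longrightarrow> (\<lambda>t. h (\<iota> t)) holomorphic_on ball 0 R)"
proof -
  obtain I where I: "\<And>U \<phi>. (U, \<phi>) \<in> \<A> \<Longrightarrow> open U \<and> openin (top_of_set (coord_subspace I)) (\<phi> ` U) \<and>
            homeomorphism U (\<phi> ` U) \<phi> (inv_into U \<phi>)"
    using atlas unfolding complex_atlas_def by fast
  have "x \<in> (\<Union>(U, \<phi>)\<in>\<A>. U)" using atlas unfolding complex_atlas_def by simp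
  then obtain U \<phi> where chart: "(U, \<phi>) \<in> \<A>" "x \<in> U" by (elim UN_E) (auto split: prod.splits)
  define \<psi> where "\<psi> = inv_into U \<phi>"
  define V where "V = coord_subspace I"
  have oU: "open U" and oi: "openin (top_of_set V) (\<phi> ` U)" and hom: "homeomorphism U (\<phi> ` U) \<phi> \<psi>"
    using I[OF chart(1)] by (auto simp: \<psi>_def V_def)
  have \<psi>\<phi>: "\<psi> (\<phi> y) = y" if "y \<in> U" for y using hom that by (simp add: homeomorphism_def)
  have \<phi>\<psi>: "\<phi> (\<psi> v) = v" "\<psi> v \<in> U" if "v \<in> \<phi> ` U" for v using hom that by (auto simp: homeomorphism_def)
  have c\<psi>: "continuous_on (\<phi> ` U) \<psi>" and c\<phi>: "continuous_on U \<phi>" using hom by (auto simp: homeomorphism_def)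
  have \<phi>V: "\<phi> ` U \<subseteq> V" using openin_imp_subset[OF oi] .
  have "openin (top_of_set (\<phi> ` U)) (\<phi> ` U \<inter> \<psi> -` X)" by (rule continuous_openin_preimage_gen[OF c\<psi> X(1)])
  then have "openin (top_of_set V) (\<phi> ` U \<inter> \<psi> -` X)" using oi openin_trans by blast
  then obtain W where W: "open W" "\<phi> ` U \<inter> \<psi> -` X = V \<inter> W" unfolding openin_open by blast
  define v0 where "v0 = \<phi> x"
  have "v0 \<in> \<phi> ` U \<inter> \<psi> -` X" using chart(2) X(2) by (simp add: v0_def \<psi>\<phi>)
  then have "v0 \<in> W" using W(2) by blast
  then obtain \<rho> where \<rho>: "\<rho> > 0" "cball v0 \<rho> \<subseteq> W" using W(1) open_contains_cball by metis
  define Bc where "Bc = cball v0 \<rho> \<inter> V"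
  have Bc: "Bc \<subseteq> \<phi> ` U" "Bc \<subseteq> \<psi> -` X" using W(2) \<rho>(2) by (auto simp: Bc_def)
  have v0V: "v0 \<in> V" using chart(2) \<phi>V by (auto simp: v0_def)
  define C where "C = \<psi> ` Bc"
  have "compact Bc" unfolding Bc_def V_def by (intro compact_Int_closed compact_cball coord_subspace_closed)
  then have cC: "compact C" unfolding C_def by (intro compact_continuous_image continuous_on_subset[OF c\<psi>] Bc(1))
  have CX: "C \<subseteq> X" using Bc(2) by (auto simp: C_def)
  define B where "B = ball v0 (\<rho>/3) \<inter> V"
  have BBc: "B \<subseteq> Bc" using \<rho>(1) by (auto simp: B_def Bc_def)
  define N where "N = \<psi> ` B"
  have Neq: "N = U \<inter> \<phi> -` ball v0 (\<rho>/3)"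
  proof
    show "N \<subseteq> U \<inter> \<phi> -` ball v0 (\<rho>/3)"
    proof
      fix y assume "y \<in> N"
      then obtain v where v: "v \<in> B" "y = \<psi> v" by (auto simp: N_def)
      then have "v \<in> \<phi> ` U" using BBc Bc(1) by blast
      then show "y \<in> U \<inter> \<phi> -` ball v0 (\<rho>/3)" using \<phi>\<psi> v by (auto simp: B_def)
    qed
    show "U \<inter> \<phi> -` ball v0 (\<rho>/3) \<subseteq> N"
    proof
      fix y assume y: "y \<in> U \<inter> \<phi> -` ball v0 (\<rho>/3)"
      then have "\<phi> y \<in> B" using \<phi>V by (auto simp: B_def)
      then have "\<psi> (\<phi> y) \<in> N" by (auto simp: N_def)
      then show "y \<in> N" using \<psi>\<phi> y by simp
    qed
  qed
  have "open N" unfolding Neq by (rule continuous_open_preimage[OF c\<phi> oU open_ball])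
  moreover have "connected N"
    unfolding N_def B_def V_def using BBc Bc(1) unfolding B_def V_def
    by (intro connected_continuous_image continuous_on_subset[OF c\<psi>] convex_connected convex_Int convex_ball coord_subspace_convex) blast
  moreover have "x \<in> N" unfolding Neq using chart(2) \<rho>(1) by (simp add: v0_def)
  moreover have "N \<subseteq> C" unfolding N_def C_def using BBc by blast
  moreover have "\<exists>R \<iota>. R > 1 \<and> \<iota> 0 = y \<and> \<iota> 1 = z \<and> continuous_on (ball 0 R) \<iota> \<and>
        \<iota> ` ball 0 R \<subseteq> C \<and> (\<forall>h. holomorphic_mfd \<A> h \<longrightarrow> (\<lambda>t. h (\<iota> t)) holomorphic_on ball 0 R)"
    if yz: "y \<in> N" "z \<in> N" for y z
  proof -
    define a where "a = \<phi> y"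
    define u where "u = \<phi> z - a"
    have yzU: "y \<in> U" "z \<in> U" "dist v0 a < \<rho>/3" "dist v0 (\<phi> z) < \<rho>/3" using yz by (auto simp: Neq a_def)
    have nu: "norm u < 2 * \<rho> / 3"
      using yzU(3,4) dist_triangle[of a "\<phi> z" v0] by (simp add: u_def dist_norm norm_minus_commute)
    \<comment> \<open>\<open>R > 1\<close> because \<open>norm u < 2 * \<rho> / 3\<close>; for
      \<open>u = 0\<close> the line is constant and any value above 1 will do.\<close>
    define R where "R = (if u = 0 then 2 else (2 * \<rho> / 3) / norm u)"
    have R: "R > 1" "R * norm u \<le> 2 * \<rho> / 3" using nu \<rho>(1) by (auto simp: R_def field_simps)
    define \<gamma> where "\<gamma> t = a + t *s u" for t
    have aV: "a \<in> V" "\<phi> z \<in> V" using \<phi>V yzU by (auto simp: a_def)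
    have \<gamma>: "\<gamma> t \<in> Bc" if t: "t \<in> ball 0 R" for t
    proof -
      have "\<gamma> t \<in> V" unfolding \<gamma>_def u_def V_def using aV coord_subspace_line unfolding V_def by blast
      moreover have "norm (t *s u) \<le> 2 * \<rho> / 3"
      proof -
        have "norm t * norm u \<le> R * norm u" using t by (intro mult_right_mono) auto
        then show ?thesis using R(2) by (simp add: norm_vector_scalar_mult)
      qed
      then have "dist v0 (\<gamma> t) \<le> \<rho>"
        using yzU(3) norm_triangle_ineq4[of "v0 - a" "t *s u"] by (simp add: \<gamma>_def dist_norm algebra_simps)
      ultimately show ?thesis by (simp add: Bc_def)
    qed
    define \<iota> where "\<iota> t = \<psi> (\<gamma> t)" for t
    have d\<gamma>: "(\<gamma> has_derivative (\<lambda>\<tau>. \<tau> *s u)) (at t within S)" for t S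
      unfolding \<gamma>_def using bounded_linear.has_derivative[OF bounded_linear_vector_scalar[of u] has_derivative_ident]
      by (intro has_derivative_eq_rhs[OF has_derivative_add[OF has_derivative_const]]) auto
    have c\<gamma>: "continuous_on (ball 0 R) \<gamma>" using has_derivative_continuous_on[OF d\<gamma>] by blast
    have "\<iota> 0 = y" by (simp add: \<iota>_def \<gamma>_def a_def \<psi>\<phi> yzU)
    moreover have "\<iota> 1 = z" by (simp add: \<iota>_def \<gamma>_def u_def \<psi>\<phi> yzU)
    moreover have "continuous_on (ball 0 R) \<iota>"
      unfolding \<iota>_def using \<gamma> Bc(1) by (intro continuous_on_compose2[OF c\<psi> c\<gamma>]) auto
    moreover have "\<iota> ` ball 0 R \<subseteq> C" using \<gamma> by (auto simp: \<iota>_def C_def)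
    moreover have "(\<lambda>t. h (\<iota> t)) holomorphic_on ball 0 R" if h: "holomorphic_mfd \<A> h" for h
    proof -
      have sv: "holomorphic_sv (\<lambda>v. h (\<psi> v)) (\<phi> ` U)" using h chart(1) unfolding holomorphic_mfd_def \<psi>_def by blast
      have "\<exists>f'. ((\<lambda>t. h (\<iota> t)) has_field_derivative f') (at t)" if t: "t \<in> ball 0 R" for t
      proof -
        have "\<gamma> t \<in> \<phi> ` U" using \<gamma>[OF t] Bc(1) by blast
        then obtain L where L: "Vector_Spaces.linear (*s) (*) L" "((\<lambda>v. h (\<psi> v)) has_derivative L) (at (\<gamma> t) within \<phi> ` U)"
          using sv unfolding holomorphic_sv_def by blast
        have "\<gamma> ` ball 0 R \<subseteq> \<phi> ` U" using \<gamma> Bc(1) by blast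
        then have "((\<lambda>v. h (\<psi> v)) has_derivative L) (at (\<gamma> t) within \<gamma> ` ball 0 R)" by (rule has_derivative_subset[OF L(2)])
        from has_derivative_in_compose[OF d\<gamma> this]
        have "((\<lambda>t. h (\<psi> (\<gamma> t))) has_derivative (\<lambda>\<tau>. L (\<tau> *s u))) (at t within ball 0 R)" .
        moreover have "L (\<tau> *s u) = L u * \<tau>" for \<tau>
        proof -
          interpret Vector_Spaces.linear "(*s)" "(*)" L by (rule L(1))
          show ?thesis by (simp add: scale mult.commute)
        qed
        ultimately have "((\<lambda>t. h (\<iota> t)) has_derivative (\<lambda>\<tau>. L u * \<tau>)) (at t within ball 0 R)" by (simp add: \<iota>_def)
        then have "((\<lambda>t. h (\<iota> t)) has_field_derivative L u) (at t within ball 0 R)" by (simp add: has_field_derivative_def)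
        then show ?thesis using t at_within_open[OF t open_ball] by auto
      qed
      then show ?thesis by (simp add: holomorphic_on_open)
    qed
    ultimately show ?thesis using R(1) by blast
  qed
  ultimately show ?thesis using that cC CX by blast
qed

section \<open>Kernels of hyperbolic components\<close>

lemma hyperbolic_iff_all_attracted: "f \<in> Hol_star_b \<Longrightarrow> nonescaping_hyperbolic f \<longleftrightarrow> all_attracted f"
  using hyperbolic_imp_all_attracted all_attracted_imp_hyperbolic by blast

text \<open>Pulling everything back along \<open>\<iota>\<close> leaves a one-parameter problem. The
  shift by \<open>n0\<close> discards the finitely many maps that may fail to be hyperbolic on the
  disc.\<close>

lemma hyperbolic_along_disc:
  fixes \<A> :: "('m::metric_space set \<times> ('m \<Rightarrow> complex ^ 'n::finite)) set" and f :: "enat \<Rightarrow> 'm \<Rightarrow> complex \<Rightarrow> complex"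
  assumes luc: "luc_metric d" and Hol: "\<And>n l. f n l \<in> Hol_star_b"
    and hol: "\<And>n z. holomorphic_mfd \<A> (\<lambda>l. f n l z)"
    and par: "\<And>n. sing_vals_parametrized \<A> (f n)"
    and cont: "continuous_wrt chi_prod (chi_dyn d) (\<lambda>(n, l). f n l)"
    and R: "R > 1" and \<iota>: "continuous_on (ball 0 R) \<iota>"
    and h\<iota>: "\<And>h. holomorphic_mfd \<A> h \<Longrightarrow> (\<lambda>t. h (\<iota> t)) holomorphic_on ball 0 R"
    and hypn: "\<And>n t. n \<ge> n0 \<Longrightarrow> t \<in> ball 0 R \<Longrightarrow> nonescaping_hyperbolic (f (enat n) (\<iota> t))"
    and hyp0: "nonescaping_hyperbolic (f \<infinity> (\<iota> 0))"
  shows "nonescaping_hyperbolic (f \<infinity> (\<iota> 1))"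
proof -
  define D :: "complex set" where "D = ball 0 R"
  define F where "F n t = f (enat (n + n0)) (\<iota> t)" for n t
  define G where "G t = f \<infinity> (\<iota> t)" for t
  define Fm where "Fm = (\<lambda>(n, l). f n l)"
  have HolFm: "Fm x \<in> Hol_star_b" for x using Hol by (cases x) (simp add: Fm_def)
  have contFm: "continuous_wrt chi_prod (chi_dyn d) Fm" using cont by (simp add: Fm_def)
  note continuity = chi_dyn_continuity[OF luc HolFm contFm]
  have oD: "open D" by (simp add: D_def)
  have \<iota>lim: "filterlim \<iota> (nhds (\<iota> t)) (nhds t)" if "t \<in> D" for t
  proof -
    have "isCont \<iota> t" using \<iota> that by (simp add: D_def continuous_on_eq_continuous_at)
    then show ?thesis unfolding isCont_def by (rule tendsto_at_iff_tendsto_nhds[THEN iffD1])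
  qed
  have c1: "\<forall>\<^sub>F t' in nhds t. chi_prod (n, \<iota> t) (n, \<iota> t') < \<delta>" if "t \<in> D" "\<delta> > 0" for n t \<delta>
    using \<iota>lim[OF that(1)] chi_prod_nhds[OF that(2)] unfolding filterlim_iff by blast
  have c2: "\<forall>\<^sub>F x in sequentially \<times>\<^sub>F nhds t. chi_prod (\<infinity>, \<iota> t) (enat (fst x + n0), \<iota> (snd x)) < \<delta>"
    if "t \<in> D" "\<delta> > 0" for t \<delta>
  proof -
    have "filterlim (\<lambda>x. (fst x + n0, \<iota> (snd x))) (sequentially \<times>\<^sub>F nhds (\<iota> t)) (sequentially \<times>\<^sub>F nhds t)"
      by (intro filterlim_Pair filterlim_compose[OF filterlim_add_const_nat_at_top filterlim_fst]
            filterlim_compose[OF \<iota>lim[OF that(1)] filterlim_snd])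
    from this[unfolded filterlim_iff, rule_format, OF chi_prod_infinity[OF that(2)]] show ?thesis by simp
  qed
  have c3: "\<forall>\<^sub>F n in sequentially. chi_prod (\<infinity>, \<iota> t) (enat (n + n0), \<iota> t) < \<delta>" if t\<delta>: "t \<in> D" "\<delta> > 0" for t \<delta>
  proof -
    obtain U where U: "t \<in> U" "\<forall>\<^sub>F n in sequentially. \<forall>x\<in>U. chi_prod (\<infinity>, \<iota> t) (enat (n + n0), \<iota> x) < \<delta>"
      using eventually_prod_nhds_seq[of "\<lambda>n x. chi_prod (\<infinity>, \<iota> t) (enat (n + n0), \<iota> x) < \<delta>" t, OF c2[OF t\<delta>]] by blast
    from U(2) show ?thesis by (rule eventually_mono) (use U(1) in blast)
  qed
  have fam: "hol_family D (\<lambda>t. f n (\<iota> t))" for n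
    unfolding hol_family_def
  proof (intro conjI ballI allI)
    show "f n (\<iota> t) holomorphic_on UNIV" for t using Hol[of n "\<iota> t"] by (simp add: Hol_star_b_def Hol_star_holomorphic)
    show "(\<lambda>t. f n (\<iota> t) z) holomorphic_on D" for z unfolding D_def by (rule h\<iota>[OF hol])
    show "luc_tendsto (\<lambda>t. f n (\<iota> t)) (f n (\<iota> t)) (nhds t)" if "t \<in> D" for t
      using continuity(1)[of "(n, \<iota> t)" "\<lambda>t'. (n, \<iota> t')" "nhds t", OF c1[OF that]] by (simp add: Fm_def)
  qed (rule oD)
  interpret limit_family D F G
  proof
    show "connected D" by (simp add: D_def convex_connected)
    show "hol_family D (F n)" for n unfolding F_def by (rule fam)
    show "hol_family D G" unfolding G_def by (rule fam)
    show "G t \<in> Hol_star_b" for t unfolding G_def by (rule Hol)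
    show "all_attracted (F n t)" if "t \<in> D" for n t
      using hypn[of "n + n0" t] that unfolding F_def D_def by (intro hyperbolic_imp_all_attracted) simp
    show "\<exists>w. w holomorphic_on D \<and> w t = s \<and> (\<forall>t\<in>D. w t \<in> sing_vals (F n t))"
      if ts: "t \<in> D" "s \<in> sing_vals (F n t)" for n t s
    proof -
      obtain w where w: "holomorphic_mfd \<A> w" "w (\<iota> t) = s" "\<And>l. w l \<in> sing_vals (f (enat (n + n0)) l)"
        using par[of "enat (n + n0)"] ts(2) unfolding sing_vals_parametrized_def F_def by blast
      then show ?thesis using h\<iota>[OF w(1)] unfolding D_def F_def by (intro exI[of _ "\<lambda>t. w (\<iota> t)"]) simp
    qed
    fix t assume t: "t \<in> D"
    note cont2 = continuity[of "(\<infinity>, \<iota> t)" "\<lambda>x. (enat (fst x + n0), \<iota> (snd x))" "sequentially \<times>\<^sub>F nhds t", OF c2[OF t]]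
    show "luc_tendsto (\<lambda>x. F (fst x) (snd x)) (G t) (sequentially \<times>\<^sub>F nhds t)"
      using cont2(1) by (simp add: Fm_def F_def G_def)
    show "\<forall>\<^sub>F x in sequentially \<times>\<^sub>F nhds t. sing_vals (F (fst x) (snd x)) \<subseteq> U"
      if "open U" "sing_vals (G t) \<subseteq> U" for U
      using cont2(2)[of U] that by (simp add: Fm_def F_def G_def)
    show "\<forall>\<^sub>F n in sequentially. \<exists>y\<in>sing_vals (F n t). dist y s < e" if "s \<in> sing_vals (G t)" "e > 0" for s e
      using continuity(3)[of "(\<infinity>, \<iota> t)" "\<lambda>n. (enat (n + n0), \<iota> t)" sequentially s e, OF c3[OF t]] that
      by (simp add: Fm_def F_def G_def)
    note cont1 = continuity[of "(\<infinity>, \<iota> t)" "\<lambda>t'. (\<infinity>, \<iota> t')" "nhds t", OF c1[OF t]]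
    show "\<forall>\<^sub>F t' in nhds t. all_attracted (G t')" if "all_attracted (G t)"
    proof (rule all_attracted_stable[OF _ that])
      show "G t \<in> Hol_star_b" unfolding G_def by (rule Hol)
      show "luc_tendsto G (G t) (nhds t)" using cont1(1) unfolding Fm_def G_def[abs_def] by simp
      show "G t' holomorphic_on UNIV" for t' using Hol[of \<infinity> "\<iota> t'"] by (simp add: G_def Hol_star_b_def Hol_star_holomorphic)
      show "\<forall>\<^sub>F t' in nhds t. sing_vals (G t') \<subseteq> U" if "open U" "sing_vals (G t) \<subseteq> U" for U
        using cont1(2)[of U] that by (simp add: Fm_def G_def)
    qed
  qed
  have "all_attracted (G 1)"
    by (rule all_attracted_limit[of 0 1]) (use R hyp0 hyperbolic_imp_all_attracted in \<open>auto simp: D_def G_def\<close>)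
  then show ?thesis unfolding G_def by (rule all_attracted_imp_hyperbolic[OF Hol])
qed

theorem theorem1p1:
  fixes \<A> :: "('m::metric_space set \<times> ('m \<Rightarrow> complex ^ 'n::finite)) set"
    and chi_luc :: "(complex \<Rightarrow> complex) \<Rightarrow> (complex \<Rightarrow> complex) \<Rightarrow> real"
    and f :: "enat \<Rightarrow> 'm \<Rightarrow> complex \<Rightarrow> complex"
    and H :: "nat \<Rightarrow> 'm set" and H' :: "'m set"
  assumes "complex_atlas \<A>"
    and "luc_metric chi_luc"
    and "\<And>n l. f n l \<in> Hol_star_b"
    and "\<And>n z. holomorphic_mfd \<A> (\<lambda>l. f n l z)"
    and "\<And>n. sing_vals_parametrized \<A> (f n)"
    and "continuous_wrt chi_prod (chi_dyn chi_luc) (\<lambda>(n, l). f n l)"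
    and "\<forall>\<^sub>F n in sequentially. H n \<in> components (hyp_locus (f (enat n)))"
    and "is_kernel H H'"
  shows "((\<forall>l\<in>H'. \<not> nonescaping_hyperbolic (f \<infinity> l)) \<or>
          (\<exists>Hinf \<in> components (hyp_locus (f \<infinity>)). H' = Hinf)) \<and>
         \<not> ((\<forall>l\<in>H'. \<not> nonescaping_hyperbolic (f \<infinity> l)) \<and>
            (\<exists>Hinf \<in> components (hyp_locus (f \<infinity>)). H' = Hinf))"
proof
  note atlas = assms(1) and luc = assms(2) and Hol = assms(3) and comp = assms(7)
  obtain p where ker: "kernel_candidate H p H'" and maxk: "\<And>V. kernel_candidate H p V \<Longrightarrow> V \<subseteq> H'"
    using assms(8) unfolding is_kernel_def by blast
  have H': "open H'" "connected H'" "p \<in> H'" "\<And>K. compact K \<Longrightarrow> K \<subseteq> H' \<Longrightarrow> \<forall>\<^sub>F n in sequentially. K \<subseteq> H n"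
    using ker unfolding kernel_candidate_def by auto
  show "\<not> ((\<forall>l\<in>H'. \<not> nonescaping_hyperbolic (f \<infinity> l)) \<and> (\<exists>Hinf \<in> components (hyp_locus (f \<infinity>)). H' = Hinf))"
  proof
    assume as: "(\<forall>l\<in>H'. \<not> nonescaping_hyperbolic (f \<infinity> l)) \<and> (\<exists>Hinf \<in> components (hyp_locus (f \<infinity>)). H' = Hinf)"
    then have "H' \<subseteq> hyp_locus (f \<infinity>)" using in_components_subset by blast
    then show False using as H'(3) unfolding hyp_locus_def by blast
  qed
  show "(\<forall>l\<in>H'. \<not> nonescaping_hyperbolic (f \<infinity> l)) \<or> (\<exists>Hinf \<in> components (hyp_locus (f \<infinity>)). H' = Hinf)"
  proof (rule disjCI)
    assume "\<not> (\<exists>Hinf \<in> components (hyp_locus (f \<infinity>)). H' = Hinf)"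
    then have no: "H' \<notin> components (hyp_locus (f \<infinity>))" by blast
    show "\<forall>l\<in>H'. \<not> nonescaping_hyperbolic (f \<infinity> l)"
    proof (rule ccontr)
      assume "\<not> ?thesis"
      then obtain l1 where l1: "l1 \<in> H'" "nonescaping_hyperbolic (f \<infinity> l1)" by blast
      \<comment> \<open>Any two points of a chart neighbourhood lie on a disc inside a compact
        subset of the kernel, so hyperbolicity of the limit maps passes between them and, by
        connectedness, through all of \<open>H'\<close>.\<close>
      have hyp: "nonescaping_hyperbolic (f \<infinity> l)" if l: "l \<in> H'" for l
      proof (rule connected_induction_simple[where P = "\<lambda>l. nonescaping_hyperbolic (f \<infinity> l)", OF H'(2) l1(1) l l1(2)])
        fix a assume a: "a \<in> H'"
        obtain N C where N: "open N" "a \<in> N" "N \<subseteq> C" "compact C" "C \<subseteq> H'" and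
          disc: "\<And>y z. y \<in> N \<Longrightarrow> z \<in> N \<Longrightarrow> \<exists>R \<iota>. R > 1 \<and> \<iota> 0 = y \<and> \<iota> 1 = z \<and> continuous_on (ball 0 R) \<iota> \<and>
            \<iota> ` ball 0 R \<subseteq> C \<and> (\<forall>h. holomorphic_mfd \<A> h \<longrightarrow> (\<lambda>t. h (\<iota> t)) holomorphic_on ball 0 R)"
          by (rule atlas_neighbourhood[OF atlas H'(1) a]) blast
        have "\<forall>\<^sub>F n in sequentially. C \<subseteq> hyp_locus (f (enat n))"
          using H'(4)[OF N(4,5)] comp
        proof eventually_elim
          case (elim n)
          then show ?case using in_components_subset by blast
        qed
        then obtain n0 where n0: "\<And>n. n \<ge> n0 \<Longrightarrow> C \<subseteq> hyp_locus (f (enat n))" unfolding eventually_sequentially by blast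
        have spread: "nonescaping_hyperbolic (f \<infinity> z)" if yz: "y \<in> N" "z \<in> N" "nonescaping_hyperbolic (f \<infinity> y)" for y z
        proof -
          obtain R \<iota> where R: "R > 1" "\<iota> 0 = y" "\<iota> 1 = z" "continuous_on (ball 0 R) \<iota>" "\<iota> ` ball 0 R \<subseteq> C"
              "\<And>h. holomorphic_mfd \<A> h \<Longrightarrow> (\<lambda>t. h (\<iota> t)) holomorphic_on ball 0 R"
            using disc[OF yz(1,2)] by blast
          have "nonescaping_hyperbolic (f (enat n) (\<iota> t))" if "n \<ge> n0" "t \<in> ball 0 R" for n t
            using n0[OF that(1)] R(5) that(2) unfolding hyp_locus_def by blast
          then show ?thesis
            using hyperbolic_along_disc[OF luc Hol assms(4,5,6) R(1,4,6)] R(2,3) yz(3) by metis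
        qed
        show "\<exists>T. openin (top_of_set H') T \<and> a \<in> T \<and> (\<forall>x\<in>T. \<forall>y\<in>T. 
            nonescaping_hyperbolic (f \<infinity> x) \<longrightarrow> nonescaping_hyperbolic (f \<infinity> y))"
          using N spread by (intro exI[of _ N] conjI open_subset) blast+
      qed
      define Hi where "Hi = connected_component_set (hyp_locus (f \<infinity>)) l1"
      have l1h: "l1 \<in> hyp_locus (f \<infinity>)" using l1(2) by (simp add: hyp_locus_def)
      have Hi: "Hi \<in> components (hyp_locus (f \<infinity>))" "l1 \<in> Hi" "connected Hi" "Hi \<subseteq> hyp_locus (f \<infinity>)"
        using l1h unfolding Hi_def by (auto simp: componentsI connected_component_in intro: connected_component_subset)
      have "H' \<subseteq> Hi" unfolding Hi_def
        by (rule connected_component_maximal[OF l1(1) H'(2)]) (use hyp in \<open>auto simp: hyp_locus_def\<close>)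
      \<comment> \<open>Maximality of the kernel gives the reverse inclusion once the whole
        component qualifies as a candidate with the same marked point.\<close>
      have "kernel_candidate H p Hi"
        unfolding kernel_candidate_def
      proof (intro conjI allI impI)
        show "connected Hi" by (rule Hi(3))
        show "p \<in> Hi" using H'(3) \<open>H' \<subseteq> Hi\<close> by blast
        define Fm where "Fm = (\<lambda>(n, l). f n l)"
        have HolFm: "Fm x \<in> Hol_star_b" for x using Hol by (cases x) (simp add: Fm_def)
        have contFm: "continuous_wrt chi_prod (chi_dyn chi_luc) Fm" using assms(6) by (simp add: Fm_def)
        note continuity = chi_dyn_continuity[OF luc HolFm contFm]
        have holf: "f n l holomorphic_on UNIV" for n l using Hol[of n l] by (simp add: Hol_star_b_def Hol_star_holomorphic)
        have att: "all_attracted (f \<infinity> a)" if "a \<in> Hi" for a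
          using Hi(4) that hyperbolic_imp_all_attracted unfolding hyp_locus_def by blast
        \<comment> \<open>Near a hyperbolic parameter of the limit family all late maps are
          hyperbolic, but a priori in components other than \<open>H n\<close>; connectedness of
          \<open>N\<close> will tie them to \<open>H n\<close>.\<close>
        have nearinf: "\<exists>N. open N \<and> connected N \<and> a \<in> N \<and> N \<subseteq> Hi \<and> (\<forall>\<^sub>F n in sequentially. N \<subseteq> hyp_locus (f (enat n)))"
          if a: "a \<in> Hi" for a
        proof -
          note cn = continuity[of "(\<infinity>, a)" "\<lambda>l. (\<infinity>, l)" "nhds a", OF chi_prod_nhds]
          have "\<forall>\<^sub>F l in nhds a. all_attracted (f \<infinity> l)"
            using cn by (intro all_attracted_stable[OF Hol att[OF a] _ holf]) (simp_all add: Fm_def)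
          then obtain U1 where U1: "open U1" "a \<in> U1" "\<forall>l\<in>U1. all_attracted (f \<infinity> l)" unfolding eventually_nhds by blast
          note ci = continuity[of "(\<infinity>, a)" "\<lambda>x. (enat (fst x), snd x)" "sequentially \<times>\<^sub>F nhds a", OF chi_prod_infinity]
          have "\<forall>\<^sub>F x in sequentially \<times>\<^sub>F nhds a. all_attracted (f (enat (fst x)) (snd x))"
            using ci by (intro all_attracted_stable[OF Hol att[OF a] _ holf]) (simp_all add: Fm_def)
          then obtain A B where AB: "eventually A sequentially" "eventually B (nhds a)"
              "\<And>n l. A n \<Longrightarrow> B l \<Longrightarrow> all_attracted (f (enat n) l)"
            unfolding eventually_prod_filter by auto
          obtain U2 where U2: "open U2" "a \<in> U2" "\<forall>l\<in>U2. B l" using AB(2) unfolding eventually_nhds by blast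
          have o: "open (U1 \<inter> U2)" "a \<in> U1 \<inter> U2" using U1 U2 by auto
          obtain N C where N: "open N" "connected N" "a \<in> N" "N \<subseteq> C" "C \<subseteq> U1 \<inter> U2"
            by (rule atlas_neighbourhood[OF atlas o]) blast
          have "N \<subseteq> hyp_locus (f \<infinity>)"
            using N(4,5) U1(3) hyperbolic_iff_all_attracted[OF Hol] unfolding hyp_locus_def by blast
          then have "N \<subseteq> Hi" using components_maximal[OF Hi(1) N(2)] N(3) a by blast
          moreover have "\<forall>\<^sub>F n in sequentially. N \<subseteq> hyp_locus (f (enat n))"
            using AB(1)
          proof eventually_elim
            case (elim n)
            then show ?case using N(4,5) U2(3) AB(3) hyperbolic_iff_all_attracted[OF Hol] unfolding hyp_locus_def by blast
          qed
          ultimately show ?thesis using N by blast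
        qed
        show "open Hi" unfolding open_subopen[of Hi] using nearinf by blast
        \<comment> \<open>Local containment in almost all \<open>H n\<close> starts in the kernel,
          at \<open>l1\<close>, and spreads over the connected set \<open>Hi\<close>.\<close>
        define good where "good x \<longleftrightarrow> (\<exists>U. open U \<and> x \<in> U \<and> (\<forall>\<^sub>F n in sequentially. U \<subseteq> H n))" for x
        have "good l1"
        proof -
          obtain N C where N: "open N" "l1 \<in> N" "N \<subseteq> C" "compact C" "C \<subseteq> H'"
            by (rule atlas_neighbourhood[OF atlas H'(1) l1(1)]) blast
          have "\<forall>\<^sub>F n in sequentially. N \<subseteq> H n" using H'(4)[OF N(4,5)] by (rule eventually_mono) (use N(3) in blast)
          then show ?thesis unfolding good_def using N by blast
        qed
        have allgood: "good x" if x: "x \<in> Hi" for x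
        proof (rule connected_induction_simple[where P = good, OF Hi(3,2) x \<open>good l1\<close>])
          fix a assume "a \<in> Hi"
          then obtain N where N: "open N" "connected N" "a \<in> N" "N \<subseteq> Hi" "\<forall>\<^sub>F n in sequentially. N \<subseteq> hyp_locus (f (enat n))"
            using nearinf by blast
          have "good y" if xy: "x \<in> N" "y \<in> N" "good x" for x y
          proof -
            obtain U where U: "x \<in> U" "\<forall>\<^sub>F n in sequentially. U \<subseteq> H n" using xy(3) unfolding good_def by blast
            have "\<forall>\<^sub>F n in sequentially. N \<subseteq> H n"
              using U(2) N(5) comp
            proof eventually_elim
              case (elim n)
              \<comment> \<open>\<open>H n\<close> is a full component of the hyperbolic locus, so a
                connected subset \<open>N\<close> of the locus that meets it is contained in
                it.\<close>
              have "H n \<inter> N \<noteq> {}" using elim(1) U(1) xy(1) by blast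
              then show ?case using components_maximal[OF elim(3) N(2) elim(2)] by blast
            qed
            then show ?thesis unfolding good_def using N(1) xy(2) by blast
          qed
          then show "\<exists>T. openin (top_of_set Hi) T \<and> a \<in> T \<and> (\<forall>x\<in>T. \<forall>y\<in>T. good x \<longrightarrow> good y)"
            using N by (intro exI[of _ N] conjI open_subset) blast+
        qed
        fix K assume K: "compact K \<and> K \<subseteq> Hi"
        have "\<exists>M::real. \<forall>\<^sub>F n in sequentially. \<forall>x\<in>K. x \<in> H n"
        proof (rule eventually_on_compact)
          fix x assume "x \<in> K"
          then obtain U where U: "open U" "x \<in> U" "\<forall>\<^sub>F n in sequentially. U \<subseteq> H n" using allgood K unfolding good_def by blast
          have "\<forall>\<^sub>F n in sequentially. \<forall>y\<in>U. y \<in> H n" using U(3) by (rule eventually_mono) blast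
          then show "\<exists>U. open U \<and> x \<in> U \<and> (\<exists>M::real. \<forall>\<^sub>F n in sequentially. \<forall>y\<in>U. y \<in> H n)" using U by blast
        qed (use K in auto)
        then show "\<forall>\<^sub>F n in sequentially. K \<subseteq> H n" unfolding subset_eq by simp
      qed
      then have "Hi \<subseteq> H'" by (rule maxk)
      then have "H' = Hi" using \<open>H' \<subseteq> Hi\<close> by blast
      then show False using no Hi(1) by blast
    qed
  qed
qed

end
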